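(* Let $k,\ell$ be integers with $k\geq 3$ and $k/2\leq\ell\leq k-1$. Then there exist $\epsilon>0$ and $n_0$ such that the following holds. Let $\mathcal{H}_1,\ldots,\mathcal{H}_{n/k}$ be $k$-graphs on a vertex set $V$ with $|V|=n\geq n_0$ and $n\in k\mathbb{N}$, and let $\mathcal{T}=\mathcal{T}(\mathcal{H}_1,\ldots,\mathcal{H}_{n/k})$. If $\mathcal{T}$ is $\epsilon$-close to $\mathcal{T}_{ext}$ and $\delta_\ell(\mathcal{H}_i)>\delta(n,k,\ell)$ for every $1\leq i\leq n/k$, then $\mathcal{T}$ contains a perfect matching.
   Context: A $k$-graph on $V$ is a family $\mathcal{H}\subseteq\binom{V}{k}$. For $S\in\binom{V}{\ell}$, $\deg_{\mathcal{H}}(S)=|\{T: S\cup T\in\mathcal{H}\}|$ and $\delta_\ell(\mathcal{H})=\min_{S\in\binom{V}{\ell}}\deg_{\mathcal{H}}(S)$. For a partition $V=A\cup B$, $\mathcal{H}^0(A,B)$ (resp. $\mathcal{H}^1(A,B)$) is the $k$-graph of all $k$-subsets of $V$ meeting $A$ in an even (resp. odd) number of vertices. For $n=|V|\in k\mathbb{N}$, $ext(n,k)=\{\mathcal{H}^i(A,B): i\in\{0,1\}, A\cup B=V \text{ a partition}, in/k \text{ and } |A| \text{ of different parity}\}$ and $\delta(n,k,\ell)=\max_{\mathcal{H}\in ext(n,k)}\delta_\ell(\mathcal{H})$. $\mathcal{H}_{ext}$ denotes a fixed member $\mathcal{H}^i(A,B)$ of $ext(n,k)$ attaining $\delta_\ell(\mathcal{H}_{ext})=\delta(n,k,\ell)$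 with $-1\leq|A|-|B|\leq 1$ (such a member exists). Given $k$-graphs $\mathcal{H}_1,\ldots,\mathcal{H}_{n/k}$ on $V$, $\mathcal{T}(\mathcal{H}_1,\ldots,\mathcal{H}_{n/k})$ is the $(k+1)$-graph with vertex set $X\cup V$, where $X=\{x_1,\ldots,x_{n/k}\}$ is a set of new vertices, and edge set $\bigcup_{i}\{\{x_i\}\cup E: E\in\mathcal{H}_i\}$; and $\mathcal{T}_{ext}=\mathcal{T}(\mathcal{H}_{ext},\ldots,\mathcal{H}_{ext})$ ($n/k$ copies). An $r$-graph $\mathcal{H}$ is $\epsilon$-close to an $r$-graph $\mathcal{H}'$ on the same vertex set if $\mathcal{H}$ can be made into a copy of $\mathcal{H}'$ by adding and deleting at most $\epsilon|V(\mathcal{H})|^r$ edges.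
   Formalization: The context's balanced H_ext attaining δ(n,k,ℓ) need not exist (e.g. k=4, 8|n: |A|=|B|=n/2 and n/k are even, so no balanced member of ext(n,k)); here H_ext is any balanced maximiser when one exists, and otherwise any member of ext(n,k) attaining δ(n,k,ℓ). *)

theory Defs
  imports Complex_Main "HOL-Library.Ramsey" "HOL-Library.Disjoint_Sets"
begin

text \<open>A k-graph on a finite vertex set \<open>V\<close> is a set of edges \<open>H \<subseteq> nsets V k\<close>.\<close>

text \<open>The sets \<open>T\<close> in the definition of the degree are the complementary ones, disjoint from \<open>S\<close>,
  so that the degree is the number of edges containing \<open>S\<close>.\<close>

definition deg :: "'a set set \<Rightarrow> 'a set \<Rightarrow> nat" where
  "deg H S = card {T. S \<inter> T = {} \<and> S \<union> T \<in> H}"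

definition min_deg :: "'a set \<Rightarrow> nat \<Rightarrow> 'a set set \<Rightarrow> nat" where
  "min_deg V l H = Min (deg H ` nsets V l)"

definition parity_graph :: "nat \<Rightarrow> nat \<Rightarrow> 'a set \<Rightarrow> 'a set \<Rightarrow> 'a set set" where
  "parity_graph k i A B = {E \<in> nsets (A \<union> B) k. card (E \<inter> A) mod 2 = i}"

definition ext_triple :: "'a set \<Rightarrow> nat \<Rightarrow> nat \<Rightarrow> 'a set \<Rightarrow> 'a set \<Rightarrow> bool" where
  "ext_triple V k i A B \<longleftrightarrow>
     i \<in> {0, 1} \<and> A \<union> B = V \<and> A \<inter> B = {} \<and>
     (even (i * (card V div k)) \<longleftrightarrow> odd (card A))"

definition ext :: "'a set \<Rightarrow> nat \<Rightarrow> 'a set set set" where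
  "ext V k = {parity_graph k i A B | i A B. ext_triple V k i A B}"

text \<open>This is \<open>\<delta>(n,k,l)\<close> with \<open>n = card V\<close>; it depends on \<open>V\<close> only through \<open>n\<close>.\<close>

definition delta_ext :: "'a set \<Rightarrow> nat \<Rightarrow> nat \<Rightarrow> nat" where
  "delta_ext V k l = Max (min_deg V l ` ext V k)"

definition attains :: "'a set \<Rightarrow> nat \<Rightarrow> nat \<Rightarrow> nat \<Rightarrow> 'a set \<Rightarrow> 'a set \<Rightarrow> bool" where
  "attains V k l i A B \<longleftrightarrow>
     ext_triple V k i A B \<and> min_deg V l (parity_graph k i A B) = delta_ext V k l"

definition balanced :: "'a set \<Rightarrow> 'a set \<Rightarrow> bool" where
  "balanced A B \<longleftrightarrow>
     - 1 \<le> int (card A) - int (card B) \<and> int (card A) - int (card B) \<le> 1"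

text \<open>\<open>is_H_ext V k l G\<close>: \<open>G\<close> is an admissible choice of the fixed k-graph \<open>H_ext\<close>, that is, a member
  of \<open>ext V k\<close> attaining the maximum, with a balanced partition. The existence of a balanced
  maximiser fails for some parameters (for instance \<open>k = 4\<close>, \<open>l = 3\<close> and \<open>n\<close> divisible by 8, where
  no balanced partition satisfies the parity condition). So that the notion is not empty then,
  the balance condition is imposed exactly when some balanced partition attains the maximum.\<close>

definition is_H_ext :: "'a set \<Rightarrow> nat \<Rightarrow> nat \<Rightarrow> 'a set set \<Rightarrow> bool" where
  "is_H_ext V k l G \<longleftrightarrow>
     (\<exists>i A B. G = parity_graph k i A B \<and> attains V k l i A B \<and>
        ((\<exists>i' A' B'. attains V k l i' A' B' \<and> balanced A' B') \<longrightarrow> balanced A B))"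

text \<open>The new vertices \<open>x\<^sub>1, \<dots>, x\<^sub>m\<close> are \<open>Inl 1, \<dots>, Inl m\<close>; the vertices of \<open>V\<close> are embedded by \<open>Inr\<close>.\<close>

definition T_verts :: "nat \<Rightarrow> 'a set \<Rightarrow> (nat + 'a) set" where
  "T_verts m V = {1..m} <+> V"

definition T_graph :: "nat \<Rightarrow> (nat \<Rightarrow> 'a set set) \<Rightarrow> (nat + 'a) set set" where
  "T_graph m H = (\<Union>i\<in>{1..m}. {{Inl i} \<union> Inr ` E | E. E \<in> H i})"

text \<open>For r-graphs on the vertex set \<open>W\<close>. A copy is an image under an arbitrary permutation of
  \<open>W\<close>; for the graphs \<open>T_graph\<close> it need not respect the two parts.\<close>

definition is_copy :: "'v set \<Rightarrow> 'v set set \<Rightarrow> 'v set set \<Rightarrow> bool" where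
  "is_copy W G' G \<longleftrightarrow> (\<exists>f. bij_betw f W W \<and> G' = (\<lambda>E. f ` E) ` G)"

definition close_to :: "real \<Rightarrow> nat \<Rightarrow> 'v set \<Rightarrow> 'v set set \<Rightarrow> 'v set set \<Rightarrow> bool" where
  "close_to \<epsilon> r W G G' \<longleftrightarrow>
     (\<exists>C. is_copy W C G' \<and> real (card (sym_diff G C)) \<le> \<epsilon> * real (card W) ^ r)"

definition perfect_matching :: "'v set \<Rightarrow> 'v set set \<Rightarrow> 'v set set \<Rightarrow> bool" where
  "perfect_matching W G M \<longleftrightarrow> M \<subseteq> G \<and> disjoint M \<and> \<Union>M = W"

end

(* Write n = k m. After discarding the permutation in the notion of closeness, there is a nearly
   balanced partition V = A \<union> B such that almost all edges of H^i(A,B) lie in almost all H_j.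
   Call a colour or a vertex bad if many of its edges of H^i(A,B) are missing; there are few bad
   elements. A bad vertex is moved to the other side of the partition if most of its edges have the
   wrong parity, and every bad element is then covered greedily by a disjoint edge containing no other
   bad element. Vertex edges have parity i, while a bad colour may be forced to use parity 1 - i.
   Summing the parities of |E \<inter> A| over a perfect matching shows that the number of edges of parity
   1 - i is determined modulo 2. If it comes out wrong, one additional edge corrects it: either every
   H_j has an edge of parity 1 - i, and we put such an edge in a good colour; or every H_j has an edge
   of parity i, and we use one for a bad colour of parity 1 - i. One of the two always holds: if
   neither H^0(A,B) nor H^1(A,B) is in ext, then m and |A| are even, and moving one vertex from A to B
   gives members of ext, one of which has l-degree at least the smaller of the two l-degrees
   delta_l(H^0(A,B)), delta_l(H^1(A,B)).

   The rest splits into two or three nearly complete (k+1)-partite pieces, according to |E \<inter> A|.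
   In each piece take any transversal partition into rows. A row e_0 that is not an edge is repaired by
   choosing k other rows e_1, ..., e_k and shifting the c-th column of the array e_0, ..., e_k cyclically
   by c: each new row contains exactly one entry of e_0, so for few choices some new row is a non-edge.

   Near-balance of an extremal partition comes from S_r = sum of (-1)^|T \<inter> A| over the r-sets T:
   with D = |B| - |A|, r! S_r = D^r + O(n^(r-1)), and the l-degree of a parity graph is
   (binomial(n-l, k-l) \<plusminus> S_(k-l)) / 2 with both signs occurring. *)

theory Submission
  imports Defs "HOL-Combinatorics.Cycles"
begin

section \<open>Matchings in nearly complete multipartite hypergraphs\<close>

text \<open>Balance cannot be taken from \<open>is_H_ext\<close>, which asks for it only when some
  balanced partition attains the maximum. It is therefore proved for every maximiser, with an error
  of an arbitrarily small multiple of n, and every later step tolerates such an error. The switching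
  step dictates the numerical scheme: an element that is not bad misses at most \<eta> m^k edges for
  a small constant \<eta>, while a defective row in a piece with x rows can be switched in about x^k
  ways. So every piece must have x of order m. This is why three intersection sizes are used when k
  is even and k / 2 has parity i: the mean of |E \<inter> A| may be almost exactly k / 2, and with
  two sizes one piece could be nearly empty. Comparing the H_j with the exact threshold
  \<delta>(n,k,l) matters for the parity correction: a graph above it lies in no member of ext and
  so has an edge of the other parity. Otherwise only the order n^(k - l) of their l-degrees counts:
  it gives every colour and every vertex degree of order m^k, so that the greedy covering survives a
  small linear number of forbidden elements.\<close>

definition transversals :: "(nat \<Rightarrow> nat \<Rightarrow> 'w) \<Rightarrow> nat \<Rightarrow> nat \<Rightarrow> 'w set set" where
  "transversals \<Psi> N Q = {(\<lambda>c. \<Psi> (\<rho> c) c) ` {..<Q} | \<rho>. \<rho> ` {..<Q} \<subseteq> {..<N}}"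

text \<open>The list \<open>js\<close> starts with the defective row \<open>r0\<close> and is
  completed by Q - 1 further rows, in (N - 1) ... (N - Q + 1) ways. For fixed s the s-th new row
  contains exactly one entry of \<open>r0\<close> and determines the whole list, so at most
  \<open>\<mu>\<close> lists make it a non-edge. Summing over the Q new rows, \<open>big\<close>
  leaves a list for which all of them are edges.\<close>

lemma switching_step:
  fixes \<Psi> :: "nat \<Rightarrow> nat \<Rightarrow> 'w" and T :: "'w set set"
  assumes inj: "inj_on (\<lambda>(r, c). \<Psi> r c) ({..<N} \<times> {..<Q})"
    and miss: "\<And>r c. r < N \<Longrightarrow> c < Q \<Longrightarrow> card {E \<in> transversals \<Psi> N Q. \<Psi> r c \<in> E \<and> E \<notin> T} \<le> \<mu>"
    and Q: "0 < Q" "Q \<le> N"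
    and big: "Q * \<mu> < \<Prod>{N - Q + 1..N - 1}"
    and r0: "r0 < N"
    and perm: "\<And>c. c < Q \<Longrightarrow> \<pi> c permutes {..<N}"
  obtains js where "length js = Q" "distinct js" "set js \<subseteq> {..<N}" "hd js = r0"
    "\<And>s. s < Q \<Longrightarrow> (\<lambda>c. \<Psi> (\<pi> c (js ! ((s + c) mod Q))) c) ` {..<Q} \<in> T"
proof -
  define L where "L = {xs. length xs = Q - 1 \<and> distinct xs \<and> set xs \<subseteq> {..<N} - {r0}}"
  define ed where "ed s xs = (\<lambda>c. \<Psi> (\<pi> c ((r0 # xs) ! ((s + c) mod Q))) c) ` {..<Q}" for s xs
  define Bd where "Bd s = {xs \<in> L. ed s xs \<notin> T}" for s
  have cN: "card ({..<N} - {r0}) = N - 1"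
    using r0 by simp
  have cL: "card L = \<Prod>{N - Q + 1..N - 1}"
    using card_lists_distinct_length_eq[of "{..<N} - {r0}" "Q - 1"] cN Q
    unfolding L_def by (simp add: algebra_simps Suc_diff_le)
  have finL: "finite L"
    by (rule finite_subset[OF _ finite_lists_length_eq[of "{..<N} - {r0}" "Q - 1"]])
      (auto simp: L_def)
  have finG: "finite (transversals \<Psi> N Q)"
  proof (rule finite_subset)
    show "transversals \<Psi> N Q \<subseteq> Pow ((\<lambda>(r, c). \<Psi> r c) ` ({..<N} \<times> {..<Q}))"
      using imageI by (auto simp: transversals_def image_subset_iff)
  qed simp
  have elt: "(r0 # xs) ! i < N" if "xs \<in> L" "i < Q" for xs i
  proof -
    have "(r0 # xs) ! i \<in> set (r0 # xs)"
      using that Q by (intro nth_mem) (auto simp: L_def)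
    then show ?thesis
      using that r0 by (auto simp: L_def)
  qed
  have piN: "\<pi> c x < N" if "c < Q" "x < N" for c x
    using permutes_in_image[OF perm[OF that(1)], of x] that(2) by simp
  have Bs: "card (Bd s) \<le> \<mu>" if s: "s < Q" for s
  proof -
    \<comment> \<open>The column in which the s-th new row takes its entry from \<open>r0\<close>;
      the outer \<open>mod\<close> covers s = 0.\<close>
    define c0 where "c0 = (Q - s) mod Q"
    have c0: "c0 < Q" "(s + c0) mod Q = 0"
      using s Q by (auto simp: c0_def mod_add_right_eq)
    let ?w = "\<Psi> (\<pi> c0 r0) c0"
    \<comment> \<open>Injectivity of \<open>\<Psi>\<close> recovers the entry in each column, the
      column permutation gives back the row, and as c runs over all columns, (s + c) mod Q runs over
      all positions of the list.\<close>
    have "inj_on (ed s) (Bd s)"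
    proof (rule inj_onI)
      fix xs ys assume xs: "xs \<in> Bd s" and ys: "ys \<in> Bd s" and eq: "ed s xs = ed s ys"
      have xsL: "xs \<in> L" and ysL: "ys \<in> L" using xs ys by (auto simp: Bd_def)
      have *: "(r0 # xs) ! ((s + c) mod Q) = (r0 # ys) ! ((s + c) mod Q)" if c: "c < Q" for c
      proof -
        have "\<Psi> (\<pi> c ((r0 # xs) ! ((s + c) mod Q))) c \<in> ed s ys"
          using c unfolding eq[symmetric] by (auto simp: ed_def)
        then obtain d where d: "d < Q"
          "\<Psi> (\<pi> c ((r0 # xs) ! ((s + c) mod Q))) c = \<Psi> (\<pi> d ((r0 # ys) ! ((s + d) mod Q))) d"
          by (auto simp: ed_def)
        have "(\<pi> c ((r0 # xs) ! ((s + c) mod Q)), c) = (\<pi> d ((r0 # ys) ! ((s + d) mod Q)), d)"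
          using d c Q elt[OF xsL] elt[OF ysL] piN
          by (intro inj_onD[OF inj]) auto
        then show ?thesis
          using permutes_inj[OF perm[OF c]] by (auto dest: injD)
      qed
      have "(r0 # xs) ! i = (r0 # ys) ! i" if i: "i < Q" for i
      proof -
        have "(s + (i + (Q - s)) mod Q) mod Q = i"
          using s i by (simp add: mod_add_right_eq)
        then show ?thesis
          using *[of "(i + (Q - s)) mod Q"] Q by simp
      qed
      then have "r0 # xs = r0 # ys"
        using xsL ysL Q by (intro nth_equalityI) (auto simp: L_def)
      then show "xs = ys" by simp
    qed
    moreover have "ed s ` Bd s \<subseteq> {E \<in> transversals \<Psi> N Q. ?w \<in> E \<and> E \<notin> T}"
    proof clarify
      fix xs assume xs: "xs \<in> Bd s"
      then have xsL: "xs \<in> L" by (auto simp: Bd_def)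
      have "ed s xs \<in> transversals \<Psi> N Q"
        unfolding transversals_def ed_def using piN elt[OF xsL] Q
        by (intro CollectI exI[of _ "\<lambda>c. \<pi> c ((r0 # xs) ! ((s + c) mod Q))"]) auto
      moreover have "?w \<in> ed s xs"
        unfolding ed_def using c0 by (intro image_eqI[of _ _ c0]) auto
      ultimately show "ed s xs \<in> transversals \<Psi> N Q \<and> ?w \<in> ed s xs \<and> ed s xs \<notin> T"
        using xs by (auto simp: Bd_def)
    qed
    moreover have "finite {E \<in> transversals \<Psi> N Q. ?w \<in> E \<and> E \<notin> T}" using finG by simp
    ultimately have "card (Bd s) \<le> card {E \<in> transversals \<Psi> N Q. ?w \<in> E \<and> E \<notin> T}"
      using card_inj_on_le by blast
    also have "\<dots> \<le> \<mu>" using miss piN c0 r0 by blast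
    finally show ?thesis .
  qed
  have "card (\<Union>s<Q. Bd s) \<le> (\<Sum>s<Q. card (Bd s))" by (rule card_UN_le) simp
  also have "\<dots> \<le> (\<Sum>s<Q. \<mu>)" using Bs by (intro sum_mono) auto
  also have "\<dots> < card L" using big cL by simp
  finally have "\<not> L \<subseteq> (\<Union>s<Q. Bd s)"
    using card_mono[of "\<Union>s<Q. Bd s" L] finL by (auto simp: Bd_def not_le)
  then obtain xs where xs: "xs \<in> L" "\<And>s. s < Q \<Longrightarrow> ed s xs \<in> T"
    by (auto simp: Bd_def)
  show ?thesis
    by (rule that[of "r0 # xs"]) (use xs Q r0 in \<open>auto simp: L_def ed_def\<close>)
qed

text \<open>A partition into rows is stored as one permutation of the row indices per column,
  initially the identity. A switch turns all rows in \<open>js\<close> into edges and leaves the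
  others alone, so induction on the number of defective rows applies.\<close>

lemma partite_matching:
  fixes \<Psi> :: "nat \<Rightarrow> nat \<Rightarrow> 'w" and T :: "'w set set"
  assumes inj: "inj_on (\<lambda>(r, c). \<Psi> r c) ({..<N} \<times> {..<Q})"
    and miss: "\<And>r c. r < N \<Longrightarrow> c < Q \<Longrightarrow> card {E \<in> transversals \<Psi> N Q. \<Psi> r c \<in> E \<and> E \<notin> T} \<le> \<mu>"
    and Q: "0 < Q" "Q \<le> N"
    and big: "Q * \<mu> < \<Prod>{N - Q + 1..N - 1}"
  shows "\<exists>M. perfect_matching ((\<lambda>(r, c). \<Psi> r c) ` ({..<N} \<times> {..<Q})) T M"
proof -
  define row where "row \<pi> r = (\<lambda>c. \<Psi> (\<pi> c r) c) ` {..<Q}" for \<pi> :: "nat \<Rightarrow> nat \<Rightarrow> nat" and r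
  have "\<exists>\<pi>. (\<forall>c<Q. \<pi> c permutes {..<N}) \<and> (\<forall>r<N. row \<pi> r \<in> T)"
    if "\<forall>c<Q. \<pi> c permutes {..<N}" for \<pi>
    using that
  proof (induction "card {r. r < N \<and> row \<pi> r \<notin> T}" arbitrary: \<pi> rule: less_induct)
    case less
    show ?case
    proof (cases "\<exists>r0<N. row \<pi> r0 \<notin> T")
      case False
      then show ?thesis using less.prems by blast
    next
      case True
      then obtain r0 where r0: "r0 < N" "row \<pi> r0 \<notin> T" by blast
      obtain js where js: "length js = Q" "distinct js" "set js \<subseteq> {..<N}" "hd js = r0"
        "\<And>s. s < Q \<Longrightarrow> (\<lambda>c. \<Psi> (\<pi> c (js ! ((s + c) mod Q))) c) ` {..<Q} \<in> T"
        using switching_step[OF inj miss Q big r0(1), of \<pi>] less.prems by blast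
      \<comment> \<open>Column c is rotated by c steps along the cycle through \<open>js\<close>;
        \<open>rot\<close> matches the result with the index (s + c) mod Q of the switching
        step.\<close>
      define \<pi>' where "\<pi>' c = \<pi> c \<circ> (cycle_of_list js ^^ c)" for c
      have cyc: "(cycle_of_list js ^^ c) permutes set js" for c
        using cycle_permutes permutes_funpow by blast
      have p': "\<pi>' c permutes {..<N}" if "c < Q" for c
        unfolding \<pi>'_def using less.prems that permutes_subset[OF cyc js(3)]
        by (intro permutes_compose) auto
      have rot: "(cycle_of_list js ^^ c) (js ! s) = js ! ((s + c) mod Q)" if "s < Q" for c s
      proof -
        have "(cycle_of_list js ^^ c) (js ! s) = map (cycle_of_list js ^^ c) js ! s"
          using that js(1) by simp
        also have "\<dots> = rotate c js ! s"
          using cyclic_rotation[of js c] js(2) by simp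
        also have "\<dots> = js ! ((s + c) mod Q)"
          using that js(1) by (simp add: nth_rotate add.commute)
        finally show ?thesis .
      qed
      have new: "row \<pi>' r \<in> T" if r: "r \<in> set js" for r
      proof -
        obtain s where s: "s < Q" "r = js ! s" using r js(1) unfolding in_set_conv_nth by blast
        show ?thesis using js(5)[OF s(1)] s rot unfolding row_def \<pi>'_def by simp
      qed
      have old: "row \<pi>' r = row \<pi> r" if "r \<notin> set js" for r
        using permutes_not_in[OF cyc that] unfolding row_def \<pi>'_def by simp
      have "r0 \<in> set js" using js(1,4) Q by (cases js) auto
      moreover have "row \<pi> r \<notin> T" if "row \<pi>' r \<notin> T" for r
        using new[of r] old[of r] that by (cases "r \<in> set js") auto
      ultimately have "{r. r < N \<and> row \<pi>' r \<notin> T} \<subset> {r. r < N \<and> row \<pi> r \<notin> T}"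
        by (intro psubsetI subsetI) (use new r0 in auto)
      then have "card {r. r < N \<and> row \<pi>' r \<notin> T} < card {r. r < N \<and> row \<pi> r \<notin> T}"
        by (intro psubset_card_mono) auto
      then show ?thesis using less.hyps p' by blast
    qed
  qed
  from this[of "\<lambda>_. id"] obtain \<pi> where \<pi>: "\<forall>c<Q. \<pi> c permutes {..<N}" "\<forall>r<N. row \<pi> r \<in> T"
    by (auto simp: permutes_id)
  have piN: "\<pi> c x < N" if "c < Q" "x < N" for c x
    using permutes_in_image[of "\<pi> c" "{..<N}" x] \<pi>(1) that by simp
  have dis: "row \<pi> r \<inter> row \<pi> r' = {}" if r: "r < N" "r' < N" "r \<noteq> r'" for r r'
  proof (rule ccontr)
    assume "row \<pi> r \<inter> row \<pi> r' \<noteq> {}"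
    then obtain c d where cd: "c < Q" "d < Q" "\<Psi> (\<pi> c r) c = \<Psi> (\<pi> d r') d"
      by (auto simp: row_def)
    have "(\<pi> c r, c) = (\<pi> d r', d)"
      using cd r piN by (intro inj_onD[OF inj]) auto
    then show False
      using permutes_inj[of "\<pi> c" "{..<N}"] \<pi>(1) cd r by (auto dest: injD)
  qed
  have "perfect_matching ((\<lambda>(r, c). \<Psi> r c) ` ({..<N} \<times> {..<Q})) T (row \<pi> ` {..<N})"
    unfolding perfect_matching_def
  proof (intro conjI)
    show "row \<pi> ` {..<N} \<subseteq> T" using \<pi> by auto
    show "disjoint (row \<pi> ` {..<N})"
      by (rule disjointI) (use dis in auto)
    show "\<Union> (row \<pi> ` {..<N}) = (\<lambda>(r, c). \<Psi> r c) ` ({..<N} \<times> {..<Q})"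
    proof (intro equalityI subsetI)
      fix x assume "x \<in> (\<lambda>(r, c). \<Psi> r c) ` ({..<N} \<times> {..<Q})"
      then obtain r c where rc: "r < N" "c < Q" "x = \<Psi> r c" by auto
      then obtain r' where "r' < N" "\<pi> c r' = r"
        using permutes_image[of "\<pi> c" "{..<N}"] \<pi>(1) by (metis imageE lessThan_iff)
      then show "x \<in> \<Union> (row \<pi> ` {..<N})" using rc by (auto simp: row_def)
    qed (use piN in \<open>force simp: row_def\<close>)
  qed
  then show ?thesis by blast
qed

section \<open>Pieces in which all edges have the same |E \<inter> A|\<close>

text \<open>With a parity graph for \<open>P\<close> this is the complete model against which
  \<open>T\<close> is compared. Unlike \<open>T_graph\<close>, it allows an arbitrary set of
  colours, so that it can be restricted to the part left over by a partial matching.\<close>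

definition tedges :: "nat set \<Rightarrow> 'a set set \<Rightarrow> (nat + 'a) set set" where
  "tedges J P = {insert (Inl j) (Inr ` e) | j e. j \<in> J \<and> e \<in> P}"

lemma finite_tedges: "finite J \<Longrightarrow> finite P \<Longrightarrow> finite (tedges J P)"
proof -
  assume "finite J" "finite P"
  moreover have "tedges J P = (\<lambda>(j, e). insert (Inl j) (Inr ` e)) ` (J \<times> P)"
    by (auto simp: tedges_def)
  ultimately show ?thesis by simp
qed

lemma perfect_matching_Un:
  assumes "perfect_matching W1 T M1" "perfect_matching W2 T M2" "W1 \<inter> W2 = {}"
  shows "perfect_matching (W1 \<union> W2) T (M1 \<union> M2)"
proof -
  have "disjoint (M1 \<union> M2)"
    using assms by (intro disjoint_union) (auto simp: perfect_matching_def)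
  then show ?thesis using assms by (auto simp: perfect_matching_def)
qed

text \<open>Column 0 of the array holds the colours, columns 1, ..., t the vertices of
  \<open>A\<close> and the remaining k - t columns those of \<open>B\<close>, with \<open>x\<close>
  entries each. Every transversal then meets \<open>A\<close> in exactly t vertices, so its absence
  from \<open>T\<close> is counted by \<open>miss\<close>.\<close>

lemma type_class_matching:
  fixes J :: "nat set" and A B :: "'a set"
  assumes fin: "finite J" "finite A" "finite B" and AB: "A \<inter> B = {}" and t: "t \<le> k"
    and card: "card J = x" "card A = t * x" "card B = (k - t) * x"
    and miss: "\<And>w. w \<in> Inl ` J \<union> Inr ` (A \<union> B) \<Longrightarrow>
      card {E \<in> tedges J {e \<in> nsets (A \<union> B) k. card (e \<inter> A) = t}. w \<in> E \<and> E \<notin> T} \<le> \<mu>"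
    and big: "k + 1 \<le> x" "(k + 1) * \<mu> < \<Prod>{x - k..x - 1}"
  shows "\<exists>M. perfect_matching (Inl ` J \<union> Inr ` (A \<union> B)) T M"
proof -
  obtain hJ where hJ: "bij_betw hJ {..<x} J"
    using fin card by (metis card_lessThan finite_lessThan finite_same_card_bij)
  obtain hA where hA: "bij_betw hA ({..<x} \<times> {..<t}) A"
    using finite_same_card_bij[of "{..<x} \<times> {..<t}" A] fin card by (auto simp: mult.commute)
  obtain hB where hB: "bij_betw hB ({..<x} \<times> {t..<k}) B"
    using finite_same_card_bij[of "{..<x} \<times> {t..<k}" B] fin card by (auto simp: mult.commute)
  define g where "g r c = (if c < t then hA (r, c) else hB (r, c))" for r c :: nat
  define \<Psi> where "\<Psi> r c = (case c of 0 \<Rightarrow> Inl (hJ r) | Suc c' \<Rightarrow> Inr (g r c'))" for r c :: nat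
  have gA: "g r c \<in> A" if "r < x" "c < t" for r c
    using that bij_betwE[OF hA] by (auto simp: g_def)
  have gB: "g r c \<in> B" if "r < x" "\<not> c < t" "c < k" for r c
    using that bij_betwE[OF hB] by (auto simp: g_def)
  have g_inj: "r = r' \<and> c = c'"
    if "r < x" "r' < x" "c < k" "c' < k" "g r c = g r' c'" for r r' c c'
  proof (cases "c < t"; cases "c' < t")
    assume "c < t" "c' < t"
    then show ?thesis using inj_onD[OF bij_betw_imp_inj_on[OF hA], of "(r, c)" "(r', c')"] that
      by (simp add: g_def)
  next
    assume "\<not> c < t" "\<not> c' < t"
    then show ?thesis using inj_onD[OF bij_betw_imp_inj_on[OF hB], of "(r, c)" "(r', c')"] that
      by (simp add: g_def)
  next
    assume "c < t" "\<not> c' < t"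
    then show ?thesis using gA[of r c] gB[of r' c'] that AB by auto
  next
    assume "\<not> c < t" "c' < t"
    then show ?thesis using gB[of r c] gA[of r' c'] that AB by auto
  qed
  have inj: "inj_on (\<lambda>(r, c). \<Psi> r c) ({..<x} \<times> {..<Suc k})"
  proof (rule inj_onI)
    fix p q assume pq: "p \<in> {..<x} \<times> {..<Suc k}" "q \<in> {..<x} \<times> {..<Suc k}"
      "(case p of (r, c) \<Rightarrow> \<Psi> r c) = (case q of (r, c) \<Rightarrow> \<Psi> r c)"
    obtain r c r' c' where [simp]: "p = (r, c)" "q = (r', c')" by (cases p; cases q)
    show "p = q"
      using pq g_inj[of r r'] inj_onD[OF bij_betw_imp_inj_on[OF hJ], of r r']
      by (auto simp: \<Psi>_def split: nat.splits)
  qed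
  have img: "(\<lambda>(r, c). \<Psi> r c) ` ({..<x} \<times> {..<Suc k}) = Inl ` J \<union> Inr ` (A \<union> B)"
  proof (intro equalityI subsetI)
    fix w assume "w \<in> (\<lambda>(r, c). \<Psi> r c) ` ({..<x} \<times> {..<Suc k})"
    then show "w \<in> Inl ` J \<union> Inr ` (A \<union> B)"
      using gA gB bij_betwE[OF hJ] by (auto simp: \<Psi>_def split: nat.splits) blast+
  next
    fix w assume "w \<in> Inl ` J \<union> Inr ` (A \<union> B)"
    then consider j where "j \<in> J" "w = Inl j" | a where "a \<in> A" "w = Inr a"
      | b where "b \<in> B" "w = Inr b" by auto
    then show "w \<in> (\<lambda>(r, c). \<Psi> r c) ` ({..<x} \<times> {..<Suc k})"
    proof cases
      case 1
      then obtain r where "r < x" "j = hJ r" using hJ by (auto simp: bij_betw_def)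
      then show ?thesis using 1 by (intro image_eqI[of _ _ "(r, 0)"]) (auto simp: \<Psi>_def)
    next
      case 2
      then obtain r c where "r < x" "c < t" "a = hA (r, c)" using hA by (auto simp: bij_betw_def)
      then show ?thesis using 2 t
        by (intro image_eqI[of _ _ "(r, Suc c)"]) (auto simp: \<Psi>_def g_def)
    next
      case 3
      then obtain r c where "r < x" "t \<le> c" "c < k" "b = hB (r, c)"
        using hB by (auto simp: bij_betw_def)
      then show ?thesis using 3 t
        by (intro image_eqI[of _ _ "(r, Suc c)"]) (auto simp: \<Psi>_def g_def)
    qed
  qed
  let ?G = "tedges J {e \<in> nsets (A \<union> B) k. card (e \<inter> A) = t}"
  have tr: "transversals \<Psi> x (Suc k) \<subseteq> ?G"
  proof
    fix E assume "E \<in> transversals \<Psi> x (Suc k)"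
    then obtain \<rho> where \<rho>: "\<rho> ` {..<Suc k} \<subseteq> {..<x}" "E = (\<lambda>c. \<Psi> (\<rho> c) c) ` {..<Suc k}"
      by (auto simp: transversals_def)
    define e where "e = (\<lambda>c. g (\<rho> (Suc c)) c) ` {..<k}"
    have r: "\<rho> c < x" if "c \<le> k" for c using \<rho>(1) that by (auto simp: image_subset_iff)
    have E: "E = insert (Inl (hJ (\<rho> 0))) (Inr ` e)"
      unfolding \<rho>(2) e_def lessThan_Suc_eq_insert_0 by (auto simp: \<Psi>_def image_image)
    have ginj: "inj_on (\<lambda>c. g (\<rho> (Suc c)) c) {..<k}"
    proof (rule inj_onI)
      fix c d assume "c \<in> {..<k}" "d \<in> {..<k}" "g (\<rho> (Suc c)) c = g (\<rho> (Suc d)) d"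
      then show "c = d" using g_inj[of "\<rho> (Suc c)" "\<rho> (Suc d)" c d] r by (simp add: Suc_le_eq)
    qed
    have sub: "e \<subseteq> A \<union> B"
    proof
      fix a assume "a \<in> e"
      then obtain c where "c < k" "a = g (\<rho> (Suc c)) c" by (auto simp: e_def)
      then show "a \<in> A \<union> B"
        using gA[of "\<rho> (Suc c)" c] gB[of "\<rho> (Suc c)" c] r[of "Suc c"] by (cases "c < t") auto
    qed
    have "e \<inter> A = (\<lambda>c. g (\<rho> (Suc c)) c) ` {..<t}"
    proof (intro equalityI subsetI)
      fix a assume "a \<in> e \<inter> A"
      then obtain c where c: "c < k" "a = g (\<rho> (Suc c)) c" "a \<in> A" by (auto simp: e_def)
      then have "c < t" using gB[of "\<rho> (Suc c)" c] r[of "Suc c"] AB by auto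
      then show "a \<in> (\<lambda>c. g (\<rho> (Suc c)) c) ` {..<t}" using c by auto
    next
      fix a assume "a \<in> (\<lambda>c. g (\<rho> (Suc c)) c) ` {..<t}"
      then obtain c where "c < t" "a = g (\<rho> (Suc c)) c" by auto
      then show "a \<in> e \<inter> A" using gA[of "\<rho> (Suc c)" c] r[of "Suc c"] t by (auto simp: e_def)
    qed
    moreover have "card ((\<lambda>c. g (\<rho> (Suc c)) c) ` {..<t}) = t"
      using inj_on_subset[OF ginj, of "{..<t}"] t by (subst card_image) auto
    moreover have "card e = k" "finite e"
      using card_image[OF ginj] by (auto simp: e_def)
    moreover have "hJ (\<rho> 0) \<in> J" using bij_betwE[OF hJ] r[of 0] by auto
    ultimately show "E \<in> ?G"
      using sub unfolding tedges_def E nsets_def mem_Collect_eq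
      by (intro exI[of _ "hJ (\<rho> 0)"] exI[of _ e]) simp
  qed
  have "finite ?G"
    using fin by (intro finite_tedges) (simp_all add: finite_imp_finite_nsets)
  have "\<exists>M. perfect_matching ((\<lambda>(r, c). \<Psi> r c) ` ({..<x} \<times> {..<Suc k})) T M"
  proof (rule partite_matching[OF inj])
    fix r c assume rc: "r < x" "c < Suc k"
    have "card {E \<in> transversals \<Psi> x (Suc k). \<Psi> r c \<in> E \<and> E \<notin> T} \<le>
      card {E \<in> ?G. \<Psi> r c \<in> E \<and> E \<notin> T}"
      using tr \<open>finite ?G\<close> by (intro card_mono) auto
    also have "\<dots> \<le> \<mu>"
    proof (rule miss)
      have "\<Psi> r c \<in> (\<lambda>(r, c). \<Psi> r c) ` ({..<x} \<times> {..<Suc k})" using rc by (intro image_eqI[of _ _ "(r, c)"]) simp_all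
      then show "\<Psi> r c \<in> Inl ` J \<union> Inr ` (A \<union> B)" unfolding img .
    qed
    finally show "card {E \<in> transversals \<Psi> x (Suc k). \<Psi> r c \<in> E \<and> E \<notin> T} \<le> \<mu>" .
  qed (use big in \<open>auto simp: Suc_diff_Suc\<close>)
  then show ?thesis unfolding img .
qed

text \<open>A pair (t, x) in \<open>ps\<close> prescribes x edges meeting \<open>A\<close> in t
  vertices, and the pieces are cut off one at a time. The bound on missing edges refers to fixed
  ambient sets \<open>J0\<close>, \<open>A0\<close>, \<open>B0\<close>, so it passes to every
  remainder while the induction varies \<open>J\<close>, \<open>A\<close>, \<open>B\<close>.\<close>

lemma classes_matching:
  fixes J0 :: "nat set" and A0 B0 :: "'a set"
  assumes fin0: "finite J0" "finite A0" "finite B0" and AB0: "A0 \<inter> B0 = {}"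
    and miss: "\<And>w. w \<in> Inl ` J0 \<union> Inr ` (A0 \<union> B0) \<Longrightarrow>
      card {E \<in> tedges J0 (parity_graph k i A0 B0). w \<in> E \<and> E \<notin> T} \<le> \<mu>"
    and ps: "\<And>t x. (t, x) \<in> set ps \<Longrightarrow>
      t \<le> k \<and> t mod 2 = i \<and> k + 1 \<le> x \<and> (k + 1) * \<mu> < \<Prod>{x - k..x - 1}"
    and sub: "J \<subseteq> J0" "A \<subseteq> A0" "B \<subseteq> B0"
    and card: "card J = (\<Sum>(t, x)\<leftarrow>ps. x)" "card A = (\<Sum>(t, x)\<leftarrow>ps. t * x)"
      "card B = (\<Sum>(t, x)\<leftarrow>ps. (k - t) * x)"
  shows "\<exists>M. perfect_matching (Inl ` J \<union> Inr ` (A \<union> B)) T M"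
  using ps sub card
proof (induction ps arbitrary: J A B)
  case Nil
  then have "J = {}" "A = {}" "B = {}"
    using finite_subset[OF _ fin0(1)] finite_subset[OF _ fin0(2)] finite_subset[OF _ fin0(3)] by simp_all
  then show ?case by (intro exI[of _ "{}"]) (auto simp: perfect_matching_def)
next
  case (Cons p ps)
  obtain t x where p: "p = (t, x)" by (cases p)
  note fin = finite_subset[OF Cons.prems(2) fin0(1)] finite_subset[OF Cons.prems(3) fin0(2)]
    finite_subset[OF Cons.prems(4) fin0(3)]
  have AB: "A \<inter> B = {}" using Cons.prems AB0 by blast
  obtain J1 where J1: "J1 \<subseteq> J" "card J1 = x"
    using obtain_subset_with_card_n[of x J] Cons.prems(5) p by auto
  obtain A1 where A1: "A1 \<subseteq> A" "card A1 = t * x"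
    using obtain_subset_with_card_n[of "t * x" A] Cons.prems(6) p by auto
  obtain B1 where B1: "B1 \<subseteq> B" "card B1 = (k - t) * x"
    using obtain_subset_with_card_n[of "(k - t) * x" B] Cons.prems(7) p by auto
  note fin1 = finite_subset[OF J1(1) fin(1)] finite_subset[OF A1(1) fin(2)]
    finite_subset[OF B1(1) fin(3)]
  have tx: "t \<le> k" "t mod 2 = i" "k + 1 \<le> x" "(k + 1) * \<mu> < \<Prod>{x - k..x - 1}"
    using Cons.prems(1)[of t x] p by auto
  have sub: "tedges J1 {e \<in> nsets (A1 \<union> B1) k. card (e \<inter> A1) = t} \<subseteq>
      tedges J0 (parity_graph k i A0 B0)"
  proof -
    have "e \<in> parity_graph k i A0 B0" if "e \<in> nsets (A1 \<union> B1) k" "card (e \<inter> A1) = t" for e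
    proof -
      have "e \<inter> A0 = e \<inter> A1"
        using that(1) A1(1) B1(1) Cons.prems(3,4) AB0 unfolding nsets_def by blast
      then show ?thesis
        using that(1,2) tx(2) A1(1) B1(1) Cons.prems(3,4) by (simp add: parity_graph_def nsets_def) blast
    qed
    then show ?thesis using J1(1) Cons.prems(2) unfolding tedges_def by blast
  qed
  have fG: "finite (tedges J0 (parity_graph k i A0 B0))"
    using fin0 by (intro finite_tedges) (simp_all add: parity_graph_def finite_imp_finite_nsets)
  have "\<exists>M. perfect_matching (Inl ` J1 \<union> Inr ` (A1 \<union> B1)) T M"
  proof (rule type_class_matching[OF fin1 _ tx(1) J1(2) A1(2) B1(2) _ tx(3,4)])
    show "A1 \<inter> B1 = {}" using A1 B1 AB by auto
    fix w :: "nat + 'a" assume w: "w \<in> Inl ` J1 \<union> Inr ` (A1 \<union> B1)"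
    have "card {E \<in> tedges J1 {e \<in> nsets (A1 \<union> B1) k. card (e \<inter> A1) = t}. w \<in> E \<and> E \<notin> T} \<le>
      card {E \<in> tedges J0 (parity_graph k i A0 B0). w \<in> E \<and> E \<notin> T}"
      using sub fG by (intro card_mono) auto
    also have "\<dots> \<le> \<mu>" using w J1 A1 B1 Cons.prems by (intro miss) blast
    finally show "card {E \<in> tedges J1 {e \<in> nsets (A1 \<union> B1) k. card (e \<inter> A1) = t}.
      w \<in> E \<and> E \<notin> T} \<le> \<mu>" .
  qed
  then obtain M1 where M1: "perfect_matching (Inl ` J1 \<union> Inr ` (A1 \<union> B1)) T M1" ..
  have "\<exists>M. perfect_matching (Inl ` (J - J1) \<union> Inr ` ((A - A1) \<union> (B - B1))) T M"
    using Cons.prems J1 A1 B1 fin1 by (intro Cons.IH) (auto simp: p card_Diff_subset)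
  then obtain M2 where M2: "perfect_matching (Inl ` (J - J1) \<union> Inr ` ((A - A1) \<union> (B - B1))) T M2" ..
  have "perfect_matching ((Inl ` J1 \<union> Inr ` (A1 \<union> B1)) \<union>
      (Inl ` (J - J1) \<union> Inr ` ((A - A1) \<union> (B - B1)))) T (M1 \<union> M2)"
    using AB A1 B1 by (intro perfect_matching_Un[OF M1 M2]) auto
  moreover have "(Inl ` J1 \<union> Inr ` (A1 \<union> B1)) \<union>
      (Inl ` (J - J1) \<union> Inr ` ((A - A1) \<union> (B - B1))) = Inl ` J \<union> Inr ` (A \<union> B)"
    using J1 A1 B1 by auto
  ultimately show ?case by auto
qed

section \<open>Distributing the edges over intersection sizes of one parity\<close>

text \<open>The mean a / m differs from k / 2 by at most 1 / 16, and k / 2 lies between t + 1 / 2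
  and t + 3 / 2, so the mean stays away from both t and t + 2. The solution y = (a - t m) / 2 is an
  integer by the parity hypothesis, and x and y are both at least 7 m / 32.\<close>

lemma two_type_list:
  fixes a b k m t :: nat
  assumes "a + b = k * m" "8 * \<bar>int a - int b\<bar> \<le> int m" "even (a + t * m)"
    "2 * t < k" "k < 2 * t + 4" "64 \<le> m"
  obtains x y where "x + y = m" "t * x + (t + 2) * y = a" "m \<le> 32 * x" "m \<le> 32 * y"
proof -
  have "(2 * t + 1) * m \<le> k * m" "k * m \<le> (2 * t + 3) * m"
    using assms by (intro mult_right_mono; simp)+
  then have km: "2 * (t * m) + m \<le> a + b" "a + b \<le> 2 * (t * m) + 3 * m"
    unfolding assms(1) by (simp_all add: algebra_simps)
  have ab: "8 * a \<le> 8 * b + m" "8 * b \<le> 8 * a + m"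
    using assms(2) by (auto simp: abs_if split: if_splits)
  have a: "16 * a \<ge> 16 * (t * m) + 7 * m" "16 * a \<le> 16 * (t * m) + 25 * m"
    using km ab by linarith+
  have "even (a - t * m)" using assms(3) a by (auto simp: even_diff_nat)
  then obtain y where y: "a - t * m = 2 * y" by (rule evenE)
  have y': "a = t * m + 2 * y" using y a by linarith
  show ?thesis
  proof (rule that[of "m - y" y])
    have "y \<le> m" using a y' by linarith
    then show "m - y + y = m" by simp
    show "t * (m - y) + (t + 2) * y = a"
      using \<open>y \<le> m\<close> y' by (simp add: diff_mult_distrib2 algebra_simps)
    show "m \<le> 32 * (m - y)" "m \<le> 32 * y" using a y' by linarith+
  qed
qed

text \<open>The case k = 2 h with h itself of the required parity. Shares near 1 / 4, 1 / 2, 1 / 4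
  of the sizes h - 2, h, h + 2 keep all classes large wherever the mean lies near h.\<close>

lemma three_type_list:
  fixes a b h m :: nat
  assumes "a + b = 2 * h * m" "8 * \<bar>int a - int b\<bar> \<le> int m" "even (a + h * m)"
    "2 \<le> h" "64 \<le> m"
  obtains x y z where "x + y + z = m" "(h - 2) * x + h * y + (h + 2) * z = a"
    "m \<le> 32 * x" "m \<le> 32 * y" "m \<le> 32 * z"
proof -
  obtain g where g: "h = g + 2" using assms(4) by (metis add.commute le_Suc_ex)
  have "even (int a - int (h * m))" using assms(3) by presburger
  then obtain d where d: "int a - int (h * m) = 2 * d" by (rule evenE)
  define e where "e = int m div 4"
  have e: "4 * e \<le> int m" "int m < 4 * e + 4" unfolding e_def by linarith+
  have "int a + int b = 2 * int (h * m)"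
    using assms(1) by (metis mult.assoc of_nat_add of_nat_mult of_nat_numeral)
  then have db: "32 * \<bar>d\<bar> \<le> int m"
    using abs_ge_self[of "int a - int b"] abs_ge_minus_self[of "int a - int b"] assms(2) d
    by (cases "0 \<le> d"; simp; linarith)
  show ?thesis
  \<comment> \<open>Moving \<open>e\<close> edges from size h to each of h - 2 and h + 2 leaves the
    total h m unchanged; moving d more to h + 2 raises it to h m + 2 d = a.\<close>
  proof (rule that[of "nat e" "nat (int m - 2 * e - d)" "nat (e + d)"])
    have nn: "0 \<le> e" "0 \<le> int m - 2 * e - d" "0 \<le> e + d" using e db assms(5) by linarith+
    show "nat e + nat (int m - 2 * e - d) + nat (e + d) = m" using nn by linarith
    have "int ((h - 2) * nat e + h * nat (int m - 2 * e - d) + (h + 2) * nat (e + d)) = int a"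
      using nn d by (simp add: g algebra_simps)
    then show "(h - 2) * nat e + h * nat (int m - 2 * e - d) + (h + 2) * nat (e + d) = a"
      using of_nat_eq_iff by blast
    show "m \<le> 32 * nat e" "m \<le> 32 * nat (int m - 2 * e - d)" "m \<le> 32 * nat (e + d)"
      using e db assms(5) nn by linarith+
  qed
qed

lemma type_list:
  fixes a b i k m :: nat
  assumes k: "3 \<le> k" and i: "i < 2" and ab: "a + b = k * m"
    and bal: "8 * \<bar>int a - int b\<bar> \<le> int m" and ev: "even (a + i * m)" and m: "64 \<le> m"
  obtains ps where "\<And>t x. (t, x) \<in> set ps \<Longrightarrow> t \<le> k \<and> t mod 2 = i \<and> m \<le> 32 * x"
    "(\<Sum>(t, x)\<leftarrow>ps. x) = m" "(\<Sum>(t, x)\<leftarrow>ps. t * x) = a" "(\<Sum>(t, x)\<leftarrow>ps. (k - t) * x) = b"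
proof -
  have b_sum: "(\<Sum>(t, x)\<leftarrow>ps. (k - t) * x) = b"
    if "\<And>t x. (t, x) \<in> set ps \<Longrightarrow> t \<le> k" "(\<Sum>(t, x)\<leftarrow>ps. x) = m" "(\<Sum>(t, x)\<leftarrow>ps. t * x) = a"
    for ps
  proof -
    have "(\<Sum>(t, x)\<leftarrow>ps. (k - t) * x) + (\<Sum>(t, x)\<leftarrow>ps. t * x) = k * (\<Sum>(t, x)\<leftarrow>ps. x)"
      using that(1)
    proof (induction ps)
      case (Cons p ps)
      obtain t x where p: "p = (t, x)" by (cases p)
      have "t \<le> k" using Cons.prems[of t x] p by simp
      have "(k - t) * x + t * x = k * x"
        using \<open>t \<le> k\<close> by (simp add: add_mult_distrib[symmetric])
      moreover have "(\<Sum>(t, x)\<leftarrow>ps. (k - t) * x) + (\<Sum>(t, x)\<leftarrow>ps. t * x) = k * (\<Sum>(t, x)\<leftarrow>ps. x)"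
        using Cons.prems by (intro Cons.IH) auto
      ultimately show ?case unfolding p list.map sum_list.Cons prod.case
        by (simp add: add_mult_distrib2)
    qed simp
    then show ?thesis using that ab by simp
  qed
  show ?thesis
  proof (cases "\<exists>t. t mod 2 = i \<and> 2 * t < k \<and> k < 2 * t + 4")
    case True
    then obtain t where t: "t mod 2 = i" "2 * t < k" "k < 2 * t + 4" by blast
    have "even (a + t * m)" using ev t(1) by (auto simp: mod2_eq_if split: if_splits)
    then obtain x y where xy: "x + y = m" "t * x + (t + 2) * y = a" "m \<le> 32 * x" "m \<le> 32 * y"
      using two_type_list[OF ab bal _ t(2,3) m] by blast
    have ty: "\<And>s x'. (s, x') \<in> set [(t, x), (t + 2, y)] \<Longrightarrow> s \<le> k \<and> s mod 2 = i \<and> m \<le> 32 * x'"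
      using t k xy by auto
    show ?thesis
      by (rule that[of "[(t, x), (t + 2, y)]", OF ty _ _ b_sum]) (use ty xy in auto)
  next
    case False
    have i01: "i = 0 \<or> i = 1" using i by auto
    \<comment> \<open>For odd k = 2 h + 1 one of h and h - 1 would serve as t, and for k = 2 h with
      h of the other parity h - 1 would. What remains is k = 2 h with h of parity i.\<close>
    have "\<not> odd k"
    proof
      assume "odd k"
      then obtain h where h: "k = 2 * h + 1" by (auto elim: oddE)
      have "h mod 2 = i \<or> (h - 1) mod 2 = i" using i01 k h by (elim disjE; simp; presburger)
      then show False
        using False[unfolded not_ex, THEN spec, of h] False[unfolded not_ex, THEN spec, of "h - 1"] h k
        by auto
    qed
    then obtain h where h: "k = 2 * h" by (auto elim: evenE)
    have hi: "h mod 2 = i"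
    proof (rule ccontr)
      assume "h mod 2 \<noteq> i"
      then have "(h - 1) mod 2 = i" using i01 k h by (elim disjE; simp; arith)
      then show False using False[unfolded not_ex, THEN spec, of "h - 1"] h k by auto
    qed
    have "even (a + h * m)" using ev hi by (auto simp: mod2_eq_if split: if_splits)
    then obtain x y z where xyz: "x + y + z = m" "(h - 2) * x + h * y + (h + 2) * z = a"
      "m \<le> 32 * x" "m \<le> 32 * y" "m \<le> 32 * z"
      using three_type_list[of a b h m] ab bal m h k by auto
    have "(h - 2) mod 2 = i" using hi h k by (auto simp: mod2_eq_if even_diff_nat split: if_splits)
    then have ty: "\<And>s x'. (s, x') \<in> set [(h - 2, x), (h, y), (h + 2, z)] \<Longrightarrow>
        s \<le> k \<and> s mod 2 = i \<and> m \<le> 32 * x'"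
      using hi xyz h k by auto
    show ?thesis
      by (rule that[of "[(h - 2, x), (h, y), (h + 2, z)]", OF ty _ _ b_sum]) (use ty xyz in auto)
  qed
qed

lemma prod_interval_ge:
  fixes x k :: nat
  assumes "k + 1 \<le> x"
  shows "(x - k) ^ k \<le> \<Prod>{x - k..x - 1}"
proof -
  have "(\<Prod>j\<in>{x - k..x - 1}. x - k) \<le> \<Prod>{x - k..x - 1}"
    by (intro prod_mono) auto
  moreover have "card {x - k..x - 1} = k" using assms by auto
  ultimately show ?thesis by simp
qed

text \<open>Each set chosen so far meets \<open>D\<close> only in its own element, so the union
  \<open>Z\<close> of the earlier sets misses the element treated next and has at most q times card
  D elements.\<close>

lemma greedy_disjoint:
  assumes "finite D"
    and "\<And>d E. d \<in> D \<Longrightarrow> E \<in> F d \<Longrightarrow> finite E \<and> card E \<le> q \<and> E \<inter> D = {d}"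
    and "\<And>d Z. d \<in> D \<Longrightarrow> d \<notin> Z \<Longrightarrow> finite Z \<Longrightarrow> card Z \<le> q * card D \<Longrightarrow> \<exists>E\<in>F d. E \<inter> Z = {}"
  obtains e where "\<And>d. d \<in> D \<Longrightarrow> e d \<in> F d" "disjoint_family_on e D"
proof -
  have "\<exists>e. (\<forall>d\<in>D'. e d \<in> F d) \<and> disjoint_family_on e D'" if "D' \<subseteq> D" for D'
    using finite_subset[OF that assms(1)] that
  proof (induction D' rule: finite_induct)
    case empty
    then show ?case by (auto simp: disjoint_family_on_def)
  next
    case (insert d D')
    then obtain e where e: "\<forall>d\<in>D'. e d \<in> F d" "disjoint_family_on e D'" by blast
    let ?Z = "\<Union>(e ` D')"
    have "card ?Z \<le> (\<Sum>d\<in>D'. card (e d))" by (rule card_UN_le) (use insert in simp)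
    also have "\<dots> \<le> (\<Sum>d\<in>D'. q)" using assms(2) e(1) insert.prems by (intro sum_mono) auto
    also have "\<dots> \<le> q * card D"
      using card_mono[OF assms(1), of D'] insert by simp
    finally have "card ?Z \<le> q * card D" .
    moreover have "finite ?Z" using insert.hyps insert.prems assms(2) e(1) by (intro finite_UN_I) auto
    moreover have "d \<notin> ?Z"
    proof
      assume "d \<in> ?Z"
      then obtain d' where "d' \<in> D'" "d \<in> e d'" by blast
      then have "d \<in> e d' \<inter> D" "e d' \<inter> D = {d'}" using assms(2)[of d' "e d'"] e(1) insert by auto
      then show False using \<open>d' \<in> D'\<close> insert.hyps by auto
    qed
    ultimately obtain E where E: "E \<in> F d" "E \<inter> ?Z = {}" using assms(3)[of d ?Z] insert.prems by blast
    show ?case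
    proof (intro exI[of _ "e(d := E)"] conjI ballI)
      show "disjoint_family_on (e(d := E)) (insert d D')"
        using e(2) E(2) insert.hyps unfolding disjoint_family_on_def by auto
    qed (use e(1) E(1) in \<open>auto split: if_splits\<close>)
  qed
  then show ?thesis using that by blast
qed

section \<open>Greedy covering of exceptional vertices\<close>

lemma card_nsets_superset_le:
  assumes "finite W" "finite U"
  shows "card {E \<in> nsets W (card U + q). U \<subseteq> E} \<le> card W ^ q"
proof -
  have "inj_on (\<lambda>E. E - U) {E \<in> nsets W (card U + q). U \<subseteq> E}"
    by (rule inj_onI) blast
  moreover have "(\<lambda>E. E - U) ` {E \<in> nsets W (card U + q). U \<subseteq> E} \<subseteq> nsets W q"
    using assms by (auto simp: nsets_def card_Diff_subset)
  ultimately have "card {E \<in> nsets W (card U + q). U \<subseteq> E} \<le> card (nsets W q)"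
    using finite_imp_finite_nsets[OF assms(1)] by (rule card_inj_on_le)
  also have "\<dots> = card W choose q" by (rule card_nsets)
  also have "\<dots> \<le> card W ^ q"
    by (cases "q \<le> card W") (auto simp: binomial_le_pow binomial_eq_0)
  finally show ?thesis .
qed

text \<open>Against a degree of order card W ^ (q + 1), each element of \<open>Z\<close> costs one
  power of card W less; hence a small linear number of forbidden elements does no harm.\<close>

lemma card_containing_meeting_le:
  assumes "finite W" "finite Z" "w \<notin> Z"
  shows "card {E \<in> nsets W (q + 2). w \<in> E \<and> E \<inter> Z \<noteq> {}} \<le> card Z * card W ^ q"
proof -
  have "{E \<in> nsets W (q + 2). w \<in> E \<and> E \<inter> Z \<noteq> {}} =
      (\<Union>z\<in>Z. {E \<in> nsets W (q + 2). {w, z} \<subseteq> E})" by auto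
  then have "card {E \<in> nsets W (q + 2). w \<in> E \<and> E \<inter> Z \<noteq> {}} \<le>
      (\<Sum>z\<in>Z. card {E \<in> nsets W (q + 2). {w, z} \<subseteq> E})"
    by (simp only: card_UN_le[OF assms(2)])
  also have "\<dots> \<le> (\<Sum>z\<in>Z. card W ^ q)"
  proof (rule sum_mono)
    fix z assume "z \<in> Z"
    then have "w \<noteq> z" using assms(3) by blast
    then have "card {w, z} = 2" by simp
    then show "card {E \<in> nsets W (q + 2). {w, z} \<subseteq> E} \<le> card W ^ q"
      using card_nsets_superset_le[OF assms(1), of "{w, z}" q] by (simp add: add.commute)
  qed
  finally show ?thesis by simp
qed

lemma tedges_subset_nsets: "tedges {1..m} (nsets V k) \<subseteq> nsets (T_verts m V) (k + 1)"
proof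
  fix E assume "E \<in> tedges {1..m} (nsets V k)"
  then obtain j e where E: "E = insert (Inl j) (Inr ` e)" "j \<in> {1..m}" "e \<subseteq> V" "finite e" "card e = k"
    by (auto simp: tedges_def nsets_def)
  have "card (Inr ` e :: (nat + 'a) set) = k" using E by (subst card_image) auto
  then have "card E = k + 1" unfolding E(1) using E(4) by (subst card_insert_disjoint) auto
  then show "E \<in> nsets (T_verts m V) (k + 1)"
    using E by (auto simp: nsets_def T_verts_def)
qed

definition acount :: "'a set \<Rightarrow> (nat + 'a) set \<Rightarrow> nat" where
  "acount A E = card {a \<in> A. Inr a \<in> E}"

lemma acount_insert: "acount A (insert (Inl j) (Inr ` e)) = card (e \<inter> A)"
  unfolding acount_def by (rule arg_cong[of _ _ card]) auto

lemma tedges_complement: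
  assumes M: "M \<subseteq> tedges {1..m} (nsets V k)" "finite M" "disjoint M" and V: "finite V"
  shows "card {j \<in> {1..m}. Inl j \<notin> \<Union>M} + card M = m"
    and "A \<subseteq> V \<Longrightarrow> card {a \<in> A. Inr a \<notin> \<Union>M} + (\<Sum>E\<in>M. acount A E) = card A"
proof -
  have dis: "E \<inter> E' = {}" if "E \<in> M" "E' \<in> M" "E \<noteq> E'" for E E'
    using M(3) that by (auto simp: disjoint_def)
  have "{j \<in> {1..m}. Inl j \<in> \<Union>M} = (\<Union>E\<in>M. {j \<in> {1..m}. Inl j \<in> E})" by auto
  then have "card {j \<in> {1..m}. Inl j \<in> \<Union>M} = (\<Sum>E\<in>M. card {j \<in> {1..m}. Inl j \<in> E})"
    using dis M(2) by (simp only:) (rule card_UN_disjoint; auto; blast)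
  also have "\<dots> = (\<Sum>E\<in>M. 1)"
  proof (rule sum.cong[OF refl])
    fix E assume "E \<in> M"
    then obtain j e where "E = insert (Inl j) (Inr ` e)" "j \<in> {1..m}"
      using M(1) by (auto simp: tedges_def)
    then have "{j \<in> {1..m}. Inl j \<in> E} = {j}" by auto
    then show "card {j \<in> {1..m}. Inl j \<in> E} = 1" by simp
  qed
  finally have 1: "card {j \<in> {1..m}. Inl j \<in> \<Union>M} = card M" by simp
  have "card {j \<in> {1..m}. Inl j \<notin> \<Union>M} + card {j \<in> {1..m}. Inl j \<in> \<Union>M} =
      card ({j \<in> {1..m}. Inl j \<notin> \<Union>M} \<union> {j \<in> {1..m}. Inl j \<in> \<Union>M})"
    by (rule card_Un_disjoint[symmetric]) auto
  also have "{j \<in> {1..m}. Inl j \<notin> \<Union>M} \<union> {j \<in> {1..m}. Inl j \<in> \<Union>M} = {1..m}" by blast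
  finally show "card {j \<in> {1..m}. Inl j \<notin> \<Union>M} + card M = m" using 1 by simp
  assume A: "A \<subseteq> V"
  then have fA: "finite A" using V finite_subset by blast
  have "{a \<in> A. Inr a \<in> \<Union>M} = (\<Union>E\<in>M. {a \<in> A. Inr a \<in> E})" by auto
  then have "card {a \<in> A. Inr a \<in> \<Union>M} = (\<Sum>E\<in>M. card {a \<in> A. Inr a \<in> E})"
    using dis M(2) fA by (simp only:) (rule card_UN_disjoint; auto; blast)
  then have 2: "card {a \<in> A. Inr a \<in> \<Union>M} = (\<Sum>E\<in>M. acount A E)" by (simp add: acount_def)
  have "card {a \<in> A. Inr a \<notin> \<Union>M} + card {a \<in> A. Inr a \<in> \<Union>M} =
      card ({a \<in> A. Inr a \<notin> \<Union>M} \<union> {a \<in> A. Inr a \<in> \<Union>M})"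
    by (rule card_Un_disjoint[symmetric]) (use fA in auto)
  also have "{a \<in> A. Inr a \<notin> \<Union>M} \<union> {a \<in> A. Inr a \<in> \<Union>M} = A" by blast
  finally show "card {a \<in> A. Inr a \<notin> \<Union>M} + (\<Sum>E\<in>M. acount A E) = card A" using 2 by simp
qed

text \<open>The matching produced consists of card J edges with |E \<inter> A| of parity i, which
  forces \<open>ev\<close>. The factor 32 comes from \<open>type_list\<close>: every class has at
  least card J / 32 rows.\<close>

lemma near_complete_matching:
  fixes J :: "nat set" and A B :: "'a set"
  assumes k: "3 \<le> k" and i: "i < 2" and fin: "finite J" "finite A" "finite B" and AB: "A \<inter> B = {}"
    and card: "card A + card B = k * card J"
    and bal: "8 * \<bar>int (card A) - int (card B)\<bar> \<le> int (card J)"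
    and ev: "even (card A + i * card J)"
    and J: "64 \<le> card J" "\<And>x. card J \<le> 32 * x \<Longrightarrow> k + 1 \<le> x \<and> (k + 1) * \<mu> < (x - k) ^ k"
    and miss: "\<And>w. w \<in> Inl ` J \<union> Inr ` (A \<union> B) \<Longrightarrow>
      card {E \<in> tedges J (parity_graph k i A B). w \<in> E \<and> E \<notin> T} \<le> \<mu>"
  shows "\<exists>M. perfect_matching (Inl ` J \<union> Inr ` (A \<union> B)) T M"
proof -
  obtain ps where ps: "\<And>t x. (t, x) \<in> set ps \<Longrightarrow> t \<le> k \<and> t mod 2 = i \<and> card J \<le> 32 * x"
    "(\<Sum>(t, x)\<leftarrow>ps. x) = card J" "(\<Sum>(t, x)\<leftarrow>ps. t * x) = card A"
    "(\<Sum>(t, x)\<leftarrow>ps. (k - t) * x) = card B"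
    using type_list[OF k i card bal ev J(1)] by blast
  show ?thesis
  proof (rule classes_matching[OF fin AB miss])
    fix t x assume "(t, x) \<in> set ps"
    then have tx: "t \<le> k" "t mod 2 = i" "card J \<le> 32 * x" using ps(1) by auto
    then have x: "k + 1 \<le> x" "(k + 1) * \<mu> < (x - k) ^ k" using J(2) by auto
    then show "t \<le> k \<and> t mod 2 = i \<and> k + 1 \<le> x \<and> (k + 1) * \<mu> < \<Prod>{x - k..x - 1}"
      using prod_interval_ge[OF x(1)] tx by linarith
  qed (use ps in auto)
qed

text \<open>Of the at least \<open>\<delta>\<close> edges at d, at most card Bad * card W ^ q
  contain a second bad element, at least half of the others have the prescribed value of
  \<open>p\<close>, and at most (q + 2) (card Bad + 1) card W ^ q meet an earlier edge or
  \<open>g\<close>. The inequality \<open>big\<close> adds these losses, the last one doubled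
  because of the halving. The set \<open>g\<close> stands for the correcting edge, fixed
  beforehand.\<close>

lemma greedy_cover:
  fixes T :: "'w set set" and \<tau> :: "'w \<Rightarrow> nat" and p :: "'w set \<Rightarrow> nat"
  assumes W: "finite W" and T: "T \<subseteq> nsets W (q + 2)" and Bad: "Bad \<subseteq> W"
    and half: "\<And>d. d \<in> Bad \<Longrightarrow>
      card {E \<in> T. E \<inter> Bad = {d}} \<le> 2 * card {E \<in> T. E \<inter> Bad = {d} \<and> p E = \<tau> d}"
    and deg: "\<And>d. d \<in> Bad \<Longrightarrow> \<delta> \<le> card {E \<in> T. d \<in> E}"
    and big: "(card Bad + 2 * ((q + 2) * (card Bad + 1))) * card W ^ q < \<delta>"
    and g: "finite g" "card g \<le> q + 2"
  obtains e where "\<And>d. d \<in> Bad - g \<Longrightarrow> e d \<in> T \<and> e d \<inter> (Bad \<union> g) = {d} \<and> p (e d) = \<tau> d"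
    "disjoint_family_on e (Bad - g)"
proof -
  define F where "F d = {E \<in> T. E \<inter> (Bad \<union> g) = {d} \<and> p E = \<tau> d}" for d
  have finB: "finite Bad" using Bad W finite_subset by blast
  have finT: "finite T" using T finite_imp_finite_nsets[OF W] finite_subset by blast
  show ?thesis
  proof (rule greedy_disjoint[where D = "Bad - g" and q = "q + 2" and F = F])
    show "finite (Bad - g)" using finB by simp
    fix d E assume "d \<in> Bad - g" "E \<in> F d"
    then show "finite E \<and> card E \<le> q + 2 \<and> E \<inter> (Bad - g) = {d}"
      using T by (auto simp: F_def nsets_def)
  next
    fix d Z assume d: "d \<in> Bad - g" and Z: "d \<notin> Z" "finite Z" "card Z \<le> (q + 2) * card (Bad - g)"
    have cB: "card (Bad - g) \<le> card Bad" using finB by (intro card_mono) auto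
    let ?R = "card W ^ q"
    have hit: "card {E \<in> T. d \<in> E \<and> E \<inter> Y \<noteq> {}} \<le> card Y * ?R" if "finite Y" "d \<notin> Y" for Y
    proof -
      have "card {E \<in> T. d \<in> E \<and> E \<inter> Y \<noteq> {}} \<le>
          card {E \<in> nsets W (q + 2). d \<in> E \<and> E \<inter> Y \<noteq> {}}"
        using T finite_imp_finite_nsets[OF W] by (intro card_mono) auto
      then show ?thesis using card_containing_meeting_le[OF W that, of q] by linarith
    qed
    have "{E \<in> T. d \<in> E} \<subseteq> {E \<in> T. E \<inter> Bad = {d}} \<union> {E \<in> T. d \<in> E \<and> E \<inter> (Bad - {d}) \<noteq> {}}"
      using d by auto
    then have "card {E \<in> T. d \<in> E} \<le>
        card ({E \<in> T. E \<inter> Bad = {d}} \<union> {E \<in> T. d \<in> E \<and> E \<inter> (Bad - {d}) \<noteq> {}})"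
      using finT by (intro card_mono) auto
    also have "\<dots> \<le> card {E \<in> T. E \<inter> Bad = {d}} + card {E \<in> T. d \<in> E \<and> E \<inter> (Bad - {d}) \<noteq> {}}"
      by (rule card_Un_le)
    finally have "card {E \<in> T. d \<in> E} \<le>
      card {E \<in> T. E \<inter> Bad = {d}} + card {E \<in> T. d \<in> E \<and> E \<inter> (Bad - {d}) \<noteq> {}}" .
    moreover have "card {E \<in> T. d \<in> E \<and> E \<inter> (Bad - {d}) \<noteq> {}} \<le> card (Bad - {d}) * ?R"
      using finB by (intro hit) auto
    moreover have "card (Bad - {d}) * ?R \<le> card Bad * ?R"
      using finB by (intro mult_right_mono card_mono) auto
    ultimately have 1: "\<delta> \<le> card {E \<in> T. E \<inter> Bad = {d}} + card Bad * ?R"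
      using deg[OF DiffD1[OF d]] by linarith
    have "card (Z \<union> g) \<le> card Z + card g" by (rule card_Un_le)
    also have "\<dots> \<le> (q + 2) * (card Bad + 1)"
    proof -
      have "(q + 2) * card (Bad - g) \<le> (q + 2) * card Bad" using cB by (intro mult_left_mono) auto
      then show ?thesis using Z(3) g(2) by (simp only: distrib_left mult_1_right)
    qed
    finally have "card (Z \<union> g) * ?R \<le> ((q + 2) * (card Bad + 1)) * ?R" by (intro mult_right_mono) auto
    moreover have "card {E \<in> T. d \<in> E \<and> E \<inter> (Z \<union> g) \<noteq> {}} \<le> card (Z \<union> g) * ?R"
      using Z g d by (intro hit) auto
    ultimately have 2: "card {E \<in> T. d \<in> E \<and> E \<inter> (Z \<union> g) \<noteq> {}} \<le> ((q + 2) * (card Bad + 1)) * ?R"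
      by linarith
    let ?S = "{E \<in> T. E \<inter> Bad = {d} \<and> p E = \<tau> d}"
    have 3: "\<delta> \<le> 2 * card ?S + card Bad * ?R"
      using 1 half[of d] d by auto
    have "\<not> ?S \<subseteq> {E \<in> T. d \<in> E \<and> E \<inter> (Z \<union> g) \<noteq> {}}"
    proof
      assume "?S \<subseteq> {E \<in> T. d \<in> E \<and> E \<inter> (Z \<union> g) \<noteq> {}}"
      then have "card ?S \<le> card {E \<in> T. d \<in> E \<and> E \<inter> (Z \<union> g) \<noteq> {}}"
        using finT by (intro card_mono) auto
      then have "\<delta> \<le> 2 * (((q + 2) * (card Bad + 1)) * ?R) + card Bad * ?R" using 2 3 by linarith
      also have "\<dots> = (card Bad + 2 * ((q + 2) * (card Bad + 1))) * ?R"
        by (simp add: algebra_simps)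
      finally show False using big by simp
    qed
    then obtain E where "E \<in> ?S" "\<not> (d \<in> E \<and> E \<inter> (Z \<union> g) \<noteq> {})" by blast
    then show "\<exists>E\<in>F d. E \<inter> Z = {}" using d unfolding F_def by (intro bexI[of _ E]) auto
  qed (use that in \<open>auto simp: F_def\<close>)
qed

lemma T_graph_subset_tedges:
  assumes "\<And>j. j \<in> {1..m} \<Longrightarrow> H j \<subseteq> P"
  shows "T_graph m H \<subseteq> tedges {1..m} P"
proof
  fix E assume "E \<in> T_graph m H"
  then obtain j e where "j \<in> {1..m}" "e \<in> H j" "E = insert (Inl j) (Inr ` e)"
    by (auto simp: T_graph_def)
  then show "E \<in> tedges {1..m} P" using assms by (auto simp: tedges_def)
qed

lemma tedge_cases:
  assumes "E \<in> tedges J P"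
  obtains j e where "E = insert (Inl j) (Inr ` e)" "j \<in> J" "e \<in> P"
  using assms by (auto simp: tedges_def)

lemma acount_split:
  assumes "A \<inter> B = {}" "A \<union> B = V" "E \<in> tedges J (nsets V k)"
  shows "acount A E + acount B E = k"
proof -
  obtain j e where E: "E = insert (Inl j) (Inr ` e)" "e \<in> nsets V k"
    using assms(3) by (rule tedge_cases)
  then have fe: "finite e" "e \<subseteq> V" "card e = k" by (auto simp: nsets_def)
  have "card (e \<inter> A) + card (e \<inter> B) = card ((e \<inter> A) \<union> (e \<inter> B))"
    using fe assms(1) by (intro card_Un_disjoint[symmetric]) auto
  also have "(e \<inter> A) \<union> (e \<inter> B) = e" using fe assms(2) by auto
  finally show ?thesis using fe unfolding E(1) acount_insert by simp
qed

text \<open>Only edges with a single bad element are compared, so all unfavourable bad vertices can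
  be moved simultaneously: an edge at v contains no other moved vertex, and its parity changes
  exactly when v moves. Afterwards parity i has at least half of these edges at each bad vertex. A
  colour cannot be moved and receives a majority parity as \<open>\<tau>\<close>.\<close>

lemma flip_bad_vertices:
  fixes T :: "(nat + 'a) set set" and Bad :: "(nat + 'a) set"
  assumes V: "finite V" and T: "T \<subseteq> tedges {1..m} (nsets V k)" and A: "A \<subseteq> V" and i: "i < 2"
    and finB: "finite Bad"
  obtains A' \<tau> where "A' \<subseteq> V" "\<And>v. v \<in> V \<Longrightarrow> Inr v \<notin> Bad \<Longrightarrow> v \<in> A' \<longleftrightarrow> v \<in> A"
    "\<And>d. d \<in> Bad \<Longrightarrow> \<tau> d < (2::nat)" "\<And>v. \<tau> (Inr v) = i"
    "\<And>d. d \<in> Bad \<Longrightarrow> card {E \<in> T. E \<inter> Bad = {d}} \<le>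
        2 * card {E \<in> T. E \<inter> Bad = {d} \<and> acount A' E mod 2 = \<tau> d}"
proof -
  have finT: "finite T"
    using T finite_tedges[of "{1..m}" "nsets V k"] finite_imp_finite_nsets[OF V] finite_subset by blast
  have split: "card {E \<in> T. E \<inter> Bad = {d}} = card {E \<in> T. E \<inter> Bad = {d} \<and> acount X E mod 2 = i}
      + card {E \<in> T. E \<inter> Bad = {d} \<and> acount X E mod 2 = 1 - i}" for X d
  proof -
    have "i \<noteq> 1 - i" by presburger
    have "card {E \<in> T. E \<inter> Bad = {d} \<and> acount X E mod 2 = i}
        + card {E \<in> T. E \<inter> Bad = {d} \<and> acount X E mod 2 = 1 - i} =
      card ({E \<in> T. E \<inter> Bad = {d} \<and> acount X E mod 2 = i} \<union>
        {E \<in> T. E \<inter> Bad = {d} \<and> acount X E mod 2 = 1 - i})"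
      using finT \<open>i \<noteq> 1 - i\<close> by (intro card_Un_disjoint[symmetric]) (simp_all, blast)
    also have "{E \<in> T. E \<inter> Bad = {d} \<and> acount X E mod 2 = i} \<union>
        {E \<in> T. E \<inter> Bad = {d} \<and> acount X E mod 2 = 1 - i} = {E \<in> T. E \<inter> Bad = {d}}"
      using i by (auto simp: less_2_cases_iff)
    finally show ?thesis by simp
  qed
  define Mv where "Mv = {v \<in> V. Inr v \<in> Bad \<and>
    2 * card {E \<in> T. E \<inter> Bad = {Inr v} \<and> acount A E mod 2 = i} < card {E \<in> T. E \<inter> Bad = {Inr v}}}"
  define A' where "A' = (A - Mv) \<union> (Mv - A)"
  define \<tau> where "\<tau> d = (if \<exists>v. d = Inr v then i else
    if card {E \<in> T. E \<inter> Bad = {d}} \<le> 2 * card {E \<in> T. E \<inter> Bad = {d} \<and> acount A' E mod 2 = i}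
    then i else 1 - i)" for d
  have par: "acount A' E mod 2 = (if v \<in> Mv then 1 - acount A E mod 2 else acount A E mod 2)"
    if E: "E \<in> T" "E \<inter> Bad = {Inr v}" for E v
  proof -
    obtain j e where e: "E = insert (Inl j) (Inr ` e)" "e \<in> nsets V k"
      using E(1) T by (blast elim: tedge_cases)
    have fe: "finite e" "e \<subseteq> V" using e by (auto simp: nsets_def)
    have ve: "v \<in> e" using E(2) e(1) by auto
    have only: "w = v" if "w \<in> e" "w \<in> Mv" for w
    proof -
      have "Inr w \<in> E \<inter> Bad" using that e(1) by (auto simp: Mv_def)
      then show ?thesis using E(2) by auto
    qed
    show ?thesis
    proof (cases "v \<in> Mv")
      case False
      then have "e \<inter> A' = e \<inter> A" using only unfolding A'_def by blast
      then show ?thesis using False by (simp add: e(1) acount_insert)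
    next
      case True
      show ?thesis
      proof (cases "v \<in> A")
        case vA: True
        have "e \<inter> A = insert v (e \<inter> A')" "v \<notin> e \<inter> A'"
          using only True vA ve unfolding A'_def by blast+
        then have "card (e \<inter> A) = Suc (card (e \<inter> A'))" using fe by simp
        then show ?thesis using True by (simp add: e(1) acount_insert) presburger
      next
        case vA: False
        have "e \<inter> A' = insert v (e \<inter> A)" "v \<notin> e \<inter> A"
          using only True vA ve unfolding A'_def by blast+
        then have "card (e \<inter> A') = Suc (card (e \<inter> A))" using fe by simp
        then show ?thesis using True by (simp add: e(1) acount_insert) presburger
      qed
    qed
  qed
  show ?thesis
  proof (rule that[of A' \<tau>])
    show "A' \<subseteq> V" using A by (auto simp: A'_def Mv_def)
    show "v \<in> A' \<longleftrightarrow> v \<in> A" if "v \<in> V" "Inr v \<notin> Bad" for v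
      using that by (auto simp: A'_def Mv_def)
    show "\<tau> d < 2" for d using i by (auto simp: \<tau>_def)
    show "\<tau> (Inr v) = i" for v by (simp add: \<tau>_def)
    fix d assume d: "d \<in> Bad"
    let ?N = "card {E \<in> T. E \<inter> Bad = {d}}"
    show "?N \<le> 2 * card {E \<in> T. E \<inter> Bad = {d} \<and> acount A' E mod 2 = \<tau> d}"
    proof (cases "\<exists>v. d = Inr v")
      case False
      then show ?thesis using split[of d A'] by (auto simp: \<tau>_def)
    next
      case True
      then obtain v where v: "d = Inr v" by blast
      show ?thesis
      proof (cases "v \<in> V")
        case False
        have "{E \<in> T. E \<inter> Bad = {d}} = {}"
        proof -
          have "v \<in> V" if E: "E \<in> T" "E \<inter> Bad = {d}" for E
          proof -
            obtain j e where e: "E = insert (Inl j) (Inr ` e)" "e \<in> nsets V k"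
              using E(1) T by (blast elim: tedge_cases)
            have "Inr v \<in> E" using E v by auto
            then show ?thesis using e by (auto simp: nsets_def)
          qed
          then show ?thesis using False by blast
        qed
        then show ?thesis by (simp only: card.empty)
      next
        case vV: True
        show ?thesis
        proof (cases "v \<in> Mv")
          case True
          have "acount A' E mod 2 = i \<longleftrightarrow> acount A E mod 2 = 1 - i"
            if "E \<in> T" "E \<inter> Bad = {Inr v}" for E
            using par[OF that] True i by presburger
          then have "{E \<in> T. E \<inter> Bad = {d} \<and> acount A' E mod 2 = i} =
              {E \<in> T. E \<inter> Bad = {d} \<and> acount A E mod 2 = 1 - i}"
            unfolding v by blast
          moreover have "2 * card {E \<in> T. E \<inter> Bad = {d} \<and> acount A E mod 2 = i} < ?N"
            using True v by (auto simp: Mv_def)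
          ultimately show ?thesis using split[of d A] v by (simp add: \<tau>_def)
        next
          case False
          have "{E \<in> T. E \<inter> Bad = {d} \<and> acount A' E mod 2 = i} =
              {E \<in> T. E \<inter> Bad = {d} \<and> acount A E mod 2 = i}"
            using par False unfolding v by auto
          moreover have "?N \<le> 2 * card {E \<in> T. E \<inter> Bad = {d} \<and> acount A E mod 2 = i}"
            using False v vV d by (auto simp: Mv_def)
          ultimately show ?thesis using v by (simp add: \<tau>_def)
        qed
      qed
    qed
  qed
qed

section \<open>The parity-corrected matching\<close>

text \<open>Here y, y1, y2 are the imbalances of the original partition, of the partition after
  moving b bad vertices, and of what a partial matching covering s vertices of V leaves over; u
  bounds s.\<close>

lemma balance_chain:
  fixes y y1 y2 b u s r :: int
  assumes "y1 \<le> y + 2 * b" "y2 \<le> y1 + s" "8 * y + 8 * (2 * b + u) \<le> r" "s \<le> u"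
  shows "8 * y2 \<le> r"
  using assms unfolding distrib_left by linarith

text \<open>Assumption \<open>par\<close> speaks of all partitions because the one it is applied to
  arises inside the proof, by moving bad vertices. In \<open>bal\<close> the term 2 card Bad pays
  for these moves and k (card Bad + 1) for the vertices covered by at most card Bad + 1 edges; the
  same number of edges bounds the colours lost, on the right of \<open>bal\<close> and in
  \<open>large\<close>.\<close>

lemma perfect_matching_if_few_bad:
  fixes V A B :: "'a set" and H :: "nat \<Rightarrow> 'a set set" and Bad :: "(nat + 'a) set" and m :: nat
  defines "T \<equiv> T_graph m H"
  assumes k: "3 \<le> k" and i: "i < 2" and V: "finite V" "card V = k * m"
    and AB: "A \<union> B = V" "A \<inter> B = {}" and H: "\<And>j. j \<in> {1..m} \<Longrightarrow> H j \<subseteq> nsets V k"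
    and Bad: "Bad \<subseteq> T_verts m V"
    and good: "\<And>w. w \<in> T_verts m V - Bad \<Longrightarrow>
      card {E \<in> tedges {1..m} (parity_graph k i A B). w \<in> E \<and> E \<notin> T} \<le> \<mu>"
    and deg: "\<And>w. w \<in> T_verts m V \<Longrightarrow> \<delta> \<le> card {E \<in> T. w \<in> E}"
    and big: "(card Bad + 2 * ((k + 1) * (card Bad + 1))) * ((k + 1) * m) ^ (k - 1) < \<delta>"
    and bal: "8 * \<bar>int (card A) - int (card B)\<bar> + 8 * (2 * int (card Bad) + int k * (int (card Bad) + 1)) \<le>
      int m - (int (card Bad) + 1)"
    and large: "64 + card Bad + 1 \<le> m"
      "\<And>x. m \<le> 32 * x + card Bad + 1 \<Longrightarrow> k + 1 \<le> x \<and> (k + 1) * \<mu> < (x - k) ^ k"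
    and par: "\<And>A' B'. A' \<union> B' = V \<Longrightarrow> A' \<inter> B' = {} \<Longrightarrow> A' \<noteq> {} \<Longrightarrow>
      (\<forall>j\<in>{1..m}. \<exists>E\<in>H j. E \<notin> parity_graph k i A' B') \<or>
      even (card A' + i * m) \<and> (\<forall>j\<in>{1..m}. \<exists>E\<in>H j. E \<in> parity_graph k i A' B')"
  shows "\<exists>M. perfect_matching (T_verts m V) T M"
proof -
  let ?W = "T_verts m V"
  have W: "finite ?W" "card ?W = (k + 1) * m"
    using V by (auto simp: T_verts_def card_Plus)
  have Tt: "T \<subseteq> tedges {1..m} (nsets V k)" unfolding T_def using H by (rule T_graph_subset_tedges)
  have TW: "T \<subseteq> nsets ?W (k - 1 + 2)" using Tt tedges_subset_nsets[of m V k] k by simp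
  have finT: "finite T" using TW finite_imp_finite_nsets[OF W(1)] finite_subset by blast
  have finB: "finite Bad" using Bad W(1) finite_subset by blast
  have finA: "finite A" "finite B" using V AB by auto
  obtain A1 \<tau> where A1: "A1 \<subseteq> V" "\<And>v. v \<in> V \<Longrightarrow> Inr v \<notin> Bad \<Longrightarrow> v \<in> A1 \<longleftrightarrow> v \<in> A"
    and \<tau>: "\<And>d. d \<in> Bad \<Longrightarrow> \<tau> d < (2::nat)" "\<And>v. \<tau> (Inr v) = i"
    "\<And>d. d \<in> Bad \<Longrightarrow> card {E \<in> T. E \<inter> Bad = {d}} \<le>
        2 * card {E \<in> T. E \<inter> Bad = {d} \<and> acount A1 E mod 2 = \<tau> d}"
    using flip_bad_vertices[OF V(1) Tt _ i finB, of A] AB by blast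
  define B1 where "B1 = V - A1"
  have AB1: "A1 \<union> B1 = V" "A1 \<inter> B1 = {}" using A1 by (auto simp: B1_def)
  have finA1: "finite A1" "finite B1" using AB1 V by auto
  have cAB: "card A + card B = k * m" "card A1 + card B1 = k * m"
    using card_Un_disjoint[OF finA AB(2)] card_Un_disjoint[OF finA1 AB1(2)] AB AB1 V by auto
  have moved: "card A1 \<le> card A + card Bad" "card A \<le> card A1 + card Bad"
  proof -
    have fin: "finite (Inr -` Bad :: 'a set)" using finB by (intro finite_vimageI) auto
    have c: "card (Inr -` Bad :: 'a set) \<le> card Bad"
      using finB by (metis card_vimage_inj_on_le inj_Inr inf_top_right)
    have "card A1 \<le> card (A \<union> Inr -` Bad)"
      using A1 finA fin by (intro card_mono) auto
    then show "card A1 \<le> card A + card Bad" using card_Un_le[of A "Inr -` Bad"] c by linarith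
    have "card A \<le> card (A1 \<union> Inr -` Bad)"
      using A1 finA1 AB fin by (intro card_mono) auto
    then show "card A \<le> card A1 + card Bad" using card_Un_le[of A1 "Inr -` Bad"] c by linarith
  qed
  \<comment> \<open>The bad colours assigned parity 1 - i; bad vertices all have
    \<open>\<tau>\<close> equal to i.\<close>
  define bad1 where "bad1 = {d \<in> Bad. \<tau> d \<noteq> i}"
  have bad1: "bad1 \<subseteq> Bad" "\<And>d. d \<in> bad1 \<Longrightarrow> \<exists>j\<in>{1..m}. d = Inl j"
    using \<tau>(2) Bad by (auto simp: bad1_def T_verts_def)
  have cB: "card Bad < m" using large(1) by simp
  \<comment> \<open>With \<open>A1\<close> empty the original imbalance would be at least 3 m - 2
    card Bad, against \<open>bal\<close>.\<close>
  have A1ne: "A1 \<noteq> {}"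
  proof
    assume "A1 = {}"
    then have "int (card A) \<le> int (card Bad)" using moved by simp
    moreover have "int (card A) + int (card B) = int (k * m)" using cAB by linarith
    moreover have "int (3 * m) \<le> int (k * m)" using k by (intro of_nat_mono mult_right_mono) auto
    ultimately have "3 * int m - 2 * int (card Bad) \<le> int (card B) - int (card A)" by simp
    also have "\<dots> \<le> \<bar>int (card A) - int (card B)\<bar>" by simp
    finally have "24 * int m \<le> 8 * \<bar>int (card A) - int (card B)\<bar> + 16 * int (card Bad)" by simp
    then have "24 * int m + 8 * (int k * (int (card Bad) + 1)) \<le> int m - (int (card Bad) + 1)"
      using bal unfolding distrib_left by (elim order_trans[rotated]) presburger
    moreover have "int m - (int (card Bad) + 1) < 24 * int m" by simp
    moreover have "0 \<le> 8 * (int k * (int (card Bad) + 1))" by (intro mult_nonneg_nonneg) simp_all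
    ultimately show False by (meson add_increasing2 not_le order_trans order_refl)
  qed
  \<comment> \<open>The first two summands count the covering edges of parity 1 - i; this number has
    to agree with card A1 + i m modulo 2. \<open>P\<close> is empty or consists of the correcting
    edge.\<close>
  have "\<exists>P. P \<subseteq> T \<and> card P \<le> 1 \<and> finite P \<and>
    even (card (bad1 - \<Union>P) + card {E \<in> P. acount A1 E mod 2 \<noteq> i} + card A1 + i * m)"
  proof (cases "even (card bad1 + card A1 + i * m)")
    case True
    then show ?thesis by (intro exI[of _ "{}"]) simp
  next
    case odd: False
    have mem: "insert (Inl j) (Inr ` E) \<in> T" if "j \<in> {1..m}" "E \<in> H j" for j E
      unfolding T_def T_graph_def by (intro UN_I[OF that(1)] CollectI exI[of _ E]) (simp add: that)
    consider "\<forall>j\<in>{1..m}. \<exists>E\<in>H j. E \<notin> parity_graph k i A1 B1"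
      | "even (card A1 + i * m)" "\<forall>j\<in>{1..m}. \<exists>E\<in>H j. E \<in> parity_graph k i A1 B1"
      using par[OF AB1 A1ne] by blast
    then show ?thesis
    proof cases
      case 1
      have "\<not> {1..m} \<subseteq> Inl -` Bad"
      proof
        assume "{1..m} \<subseteq> Inl -` Bad"
        then have "Inl ` {1..m} \<subseteq> Bad" by auto
        then have "card (Inl ` {1..m} :: (nat + 'a) set) \<le> card Bad" using finB by (rule card_mono[rotated])
        then show False using cB by (simp add: card_image)
      qed
      then obtain j where j: "j \<in> {1..m}" "Inl j \<notin> Bad" by blast
      then obtain E where E: "E \<in> H j" "E \<notin> parity_graph k i A1 B1" using 1 by blast
      have "E \<in> nsets V k" using E H j by blast
      then have "acount A1 (insert (Inl j) (Inr ` E)) mod 2 \<noteq> i"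
        using E(2) AB1 by (auto simp: acount_insert parity_graph_def)
      \<comment> \<open>The edge may contain bad vertices, which it then covers, but its colour is
        good; hence the number of colours in \<open>bad1\<close> still to be treated is unchanged
        and only the summand for \<open>P\<close> grows.\<close>
      moreover have "bad1 - insert (Inl j) (Inr ` E) = bad1" using bad1 j by blast
      ultimately show ?thesis using odd mem[OF j(1) E(1)]
        by (intro exI[of _ "{insert (Inl j) (Inr ` E)}"]) (auto simp: Collect_conv_if)
    next
      case 2
      \<comment> \<open>With card A1 + i m even, a wrong parity makes card bad1 odd, so
        \<open>bad1\<close> is nonempty. One of its colours takes an edge of parity i instead, and
        the count drops by one.\<close>
      then have "odd (card bad1)" using odd by (metis add.assoc odd_add)
      then obtain d where d: "d \<in> bad1" by (metis card.empty even_zero ex_in_conv)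
      then obtain j where j: "j \<in> {1..m}" "d = Inl j" using bad1 by blast
      then obtain E where E: "E \<in> H j" "E \<in> parity_graph k i A1 B1" using 2 by blast
      define g where "g = insert (Inl j) (Inr ` E)"
      have "acount A1 g mod 2 = i"
        using E(2) by (auto simp: g_def acount_insert parity_graph_def)
      moreover have "bad1 - g = bad1 - {d}" using bad1 j by (auto simp: g_def)
      moreover have "card bad1 = Suc (card (bad1 - {d}))"
        using card.remove[OF finite_subset[OF bad1(1) finB] d] .
      ultimately have ev: "even (card (bad1 - g))" and z: "{E' \<in> {g}. acount A1 E' mod 2 \<noteq> i} = {}"
        using \<open>odd (card bad1)\<close> by (auto simp: g_def)
      have "even (card (bad1 - \<Union>{g}) + card {E' \<in> {g}. acount A1 E' mod 2 \<noteq> i} + card A1 + i * m)"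
        unfolding z using ev 2(1) by simp
      moreover have "{g} \<subseteq> T" using mem[OF j(1) E(1)] by (simp add: g_def)
      ultimately show ?thesis by (intro exI[of _ "{g}"] conjI) simp_all
    qed
  qed
  then obtain P where P: "P \<subseteq> T" "card P \<le> 1" "finite P"
    "even (card (bad1 - \<Union>P) + card {E \<in> P. acount A1 E mod 2 \<noteq> i} + card A1 + i * m)" by blast
  have "card P = 0 \<or> card P = 1" using P(2) by linarith
  then have P01: "P = {} \<or> (\<exists>E. P = {E})" using card_0_eq[OF P(3)] card_1_singletonE[of P] by blast
  then have disP: "disjoint P" by (auto simp: disjoint_def)
  have gP: "finite (\<Union>P)" "card (\<Union>P) \<le> k - 1 + 2"
  proof -
    have "finite E \<and> card E = k + 1" if "E \<in> P" for E
      using that P(1) TW k by (auto simp: nsets_def)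
    then show "finite (\<Union>P)" "card (\<Union>P) \<le> k - 1 + 2" using P01 k by (elim disjE exE; simp)+
  qed
  have big': "(card Bad + 2 * ((k - 1 + 2) * (card Bad + 1))) * card ?W ^ (k - 1) < \<delta>"
    using big k W(2) by simp
  obtain e where e: "\<And>d. d \<in> Bad - \<Union>P \<Longrightarrow>
      e d \<in> T \<and> e d \<inter> (Bad \<union> \<Union>P) = {d} \<and> acount A1 (e d) mod 2 = \<tau> d"
    "disjoint_family_on e (Bad - \<Union>P)"
    using greedy_cover[OF W(1) TW Bad \<tau>(3) deg[OF subsetD[OF Bad]] big' gP] by blast
  define D where "D = Bad - \<Union>P"
  define M where "M = P \<union> e ` D"
  have e_in: "e d \<in> T" "d \<in> e d" "e d \<inter> \<Union>P = {}" "acount A1 (e d) mod 2 = \<tau> d" if "d \<in> D" for d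
    using e(1)[OF that[unfolded D_def]] that unfolding D_def by auto
  have e_D: "d' = d" if "d \<in> D" "d' \<in> D" "d' \<in> e d" for d d'
    using e(1)[of d] that unfolding D_def by blast
  have inj: "inj_on e D" using e_in(2) e_D unfolding inj_on_def by blast
  have PD: "P \<inter> e ` D = {}" using e_in(2,3) by blast
  have finD: "finite D" using finB by (simp add: D_def)
  have M: "M \<subseteq> T" "finite M" using P e_in(1) finD by (auto simp: M_def)
  have disM: "disjoint M"
  proof -
    have "disjoint (e ` D)"
      using e(2) unfolding D_def[symmetric] by (rule disjoint_family_on_disjoint_image)
    then show ?thesis unfolding M_def using disP e_in(3) by (intro disjoint_union) blast+
  qed
  have cM: "card M = card P + card D"
    unfolding M_def using PD P(3) finD card_image[OF inj] by (subst card_Un_disjoint) auto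
  moreover have "card D \<le> card Bad" unfolding D_def using finB by (intro card_mono) auto
  ultimately have cM_le: "card M \<le> card Bad + 1" using P(2) by linarith
  have BadM: "Bad \<subseteq> \<Union>M"
  proof
    fix d assume "d \<in> Bad"
    then show "d \<in> \<Union>M" using e_in(2)[of d] by (cases "d \<in> D") (auto simp: M_def D_def)
  qed
  define J where "J = {j \<in> {1..m}. Inl j \<notin> \<Union>M}"
  define A2 where "A2 = {a \<in> A1. Inr a \<notin> \<Union>M}"
  define B2 where "B2 = {a \<in> B1. Inr a \<notin> \<Union>M}"
  have Mt: "M \<subseteq> tedges {1..m} (nsets V k)" using M Tt by blast
  have cJ: "card J + card M = m"
    unfolding J_def using tedges_complement(1)[OF Mt M(2) disM V(1)] .
  have cA2: "card A2 + (\<Sum>E\<in>M. acount A1 E) = card A1"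
    unfolding A2_def using tedges_complement(2)[OF Mt M(2) disM V(1)] A1(1) .
  have cB2: "card B2 + (\<Sum>E\<in>M. acount B1 E) = card B1"
    unfolding B2_def using tedges_complement(2)[OF Mt M(2) disM V(1)] AB1 by blast
  have sumk: "(\<Sum>E\<in>M. acount A1 E) + (\<Sum>E\<in>M. acount B1 E) = k * card M"
  proof -
    have "(\<Sum>E\<in>M. acount A1 E) + (\<Sum>E\<in>M. acount B1 E) = (\<Sum>E\<in>M. k)"
      unfolding sum.distrib[symmetric] using acount_split[OF AB1(2,1)] Mt by (intro sum.cong) blast+
    then show ?thesis by simp
  qed
  have kJ: "k * card J + k * card M = k * m" using cJ by (metis distrib_left)
  have card2: "card A2 + card B2 = k * card J" using cA2 cB2 sumk kJ cAB by linarith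
  \<comment> \<open>Modulo 2 the sum of |E \<inter> A1| + i over M counts the edges of parity 1 - i
    in M, and the condition on \<open>P\<close> makes this agree with card A1 + i m.\<close>
  have even2: "even (card A2 + i * card J)"
  proof -
    have "{E \<in> M. odd (acount A1 E + i)} = {E \<in> P. acount A1 E mod 2 \<noteq> i} \<union> e ` (bad1 - \<Union>P)"
    proof -
      have "odd (acount A1 E + i) \<longleftrightarrow> acount A1 E mod 2 \<noteq> i" for E using i by presburger
      moreover have "bad1 - \<Union>P = {d \<in> D. \<tau> d \<noteq> i}" by (auto simp: bad1_def D_def)
      ultimately show ?thesis using e_in(4) by (auto simp: M_def)
    qed
    moreover have "card ({E \<in> P. acount A1 E mod 2 \<noteq> i} \<union> e ` (bad1 - \<Union>P)) =
      card {E \<in> P. acount A1 E mod 2 \<noteq> i} + card (bad1 - \<Union>P)"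
    proof -
      have sub: "bad1 - \<Union>P \<subseteq> D" using bad1 by (auto simp: D_def)
      then have "card (e ` (bad1 - \<Union>P)) = card (bad1 - \<Union>P)"
        using inj_on_subset[OF inj] card_image by blast
      then show ?thesis using PD sub P(3) finite_subset[OF sub finD]
        by (subst card_Un_disjoint) auto
    qed
    ultimately have "even (\<Sum>E\<in>M. acount A1 E + i) \<longleftrightarrow>
      even (card {E \<in> P. acount A1 E mod 2 \<noteq> i} + card (bad1 - \<Union>P))"
      using even_sum_iff[OF M(2), of "\<lambda>E. acount A1 E + i"] by simp
    then have "even ((\<Sum>E\<in>M. acount A1 E + i) + card A1 + i * m)" using P(4) by (simp; argo)
    moreover have "(\<Sum>E\<in>M. acount A1 E + i) = (\<Sum>E\<in>M. acount A1 E) + i * card M"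
      by (simp add: sum.distrib)
    moreover have "i * m = i * card J + i * card M" using cJ by (metis distrib_left)
    ultimately have "even ((\<Sum>E\<in>M. acount A1 E) + i * card M +
      (card A2 + (\<Sum>E\<in>M. acount A1 E)) + (i * card J + i * card M))"
      using cA2 by simp
    then show ?thesis by (simp; argo)
  qed
  have bal2: "8 * \<bar>int (card A2) - int (card B2)\<bar> \<le> int (card J)"
  proof -
    have "k * card M \<le> k * (card Bad + 1)" using cM_le by (rule mult_le_mono2)
    then have kM: "int (k * card M) \<le> int k * (int (card Bad) + 1)" by (metis of_nat_1 of_nat_add of_nat_le_iff of_nat_mult)
    have "\<bar>int (card A1) - int (card B1)\<bar> \<le> \<bar>int (card A) - int (card B)\<bar> + 2 * int (card Bad)"
      using cAB moved by linarith
    moreover have "\<bar>int (card A2) - int (card B2)\<bar> \<le> \<bar>int (card A1) - int (card B1)\<bar> + int (k * card M)"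
      using cA2 cB2 sumk by linarith
    ultimately have "8 * \<bar>int (card A2) - int (card B2)\<bar> \<le> int m - (int (card Bad) + 1)"
      using bal kM by (rule balance_chain)
    also have "\<dots> \<le> int (card J)" using cJ cM_le by linarith
    finally show ?thesis .
  qed
  have miss: "card {E \<in> tedges J (parity_graph k i A2 B2). w \<in> E \<and> E \<notin> T} \<le> \<mu>"
    if w: "w \<in> Inl ` J \<union> Inr ` (A2 \<union> B2)" for w
  proof -
    have "w \<in> ?W - Bad"
      using w BadM AB1 unfolding J_def A2_def B2_def T_verts_def by auto
    \<comment> \<open>All bad elements are covered by M, and off them \<open>A1\<close> agrees with
      \<open>A\<close>; so missing edges of the remainder are missing edges of the original
      model.\<close>
    have "e \<in> parity_graph k i A B" if "e \<in> parity_graph k i A2 B2" for e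
    proof -
      have es: "e \<subseteq> A2 \<union> B2" using that by (auto simp: parity_graph_def nsets_def)
      have "v \<in> A \<longleftrightarrow> v \<in> A2" if "v \<in> e" for v
      proof -
        have "v \<in> V" "Inr v \<notin> \<Union>M" using es that AB1 by (auto simp: A2_def B2_def)
        then show ?thesis using A1(2)[of v] BadM by (auto simp: A2_def)
      qed
      then have "e \<inter> A = e \<inter> A2" by blast
      moreover have "e \<subseteq> V" using es AB1 by (auto simp: A2_def B2_def)
      ultimately show ?thesis using that AB by (auto simp: parity_graph_def nsets_def)
    qed
    then have "{E \<in> tedges J (parity_graph k i A2 B2). w \<in> E \<and> E \<notin> T} \<subseteq>
      {E \<in> tedges {1..m} (parity_graph k i A B). w \<in> E \<and> E \<notin> T}"
      unfolding tedges_def J_def by blast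
    moreover have "finite (tedges {1..m} (parity_graph k i A B))"
      using V AB by (intro finite_tedges) (simp_all add: parity_graph_def finite_imp_finite_nsets)
    ultimately have "card {E \<in> tedges J (parity_graph k i A2 B2). w \<in> E \<and> E \<notin> T} \<le>
      card {E \<in> tedges {1..m} (parity_graph k i A B). w \<in> E \<and> E \<notin> T}"
      by (intro card_mono) auto
    then show ?thesis using good[OF \<open>w \<in> ?W - Bad\<close>] by linarith
  qed
  have "\<exists>M2. perfect_matching (Inl ` J \<union> Inr ` (A2 \<union> B2)) T M2"
  proof (rule near_complete_matching[OF k i _ _ _ _ card2 bal2 even2 _ _ miss])
    show "finite J" "finite A2" "finite B2" "A2 \<inter> B2 = {}"
      using finA1 AB1 by (auto simp: J_def A2_def B2_def)
    show "64 \<le> card J" using cJ cM_le large(1) by linarith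
    show "k + 1 \<le> x \<and> (k + 1) * \<mu> < (x - k) ^ k" if "card J \<le> 32 * x" for x
      using cJ cM_le that by (intro large(2)) linarith
  qed
  then obtain M2 where M2: "perfect_matching (Inl ` J \<union> Inr ` (A2 \<union> B2)) T M2" ..
  have "perfect_matching (\<Union>M \<union> (Inl ` J \<union> Inr ` (A2 \<union> B2))) T (M \<union> M2)"
    using M disM by (intro perfect_matching_Un[OF _ M2])
      (auto simp: perfect_matching_def J_def A2_def B2_def)
  moreover have "\<Union>M \<union> (Inl ` J \<union> Inr ` (A2 \<union> B2)) = ?W"
  proof -
    have "\<Union>M \<subseteq> ?W" using M(1) TW by (auto simp: nsets_def)
    then show ?thesis using AB1 unfolding J_def A2_def B2_def T_verts_def by auto
  qed
  ultimately show ?thesis by auto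
qed

section \<open>From few missing edges to few bad elements\<close>

text \<open>Double counting of incidences: the degrees over all of \<open>W\<close> add up to K
  times card X.\<close>

lemma card_high_degree:
  fixes X :: "'w set set" and \<eta> :: real
  assumes fin: "finite X" "finite W" and X: "\<And>E. E \<in> X \<Longrightarrow> E \<subseteq> W \<and> card E = K"
    and B: "B \<subseteq> W" "\<And>w. w \<in> B \<Longrightarrow> \<eta> \<le> real (card {E \<in> X. w \<in> E})"
  shows "real (card B) * \<eta> \<le> real K * real (card X)"
proof -
  have "(\<Sum>w\<in>W. card {E \<in> X. w \<in> E}) = K * card X"
  proof (rule sum_multicount[OF fin(2,1)])
    show "\<forall>E\<in>X. card {w \<in> W. w \<in> E} = K"
    proof
      fix E assume "E \<in> X"
      then have "{w \<in> W. w \<in> E} = E" "card E = K" using X by auto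
      then show "card {w \<in> W. w \<in> E} = K" by simp
    qed
  qed
  moreover have "(\<Sum>w\<in>B. card {E \<in> X. w \<in> E}) \<le> (\<Sum>w\<in>W. card {E \<in> X. w \<in> E})"
    using B fin by (intro sum_mono2) auto
  ultimately have "(\<Sum>w\<in>B. real (card {E \<in> X. w \<in> E})) \<le> real (K * card X)"
    by (metis of_nat_le_iff of_nat_sum)
  moreover have "real (card B) * \<eta> \<le> (\<Sum>w\<in>B. real (card {E \<in> X. w \<in> E}))"
    using B(2) by (intro sum_bounded_below) auto
  ultimately show ?thesis by simp
qed

text \<open>For every partition the wrong parity of a family of edges can be corrected with one edge.\<close>

definition avoids_parity :: "nat \<Rightarrow> nat \<Rightarrow> nat \<Rightarrow> 'a set \<Rightarrow> (nat \<Rightarrow> 'a set set) \<Rightarrow> bool" where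
  "avoids_parity m k i V H \<longleftrightarrow> (\<forall>A B. A \<union> B = V \<longrightarrow> A \<inter> B = {} \<longrightarrow> A \<noteq> {} \<longrightarrow>
      (\<forall>j\<in>{1..m}. \<exists>E\<in>H j. E \<notin> parity_graph k i A B) \<or>
      even (card A + i * m) \<and> (\<forall>j\<in>{1..m}. \<exists>E\<in>H j. E \<in> parity_graph k i A B))"

text \<open>An element is bad if more than about \<eta> m^k edges of the model at it are missing;
  double counting leaves at most \<beta> m bad elements. The constants are chosen backwards: \<eta>
  from the switching inequality, \<beta> from balance and greedy covering, \<gamma> from \<beta> and
  \<eta>.\<close>

lemma perfect_matching_if_near_parity_graph:
  fixes k :: nat and c :: real
  assumes k: "3 \<le> k" and c: "0 < c"
  obtains \<gamma> m0 where "0 < \<gamma>" "\<And>m (V :: 'a set) A B i H. m0 \<le> m \<Longrightarrow> finite V \<Longrightarrow> card V = k * m \<Longrightarrow>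
    A \<union> B = V \<Longrightarrow> A \<inter> B = {} \<Longrightarrow> i < 2 \<Longrightarrow> (\<And>j. j \<in> {1..m} \<Longrightarrow> H j \<subseteq> nsets V k) \<Longrightarrow>
    \<bar>real (card A) - real (card B)\<bar> \<le> \<gamma> * real m \<Longrightarrow>
    real (card (tedges {1..m} (parity_graph k i A B) - T_graph m H)) \<le> \<gamma> * real m ^ (k + 1) \<Longrightarrow>
    (\<And>w. w \<in> T_verts m V \<Longrightarrow> c * real m ^ k \<le> real (card {E \<in> T_graph m H. w \<in> E})) \<Longrightarrow>
    avoids_parity m k i V H \<Longrightarrow> \<exists>M. perfect_matching (T_verts m V) (T_graph m H) M"
proof -
  \<comment> \<open>\<open>K\<close> is the edge size and K m the number of vertices;
    \<open>C\<close> appears in (K m)^(k - 1) = C m^(k - 1).\<close>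
  define K where "K = real (k + 1)"
  define C where "C = K ^ (k - 1)"
  \<comment> \<open>A class has x \<ge> m / 64 rows, hence x - k \<ge> m / 128; this \<eta> makes (k
    + 1) \<mu> at most half of (m / 128)^k.\<close>
  define \<eta> where "\<eta> = 1 / (2 * K * 128 ^ k)"
  \<comment> \<open>The multiples 16 + 1 and 8 k of card Bad in the balance condition together take
    at most m / 4; the second bound keeps the losses linear in card Bad below a quarter of the
    degree c m^k.\<close>
  define \<beta> where "\<beta> = min (1 / (4 * (17 + 8 * real k))) (c / (4 * (1 + 2 * K) * C))"
  \<comment> \<open>The first bound is the outcome of the double counting; 1 / 64 keeps eight times
    the initial imbalance at most m / 8.\<close>
  define \<gamma> where "\<gamma> = min (\<beta> * \<eta> / K) (1 / 64)"
  \<comment> \<open>128 K serves the step from m / 64 to m / 128 and the additive constants; the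
    other bound makes the constant part 2 K C of the greedy losses at most c m / 4.\<close>
  define m0 where "m0 = nat \<lceil>max (128 * K) (8 * K * C / c + 1)\<rceil>"
  have K: "4 \<le> K" using k by (simp add: K_def)
  have C: "0 < C" using K by (simp add: C_def)
  have \<eta>: "0 < \<eta>" using K by (simp add: \<eta>_def)
  have \<beta>: "0 < \<beta>" using K C c by (simp add: \<beta>_def)
  have \<gamma>: "0 < \<gamma>" using K \<eta> \<beta> by (simp add: \<gamma>_def)
  have \<beta>1: "\<beta> * (17 + 8 * real k) \<le> 1 / 4"
  proof -
    have "\<beta> \<le> 1 / (4 * (17 + 8 * real k))" by (simp add: \<beta>_def)
    then show ?thesis by (simp add: field_simps)
  qed
  have \<beta>2: "\<beta> * ((1 + 2 * K) * C) \<le> c / 4"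
  proof -
    define X where "X = (1 + 2 * K) * C"
    have "0 < X" using K C by (simp add: X_def)
    moreover have "\<beta> \<le> c / (4 * X)" unfolding \<beta>_def X_def mult.assoc[symmetric] by (rule min.cobounded2)
    ultimately show ?thesis unfolding X_def[symmetric] by (simp add: field_simps)
  qed
  have \<gamma>1: "\<gamma> \<le> 1 / 64" unfolding \<gamma>_def by (rule min.cobounded2)
  have \<gamma>2: "K * \<gamma> \<le> \<beta> * \<eta>"
  proof -
    have "\<gamma> \<le> \<beta> * \<eta> / K" by (simp add: \<gamma>_def)
    then show ?thesis using K by (simp add: field_simps)
  qed
  show ?thesis
  proof (rule that[OF \<gamma>, of m0])
    fix m and V A B :: "'a set" and i and H :: "nat \<Rightarrow> 'a set set"
    assume m: "m0 \<le> m" and V: "finite V" "card V = k * m" and AB: "A \<union> B = V" "A \<inter> B = {}"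
      and i: "i < 2" and H: "\<And>j. j \<in> {1..m} \<Longrightarrow> H j \<subseteq> nsets V k"
      and bal: "\<bar>real (card A) - real (card B)\<bar> \<le> \<gamma> * real m"
      and close: "real (card (tedges {1..m} (parity_graph k i A B) - T_graph m H)) \<le> \<gamma> * real m ^ (k + 1)"
      and deg: "\<And>w. w \<in> T_verts m V \<Longrightarrow> c * real m ^ k \<le> real (card {E \<in> T_graph m H. w \<in> E})"
      and par: "avoids_parity m k i V H"
    have "max (128 * K) (8 * K * C / c + 1) \<le> real m" using m unfolding m0_def by linarith
    then have m1: "128 * K \<le> real m" and m2: "8 * K * C / c + 1 \<le> real m" by simp_all
    have mpos: "0 < real m" using m1 K by linarith
    let ?W = "T_verts m V" and ?T = "T_graph m H" and ?G = "tedges {1..m} (parity_graph k i A B)"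
    have W: "finite ?W" using V by (auto simp: T_verts_def)
    have GW: "?G \<subseteq> nsets ?W (k + 1)"
    proof -
      have "?G \<subseteq> tedges {1..m} (nsets V k)" using AB by (auto simp: tedges_def parity_graph_def)
      then show ?thesis using tedges_subset_nsets by blast
    qed
    have finG: "finite ?G" using GW finite_imp_finite_nsets[OF W] finite_subset by blast
    define \<mu> where "\<mu> = nat \<lfloor>\<eta> * real m ^ k\<rfloor>"
    have \<mu>: "real \<mu> \<le> \<eta> * real m ^ k" "\<eta> * real m ^ k \<le> real \<mu> + 1"
      using \<eta> by (simp_all add: \<mu>_def)
    define Bad where "Bad = {w \<in> ?W. \<mu> < card {E \<in> ?G. w \<in> E \<and> E \<notin> ?T}}"
    have "real (card Bad) * (\<eta> * real m ^ k) \<le> real (k + 1) * real (card (?G - ?T))"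
    proof (rule card_high_degree[OF _ W])
      show "finite (?G - ?T)" using finG by simp
      show "E \<subseteq> ?W \<and> card E = k + 1" if "E \<in> ?G - ?T" for E
        using that GW by (auto simp: nsets_def)
      show "Bad \<subseteq> ?W" by (auto simp: Bad_def)
      fix w assume "w \<in> Bad"
      then have "\<mu> + 1 \<le> card {E \<in> ?G. w \<in> E \<and> E \<notin> ?T}" by (simp add: Bad_def)
      also have "{E \<in> ?G. w \<in> E \<and> E \<notin> ?T} = {E \<in> ?G - ?T. w \<in> E}" by blast
      finally have "real (\<mu> + 1) \<le> real (card {E \<in> ?G - ?T. w \<in> E})" by (simp only: of_nat_le_iff)
      then show "\<eta> * real m ^ k \<le> real (card {E \<in> ?G - ?T. w \<in> E})" using \<mu>(2) by simp
    qed
    also have "\<dots> \<le> K * (\<gamma> * real m ^ (k + 1))"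
      using close K unfolding K_def[symmetric] by (intro mult_left_mono) auto
    also have "\<dots> = (K * \<gamma>) * (real m * real m ^ k)" by simp
    also have "\<dots> \<le> (\<beta> * \<eta>) * (real m * real m ^ k)" using \<gamma>2 by (intro mult_right_mono) auto
    finally have "real (card Bad) * (\<eta> * real m ^ k) \<le> (\<beta> * real m) * (\<eta> * real m ^ k)"
      by (simp only: mult_ac)
    then have cB: "real (card Bad) \<le> \<beta> * real m"
      using \<eta> mpos by (simp add: mult_le_cancel_right)
    have b_small: "\<beta> * real m \<le> real m / 68"
    proof -
      have "\<beta> * 17 \<le> \<beta> * (17 + 8 * real k)" using \<beta> by (intro mult_left_mono) auto
      then have "\<beta> \<le> 1 / 68" using \<beta>1 by simp
      then have "\<beta> * real m \<le> (1 / 68) * real m" by (intro mult_right_mono) auto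
      then show ?thesis by simp
    qed
    show "\<exists>M. perfect_matching ?W ?T M"
    proof (rule perfect_matching_if_few_bad[OF k i V AB H, where Bad = Bad and \<mu> = \<mu> and \<delta> = "nat \<lceil>c * real m ^ k\<rceil>"])
      show "Bad \<subseteq> ?W" by (auto simp: Bad_def)
      show "card {E \<in> ?G. w \<in> E \<and> E \<notin> ?T} \<le> \<mu>" if "w \<in> ?W - Bad" for w
        using that by (auto simp: Bad_def)
      show "nat \<lceil>c * real m ^ k\<rceil> \<le> card {E \<in> ?T. w \<in> E}" if "w \<in> ?W" for w
        using deg[OF that] by (simp add: nat_le_iff ceiling_le_iff)
      show "(card Bad + 2 * ((k + 1) * (card Bad + 1))) * ((k + 1) * m) ^ (k - 1) < nat \<lceil>c * real m ^ k\<rceil>"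
      proof -
        have mk: "real m ^ k = real m * real m ^ (k - 1)" using k by (metis One_nat_def Suc_le_D Suc_1 diff_Suc_1 numeral_3_eq_3 power_Suc)
        have "real ((card Bad + 2 * ((k + 1) * (card Bad + 1))) * ((k + 1) * m) ^ (k - 1)) =
          ((1 + 2 * K) * real (card Bad) + 2 * K) * (C * real m ^ (k - 1))"
        proof -
          have "real (((k + 1) * m) ^ (k - 1)) = C * real m ^ (k - 1)"
            unfolding C_def K_def of_nat_power of_nat_mult power_mult_distrib ..
          moreover have "real (card Bad + 2 * ((k + 1) * (card Bad + 1))) = (1 + 2 * K) * real (card Bad) + 2 * K"
            by (simp add: K_def algebra_simps)
          ultimately show ?thesis by (simp only: of_nat_mult)
        qed
        also have "\<dots> \<le> ((1 + 2 * K) * (\<beta> * real m) + 2 * K) * (C * real m ^ (k - 1))"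
          using cB K C by (intro mult_right_mono add_right_mono mult_left_mono) auto
        also have "\<dots> = (\<beta> * ((1 + 2 * K) * C) * real m + 2 * K * C) * real m ^ (k - 1)"
          by (simp add: algebra_simps)
        also have "\<dots> < (c * real m) * real m ^ (k - 1)"
        proof (rule mult_strict_right_mono)
          have "\<beta> * ((1 + 2 * K) * C) * real m \<le> (c / 4) * real m" using \<beta>2 by (intro mult_right_mono) auto
          moreover have "8 * K * C + c \<le> c * real m" using m2 c by (simp add: field_simps)
          moreover have "0 < c * real m" using c mpos by simp
          ultimately show "\<beta> * ((1 + 2 * K) * C) * real m + 2 * K * C < c * real m"
            using c by linarith
        qed (use mpos in simp)
        also have "\<dots> = c * real m ^ k" by (simp add: mk)
        finally show ?thesis by (simp add: less_ceiling_iff zless_nat_eq_int_zless)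
      qed
      show "8 * \<bar>int (card A) - int (card B)\<bar> + 8 * (2 * int (card Bad) + int k * (int (card Bad) + 1))
        \<le> int m - (int (card Bad) + 1)"
      proof -
        have "\<gamma> * real m \<le> (1 / 64) * real m" using \<gamma>1 by (intro mult_right_mono) auto
        with bal have "\<bar>real (card A) - real (card B)\<bar> \<le> (1 / 64) * real m" by (rule order_trans)
        then have 1: "8 * \<bar>real (card A) - real (card B)\<bar> \<le> real m / 8" by simp
        have "real (card Bad) * (17 + 8 * real k) \<le> (\<beta> * real m) * (17 + 8 * real k)"
          using cB by (intro mult_right_mono) auto
        also have "\<dots> = (\<beta> * (17 + 8 * real k)) * real m" by simp
        also have "\<dots> \<le> (1 / 4) * real m" using \<beta>1 by (intro mult_right_mono) auto
        finally have 2: "17 * real (card Bad) + 8 * (real k * real (card Bad)) \<le> real m / 4"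
          by (simp add: algebra_simps)
        have 3: "8 * real k + 1 \<le> real m / 2" using m1 by (simp add: K_def)
        have "8 * \<bar>real (card A) - real (card B)\<bar> + 8 * (2 * real (card Bad) + real k * (real (card Bad) + 1))
          \<le> real m - (real (card Bad) + 1)"
          using 1 2 3 unfolding distrib_left by simp
        then have "real_of_int (8 * \<bar>int (card A) - int (card B)\<bar> + 8 * (2 * int (card Bad) + int k * (int (card Bad) + 1)))
          \<le> real_of_int (int m - (int (card Bad) + 1))" by simp
        then show ?thesis by (simp only: of_int_le_iff)
      qed
      have small: "real (card Bad) + 1 \<le> real m / 2" using cB b_small m1 K by linarith
      then have "real (64 + card Bad + 1) \<le> real m" using m1 K by simp
      then show "64 + card Bad + 1 \<le> m" by (simp only: of_nat_le_iff)
      show "k + 1 \<le> x \<and> (k + 1) * \<mu> < (x - k) ^ k" if x: "m \<le> 32 * x + card Bad + 1" for x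
      proof -
        have "real m \<le> real (32 * x + card Bad + 1)" using x by (simp only: of_nat_le_iff)
        then have x64: "real m \<le> 64 * real x" using small by simp
        then have "real (k + 1) \<le> real x" using m1 unfolding K_def[symmetric] using K by linarith
        then have kx: "k + 1 \<le> x" by (simp only: of_nat_le_iff)
        have "real k \<le> K" by (simp add: K_def)
        then have "real m / 128 \<le> real x - real k" using x64 m1 by linarith
        also have "\<dots> = real (x - k)" using kx by simp
        finally have "(real m / 128) ^ k \<le> real (x - k) ^ k" using mpos by (intro power_mono) auto
        moreover have "real ((k + 1) * \<mu>) < (real m / 128) ^ k"
        proof -
          have "real ((k + 1) * \<mu>) = K * real \<mu>" unfolding K_def by (rule of_nat_mult)
          also have "\<dots> \<le> K * (\<eta> * real m ^ k)" using \<mu>(1) K by (intro mult_left_mono) auto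
          also have "\<dots> = (real m / 128) ^ k / 2" using K by (simp add: \<eta>_def power_divide)
          also have "\<dots> < (real m / 128) ^ k" using mpos by simp
          finally show ?thesis .
        qed
        ultimately have "real ((k + 1) * \<mu>) < real ((x - k) ^ k)" by simp
        then show ?thesis using kx by (simp only: of_nat_less_iff)
      qed
    qed (use par in \<open>auto simp: avoids_parity_def\<close>)
  qed
qed

section \<open>Degrees in parity graphs\<close>

definition signed_sum :: "'a set \<Rightarrow> 'a set \<Rightarrow> nat \<Rightarrow> real" where
  "signed_sum A B r = (\<Sum>T\<in>nsets (A \<union> B) r. (- 1) ^ card (T \<inter> A))"

text \<open>The Krawtchouk number, the coefficient of \<open>x^r\<close> in \<open>(1 - x)^a * (1 + x)^b\<close>, in terms of
  \<open>D = b - a\<close> and \<open>N = a + b\<close>; see \<open>signed_sum_eq_kraw\<close>.\<close>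

fun kraw :: "nat \<Rightarrow> real \<Rightarrow> real \<Rightarrow> real" where
  "kraw 0 D N = 1"
| "kraw (Suc 0) D N = D"
| "kraw (Suc (Suc r)) D N = (D * kraw (Suc r) D N - (N - real r) * kraw r D N) / real (r + 2)"

text \<open>Double counting of pairs v \<in> T, indexed by T or by T - {v}; in the recurrence below
  it moves sums one level up and one level down.\<close>

lemma sum_nsets_insert:
  fixes g :: "'a set \<Rightarrow> 'a \<Rightarrow> real"
  assumes V: "finite V"
  shows "(\<Sum>T\<in>nsets V q. \<Sum>v\<in>V - T. g (insert v T) v) = (\<Sum>T\<in>nsets V (Suc q). \<Sum>v\<in>T. g T v)"
proof -
  have fin: "finite (nsets V r)" for r using V by (rule finite_imp_finite_nsets)
  have "(\<Sum>(T, v)\<in>Sigma (nsets V q) (\<lambda>T. V - T). g (insert v T) v) =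
      (\<Sum>(T, v)\<in>Sigma (nsets V (Suc q)) (\<lambda>T. T). g T v)"
  proof (rule sum.reindex_bij_witness[where j = "\<lambda>(T, v). (insert v T, v)" and i = "\<lambda>(T, v). (T - {v}, v)"])
    fix a assume a: "a \<in> Sigma (nsets V q) (\<lambda>T. V - T)"
    obtain T v where [simp]: "a = (T, v)" by (cases a)
    show "(case case a of (T, v) \<Rightarrow> (insert v T, v) of (T, v) \<Rightarrow> (T - {v}, v)) = a"
      using a by auto
    show "(case a of (T, v) \<Rightarrow> (insert v T, v)) \<in> Sigma (nsets V (Suc q)) (\<lambda>T. T)"
      using a by (auto simp: nsets_def)
    show "(case case a of (T, v) \<Rightarrow> (insert v T, v) of (T, v) \<Rightarrow> g T v) = (case a of (T, v) \<Rightarrow> g (insert v T) v)"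
      by simp
  next
    fix b assume b: "b \<in> Sigma (nsets V (Suc q)) (\<lambda>T. T)"
    obtain T v where [simp]: "b = (T, v)" by (cases b)
    show "(case case b of (T, v) \<Rightarrow> (T - {v}, v) of (T, v) \<Rightarrow> (insert v T, v)) = b"
      using b by auto
    show "(case b of (T, v) \<Rightarrow> (T - {v}, v)) \<in> Sigma (nsets V q) (\<lambda>T. V - T)"
      using b by (auto simp: nsets_def)
  qed
  moreover have "\<forall>T\<in>nsets V (Suc q). finite T" by (auto simp: nsets_def)
  ultimately show ?thesis using fin V by (subst sum.Sigma; simp)+
qed

text \<open>The sign \<open>\<chi>\<close> is multiplicative on disjoint sets, squares to 1, and
  sums to card B - card A over the vertices. In the product of this sum with S_(r+1), a vertex v
  outside T gives \<chi>(T \<union> {v}), hence r + 2 times S_(r+2); a vertex v in T gives \<chi>(T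
  - {v}), and each r-set arises once for every vertex outside it.\<close>

lemma signed_sum_recurrence:
  fixes A B :: "'a set"
  assumes fin: "finite A" "finite B" and AB: "A \<inter> B = {}"
  shows "real (r + 2) * signed_sum A B (r + 2) =
    (real (card B) - real (card A)) * signed_sum A B (r + 1)
      - (real (card A + card B) - real r) * signed_sum A B r"
proof -
  let ?V = "A \<union> B"
  have V: "finite ?V" "card ?V = card A + card B" using fin AB by (auto simp: card_Un_disjoint)
  define \<chi> :: "'a set \<Rightarrow> real" where "\<chi> T = (- 1) ^ card (T \<inter> A)" for T
  have Z: "signed_sum A B q = (\<Sum>T\<in>nsets ?V q. \<chi> T)" for q
    by (simp add: signed_sum_def \<chi>_def)
  have ins: "\<chi> (insert v T) = \<chi> {v} * \<chi> T" if "finite T" "v \<notin> T" for v T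
    using that by (auto simp: \<chi>_def Int_insert_left)
  have sq: "\<chi> {v} * \<chi> {v} = 1" for v by (auto simp: \<chi>_def Int_insert_left)
  have BA: "{v} \<inter> A = {}" if "v \<in> B" for v using that AB by blast
  have D: "(\<Sum>v\<in>?V. \<chi> {v}) = real (card B) - real (card A)"
  proof -
    have "(\<Sum>v\<in>?V. \<chi> {v}) = (\<Sum>v\<in>A. \<chi> {v}) + (\<Sum>v\<in>B. \<chi> {v})"
      using fin AB by (rule sum.union_disjoint)
    moreover have "(\<Sum>v\<in>A. \<chi> {v}) = (\<Sum>v\<in>A. - 1)" by (intro sum.cong) (auto simp: \<chi>_def)
    moreover have "(\<Sum>v\<in>B. \<chi> {v}) = (\<Sum>v\<in>B. 1)" by (intro sum.cong) (simp_all add: \<chi>_def BA)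
    ultimately show ?thesis by simp
  qed
  have "(real (card B) - real (card A)) * signed_sum A B (r + 1) =
      (\<Sum>T\<in>nsets ?V (Suc r). \<Sum>v\<in>?V. \<chi> {v} * \<chi> T)"
    unfolding D[symmetric] Z by (simp add: sum_product sum.swap[of _ _ "nsets ?V (Suc r)"])
  also have "\<dots> = (\<Sum>T\<in>nsets ?V (Suc r). (\<Sum>v\<in>T. \<chi> {v} * \<chi> T) + (\<Sum>v\<in>?V - T. \<chi> {v} * \<chi> T))"
  proof (rule sum.cong[OF refl])
    fix T assume "T \<in> nsets ?V (Suc r)"
    then have "T \<subseteq> ?V" by (auto simp: nsets_def)
    then show "(\<Sum>v\<in>?V. \<chi> {v} * \<chi> T) = (\<Sum>v\<in>T. \<chi> {v} * \<chi> T) + (\<Sum>v\<in>?V - T. \<chi> {v} * \<chi> T)"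
      using V(1) by (simp add: sum.subset_diff add.commute)
  qed
  also have "\<dots> = (\<Sum>T\<in>nsets ?V (Suc r). \<Sum>v\<in>T. \<chi> {v} * \<chi> T) +
      (\<Sum>T\<in>nsets ?V (Suc r). \<Sum>v\<in>?V - T. \<chi> {v} * \<chi> T)"
    by (rule sum.distrib)
  also have "(\<Sum>T\<in>nsets ?V (Suc r). \<Sum>v\<in>T. \<chi> {v} * \<chi> T) =
      (\<Sum>T\<in>nsets ?V r. \<Sum>v\<in>?V - T. \<chi> {v} * \<chi> (insert v T))"
    using sum_nsets_insert[OF V(1), of "\<lambda>T v. \<chi> {v} * \<chi> T" r] by simp
  also have "\<dots> = (\<Sum>T\<in>nsets ?V r. (real (card A + card B) - real r) * \<chi> T)"
  proof (rule sum.cong[OF refl])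
    fix T assume T: "T \<in> nsets ?V r"
    then have fT: "finite T" "T \<subseteq> ?V" "card T = r" by (auto simp: nsets_def)
    have "(\<Sum>v\<in>?V - T. \<chi> {v} * \<chi> (insert v T)) = (\<Sum>v\<in>?V - T. \<chi> T)"
    proof (rule sum.cong[OF refl])
      fix v assume "v \<in> ?V - T"
      then have "\<chi> (insert v T) = \<chi> {v} * \<chi> T" by (intro ins fT) auto
      then show "\<chi> {v} * \<chi> (insert v T) = \<chi> T" using sq[of v] by (simp only: mult.assoc[symmetric] mult_1_left)
    qed
    also have "\<dots> = real (card (?V - T)) * \<chi> T" by simp
    also have "card (?V - T) = card A + card B - r" using fT V by (simp add: card_Diff_subset)
    also have "real (card A + card B - r) = real (card A + card B) - real r"
      using card_mono[OF V(1) fT(2)] V fT by simp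
    finally show "(\<Sum>v\<in>?V - T. \<chi> {v} * \<chi> (insert v T)) = (real (card A + card B) - real r) * \<chi> T" .
  qed
  also have "\<dots> = (real (card A + card B) - real r) * signed_sum A B r"
    unfolding Z by (simp add: sum_distrib_left)
  also have "(\<Sum>T\<in>nsets ?V (Suc r). \<Sum>v\<in>?V - T. \<chi> {v} * \<chi> T) =
      (\<Sum>T\<in>nsets ?V (Suc r). \<Sum>v\<in>?V - T. \<chi> (insert v T))"
  proof (intro sum.cong refl)
    fix T v assume "T \<in> nsets ?V (Suc r)" "v \<in> ?V - T"
    then show "\<chi> {v} * \<chi> T = \<chi> (insert v T)" by (intro ins[symmetric]) (auto simp: nsets_def)
  qed
  also have "\<dots> = (\<Sum>T\<in>nsets ?V (Suc (Suc r)). \<Sum>v\<in>T. \<chi> T)"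
    using sum_nsets_insert[OF V(1), of "\<lambda>T v. \<chi> T" "Suc r"] by simp
  also have "\<dots> = (\<Sum>T\<in>nsets ?V (Suc (Suc r)). real (r + 2) * \<chi> T)"
    by (intro sum.cong refl) (auto simp: nsets_def)
  also have "\<dots> = real (r + 2) * signed_sum A B (r + 2)"
    unfolding Z by (simp add: sum_distrib_left)
  finally show ?thesis by simp
qed

lemma signed_sum_eq_kraw:
  assumes fin: "finite A" "finite B" and AB: "A \<inter> B = {}"
  shows "signed_sum A B r = kraw r (real (card B) - real (card A)) (real (card A + card B))"
proof (induction r rule: induct_nat_012)
  case 0
  then show ?case by (simp add: signed_sum_def nsets_zero)
next
  case 1
  have "signed_sum A B 1 = (\<Sum>v\<in>A \<union> B. (- 1) ^ card ({v} \<inter> A))"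
    unfolding signed_sum_def One_nat_def nsets_one
    by (subst sum.reindex) (auto simp: inj_on_def)
  also have "\<dots> = (\<Sum>v\<in>A. (- 1) ^ card ({v} \<inter> A)) + (\<Sum>v\<in>B. (- 1) ^ card ({v} \<inter> A))"
    using fin AB by (rule sum.union_disjoint)
  also have "(\<Sum>v\<in>A. (- 1) ^ card ({v} \<inter> A)) = (\<Sum>v\<in>A. - 1 :: real)"
    by (intro sum.cong) auto
  also have "(\<Sum>v\<in>B. (- 1) ^ card ({v} \<inter> A)) = (\<Sum>v\<in>B. 1 :: real)"
  proof (rule sum.cong[OF refl])
    fix v assume "v \<in> B"
    then have "{v} \<inter> A = {}" using AB by blast
    then show "(- 1) ^ card ({v} \<inter> A) = (1 :: real)" by simp
  qed
  finally show ?case by simp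
next
  case (ge2 r)
  then show ?case
    using signed_sum_recurrence[OF assms, of r] by (simp add: field_simps)
qed

text \<open>Multiplied by (r + 1)!, the recurrence passes from D^(r+1) to D^(r+2) through its factor
  D, and its second term is O(N^(r+1)), one order below N^(r+2). The factor N on the left stands for
  the exponent r - 1 on the right, which natural numbers do not allow at r = 0.\<close>

lemma kraw_bound:
  "\<exists>E\<ge>0. \<forall>D N. 1 \<le> N \<longrightarrow> \<bar>D\<bar> \<le> N \<longrightarrow> \<bar>fact r * kraw r D N - D ^ r\<bar> * N \<le> E * N ^ r"
proof (induction r rule: induct_nat_012)
  case 0
  then show ?case by (intro exI[of _ 0]) simp
next
  case 1
  then show ?case by (intro exI[of _ 0]) simp
next
  case (ge2 r)
  obtain E0 where E0: "E0 \<ge> 0"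
    "\<And>D N. 1 \<le> N \<Longrightarrow> \<bar>D\<bar> \<le> N \<Longrightarrow> \<bar>fact r * kraw r D N - D ^ r\<bar> * N \<le> E0 * N ^ r"
    using ge2(1) by blast
  obtain E1 where E1: "E1 \<ge> 0"
    "\<And>D N. 1 \<le> N \<Longrightarrow> \<bar>D\<bar> \<le> N \<Longrightarrow> \<bar>fact (Suc r) * kraw (Suc r) D N - D ^ Suc r\<bar> * N \<le> E1 * N ^ Suc r"
    using ge2(2) by blast
  define R where "R = real (r + 1)"
  have R: "R \<ge> 1" by (simp add: R_def)
  show ?case
  proof (intro exI[of _ "E1 + R * R * (1 + E0)"] conjI allI impI)
    show "0 \<le> E1 + R * R * (1 + E0)" using E0 E1 R by simp
    fix D N :: real assume N: "1 \<le> N" and D: "\<bar>D\<bar> \<le> N"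
    let ?k0 = "fact r * kraw r D N" and ?k1 = "fact (Suc r) * kraw (Suc r) D N"
    have eq: "fact (Suc (Suc r)) * kraw (Suc (Suc r)) D N = D * ?k1 - R * (N - real r) * ?k0"
      by (simp add: R_def field_simps)
    have k0: "\<bar>?k0\<bar> \<le> (1 + E0) * N ^ r"
    proof -
      have "\<bar>?k0 - D ^ r\<bar> \<le> \<bar>?k0 - D ^ r\<bar> * N" using N by (simp add: mult_le_cancel_left1)
      then have "\<bar>?k0 - D ^ r\<bar> \<le> E0 * N ^ r" using E0(2)[OF N D] by linarith
      moreover have "\<bar>D ^ r\<bar> \<le> N ^ r" unfolding power_abs using D by (intro power_mono) auto
      ultimately show ?thesis by (simp add: algebra_simps)
    qed
    have nr: "\<bar>N - real r\<bar> \<le> R * N"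
    proof -
      have "real r * 1 \<le> real r * N" using N by (intro mult_left_mono) auto
      then show ?thesis using N by (simp add: R_def algebra_simps)
    qed
    have "\<bar>D * ?k1 - R * (N - real r) * ?k0 - D ^ Suc (Suc r)\<bar> =
        \<bar>D * (?k1 - D ^ Suc r) - R * (N - real r) * ?k0\<bar>" by (simp add: algebra_simps)
    also have "\<dots> \<le> \<bar>D\<bar> * \<bar>?k1 - D ^ Suc r\<bar> + R * \<bar>N - real r\<bar> * \<bar>?k0\<bar>"
      using R abs_triangle_ineq4[of "D * (?k1 - D ^ Suc r)" "R * (N - real r) * ?k0"]
      by (simp add: abs_mult)
    also have "\<dots> \<le> N * \<bar>?k1 - D ^ Suc r\<bar> + R * (R * N) * ((1 + E0) * N ^ r)"
      using D nr k0 R N E0 by (intro add_mono mult_mono mult_right_mono mult_left_mono) auto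
    finally have "\<bar>D * ?k1 - R * (N - real r) * ?k0 - D ^ Suc (Suc r)\<bar> * N \<le>
        (N * \<bar>?k1 - D ^ Suc r\<bar> + R * (R * N) * ((1 + E0) * N ^ r)) * N"
      using N by (intro mult_right_mono) auto
    also have "\<dots> = N * (\<bar>?k1 - D ^ Suc r\<bar> * N) + R * R * (1 + E0) * N ^ Suc (Suc r)"
      by (simp add: algebra_simps)
    also have "\<dots> \<le> N * (E1 * N ^ Suc r) + R * R * (1 + E0) * N ^ Suc (Suc r)"
      using E1(2)[OF N D] N by (intro add_right_mono mult_left_mono) auto
    also have "\<dots> = (E1 + R * R * (1 + E0)) * N ^ Suc (Suc r)" by (simp add: algebra_simps)
    finally show "\<bar>fact (Suc (Suc r)) * kraw (Suc (Suc r)) D N - D ^ Suc (Suc r)\<bar> * N \<le>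
        (E1 + R * R * (1 + E0)) * N ^ Suc (Suc r)" unfolding eq .
  qed
qed

text \<open>With s = card (S \<inter> A), the indicator of the right parity is half of 1 + (-1)^(i +
  s) (-1)^|T \<inter> A|; so the degree is half a binomial coefficient plus or minus half a signed
  sum over V - S. Removing S changes the difference of the two sides by 2 s - l.\<close>

lemma deg_parity_graph:
  assumes V: "finite V" "A \<union> B = V" "A \<inter> B = {}" and i: "i < 2" and l: "l \<le> k"
    and S: "S \<in> nsets V l"
  shows "real (deg (parity_graph k i A B) S) = (real ((card V - l) choose (k - l)) + (- 1) ^ (i + card (S \<inter> A)) *
    kraw (k - l) (real (card B) - real (card A) - real l + 2 * real (card (S \<inter> A))) (real (card V - l))) / 2"
proof -
  have fin: "finite A" "finite B" using V by auto
  have S': "S \<subseteq> V" "finite S" "card S = l" using S by (auto simp: nsets_def)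
  have lV: "l \<le> card V" using S' V card_mono by blast
  let ?N = "nsets (V - S) (k - l)" and ?s = "card (S \<inter> A)"
  have finN: "finite ?N" using V by (intro finite_imp_finite_nsets) simp
  have cu: "card ((S \<union> T) \<inter> A) = ?s + card (T \<inter> A)" if "S \<inter> T = {}" "finite T" for T
  proof -
    have "(S \<union> T) \<inter> A = (S \<inter> A) \<union> (T \<inter> A)" by blast
    then show ?thesis using that S' by (simp add: card_Un_disjoint Int_ac disjoint_iff)
  qed
  have "{T. S \<inter> T = {} \<and> S \<union> T \<in> parity_graph k i A B} =
      {T \<in> ?N. (?s + card (T \<inter> A)) mod 2 = i}"
  proof (intro equalityI subsetI)
    fix T assume T: "T \<in> {T. S \<inter> T = {} \<and> S \<union> T \<in> parity_graph k i A B}"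
    then have T': "S \<inter> T = {}" "S \<union> T \<subseteq> V" "finite T" "card (S \<union> T) = k" "card ((S \<union> T) \<inter> A) mod 2 = i"
      using V(2) by (auto simp: parity_graph_def nsets_def)
    then have "card T = k - l" using S' by (simp add: card_Un_disjoint)
    then show "T \<in> {T \<in> ?N. (?s + card (T \<inter> A)) mod 2 = i}"
      using T' cu by (auto simp: nsets_def)
  next
    fix T assume T: "T \<in> {T \<in> ?N. (?s + card (T \<inter> A)) mod 2 = i}"
    then have T': "S \<inter> T = {}" "T \<subseteq> V" "finite T" "card T = k - l" by (auto simp: nsets_def)
    then have "card (S \<union> T) = k" using S' l by (simp add: card_Un_disjoint)
    then show "T \<in> {T. S \<inter> T = {} \<and> S \<union> T \<in> parity_graph k i A B}"
      using T T' S' cu V(2) by (auto simp: parity_graph_def nsets_def)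
  qed
  then have "real (deg (parity_graph k i A B) S) = (\<Sum>T\<in>{T \<in> ?N. (?s + card (T \<inter> A)) mod 2 = i}. 1)"
    by (simp add: deg_def)
  also have "\<dots> = (\<Sum>T\<in>?N. if (?s + card (T \<inter> A)) mod 2 = i then 1 else 0)"
    using finN by (intro sum.inter_filter)
  also have "\<dots> = (\<Sum>T\<in>?N. (1 + (- 1) ^ (i + ?s) * (- 1) ^ card (T \<inter> A)) / 2)"
  proof (rule sum.cong[OF refl])
    fix T
    have "(- 1 :: real) ^ (i + ?s) * (- 1) ^ card (T \<inter> A) = (- 1) ^ (i + (?s + card (T \<inter> A)))"
      by (simp add: power_add)
    also have "\<dots> = (if (?s + card (T \<inter> A)) mod 2 = i then 1 else - 1)"
    proof -
      have "i = 0 \<or> i = 1" using i by auto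
      then show ?thesis by (elim disjE) (simp_all add: minus_one_power_iff mod2_eq_if)
    qed
    finally show "(if (?s + card (T \<inter> A)) mod 2 = i then 1 else 0) =
        (1 + (- 1) ^ (i + ?s) * (- 1) ^ card (T \<inter> A)) / (2 :: real)" by simp
  qed
  also have "\<dots> = (real (card ?N) + (- 1) ^ (i + ?s) * (\<Sum>T\<in>?N. (- 1) ^ card (T \<inter> A))) / 2"
    by (simp add: sum_divide_distrib[symmetric] sum.distrib sum_distrib_left)
  also have "(\<Sum>T\<in>?N. (- 1 :: real) ^ card (T \<inter> A)) = signed_sum (A - S) (B - S) (k - l)"
  proof -
    have "(A - S) \<union> (B - S) = V - S" using V by blast
    moreover have "T \<inter> A = T \<inter> (A - S)" if "T \<in> ?N" for T using that by (auto simp: nsets_def)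
    ultimately show ?thesis unfolding signed_sum_def by simp
  qed
  also have "\<dots> = kraw (k - l) (real (card (B - S)) - real (card (A - S))) (real (card (A - S) + card (B - S)))"
    using fin V by (intro signed_sum_eq_kraw) auto
  also have "card (A - S) + card (B - S) = card V - l"
  proof -
    have "card (A - S) + card (B - S) = card ((A - S) \<union> (B - S))"
      using fin V by (intro card_Un_disjoint[symmetric]) auto
    also have "(A - S) \<union> (B - S) = V - S" using V by blast
    finally show ?thesis using S' V by (simp add: card_Diff_subset)
  qed
  also have "real (card (B - S)) - real (card (A - S)) = real (card B) - real (card A) - real l + 2 * real ?s"
  proof -
    have "card (S \<inter> A) + card (S \<inter> B) = card ((S \<inter> A) \<union> (S \<inter> B))"
      using S' V by (intro card_Un_disjoint[symmetric]) auto
    also have "(S \<inter> A) \<union> (S \<inter> B) = S" using S' V by blast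
    finally have "card (S \<inter> A) + card (S \<inter> B) = l" using S' by simp
    moreover have "card (A - S) + card (S \<inter> A) = card A" "card (B - S) + card (S \<inter> B) = card B"
      using fin by (simp_all add: card_Diff_subset_Int Int_commute card_mono)
    ultimately show ?thesis by linarith
  qed
  also have "card ?N = (card V - l) choose (k - l)" using S' V by (simp add: card_Diff_subset)
  finally show ?thesis .
qed

section \<open>Minimum degrees and the order of magnitude of \<open>delta_ext\<close>\<close>

lemma min_deg_le: "finite V \<Longrightarrow> S \<in> nsets V l \<Longrightarrow> min_deg V l H \<le> deg H S"
  unfolding min_deg_def by (intro Min_le) (auto simp: finite_imp_finite_nsets)

lemma min_deg_ge:
  assumes "finite V" "l \<le> card V" "\<And>S. S \<in> nsets V l \<Longrightarrow> x \<le> deg H S"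
  shows "x \<le> min_deg V l H"
proof -
  have "nsets V l \<noteq> {}" using assms(1,2) by (simp add: nsets_eq_empty_iff)
  then show ?thesis
    unfolding min_deg_def using assms by (subst Min_ge_iff) (auto simp: finite_imp_finite_nsets)
qed

lemma deg_mono:
  assumes V: "finite V" and H: "H \<subseteq> H'" "H' \<subseteq> nsets V k"
  shows "deg H S \<le> deg H' S"
proof -
  have "{T. S \<inter> T = {} \<and> S \<union> T \<in> H'} \<subseteq> Pow V" using H by (auto simp: nsets_def)
  then have "finite {T. S \<inter> T = {} \<and> S \<union> T \<in> H'}" using V by (meson finite_Pow_iff finite_subset)
  then show ?thesis unfolding deg_def using H by (intro card_mono) auto
qed

lemma min_deg_mono:
  assumes "finite V" "l \<le> card V" "H \<subseteq> H'" "H' \<subseteq> nsets V k"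
  shows "min_deg V l H \<le> min_deg V l H'"
proof (rule min_deg_ge[OF assms(1,2)])
  fix S assume "S \<in> nsets V l"
  then have "min_deg V l H \<le> deg H S" using assms(1) by (intro min_deg_le)
  also have "\<dots> \<le> deg H' S" using assms by (intro deg_mono)
  finally show "min_deg V l H \<le> deg H' S" .
qed

lemma min_deg_le_delta_ext:
  assumes "finite V" "ext_triple V k i A B"
  shows "min_deg V l (parity_graph k i A B) \<le> delta_ext V k l"
proof -
  have "ext V k \<subseteq> Pow (nsets V k)"
    by (auto simp: ext_def ext_triple_def parity_graph_def)
  then have "finite (ext V k)"
    using finite_imp_finite_nsets[OF assms(1)] by (meson finite_Pow_iff finite_subset)
  moreover have "parity_graph k i A B \<in> ext V k" using assms(2) by (auto simp: ext_def)
  ultimately show ?thesis unfolding delta_ext_def by (intro Max_ge) auto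
qed

lemma parity_graph_subset: "A \<union> B = V \<Longrightarrow> parity_graph k i A B \<subseteq> nsets V k"
  by (auto simp: parity_graph_def)

lemma kraw_small_power:
  obtains E where "0 \<le> E" "\<And>D N. 1 \<le> N \<Longrightarrow> \<bar>D\<bar> \<le> N \<Longrightarrow>
    \<bar>fact (Suc q) * kraw (Suc q) D N - D ^ Suc q\<bar> \<le> E * N ^ q"
proof -
  obtain E where E: "0 \<le> E" "\<And>D N. 1 \<le> N \<Longrightarrow> \<bar>D\<bar> \<le> N \<Longrightarrow>
    \<bar>fact (Suc q) * kraw (Suc q) D N - D ^ Suc q\<bar> * N \<le> E * N ^ Suc q"
    using kraw_bound[of "Suc q"] by blast
  show ?thesis
  proof (rule that[OF E(1)])
    fix D N :: real assume N: "1 \<le> N" "\<bar>D\<bar> \<le> N"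
    have "\<bar>fact (Suc q) * kraw (Suc q) D N - D ^ Suc q\<bar> * N \<le> (E * N ^ q) * N"
      using E(2)[OF N] by (simp add: mult.commute mult.left_commute)
    then show "\<bar>fact (Suc q) * kraw (Suc q) D N - D ^ Suc q\<bar> \<le> E * N ^ q"
      using N(1) by (simp add: mult_le_cancel_right)
  qed
qed

text \<open>The witness has |A| odd and within 1 of n / 2 and is taken with parity 0, where
  membership in \<open>ext\<close> just says that |A| is odd. The differences D occurring in its
  degrees are at most l + 2 in absolute value, so all signed sums are O((n - l)^(k - l -
  1)).\<close>

lemma delta_ext_lower:
  assumes l: "l < k"
  obtains E where "0 \<le> E" "\<And>V :: 'a set. finite V \<Longrightarrow> 2 * l + 3 \<le> card V \<Longrightarrow>
    real ((card V - l) choose (k - l)) \<le> 2 * real (delta_ext V k l) + E * real (card V - l) ^ (k - l - 1)"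
proof -
  define q where "q = k - l - 1"
  have q: "k - l = Suc q" using l by (simp add: q_def)
  obtain E where E: "0 \<le> E" "\<And>D N. 1 \<le> N \<Longrightarrow> \<bar>D\<bar> \<le> N \<Longrightarrow>
    \<bar>fact (Suc q) * kraw (Suc q) D N - D ^ Suc q\<bar> \<le> E * N ^ q"
    using kraw_small_power by blast
  define E' where "E' = E + (real l + 2) ^ Suc q + 1"
  show ?thesis
  proof (rule that[of E'])
    show "0 \<le> E'" using E by (simp add: E'_def)
    fix V :: "'a set" assume V: "finite V" "2 * l + 3 \<le> card V"
    let ?n = "card V" and ?N = "real (card V - l)"
    define a where "a = (if odd (?n div 2) then ?n div 2 else ?n div 2 + 1)"
    have a: "odd a" "a \<le> ?n" "\<bar>real ?n - 2 * real a\<bar> \<le> 2" using V(2) unfolding a_def by auto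
    obtain A where A: "A \<subseteq> V" "card A = a" using obtain_subset_with_card_n[OF a(2)] by blast
    define B where "B = V - A"
    have AB: "A \<union> B = V" "A \<inter> B = {}" using A by (auto simp: B_def)
    have cB: "card A + card B = ?n" using A V finite_subset[OF A(1) V(1)] a(2)
      by (simp add: B_def card_Diff_subset)
    have N: "1 \<le> ?N" "real l + 2 \<le> ?N" using V(2) by simp_all
    have "real ((card V - l) choose (k - l)) - E' * ?N ^ q \<le> 2 * real (deg (parity_graph k 0 A B) S)"
      if S: "S \<in> nsets V l" for S
    proof -
      let ?s = "card (S \<inter> A)" and ?D = "real (card B) - real (card A) - real l + 2 * real (card (S \<inter> A))"
      have "?s \<le> l" using S by (metis (mono_tags, lifting) Int_lower1 card_mono mem_Collect_eq nsets_def)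
      moreover have "\<bar>real (card B) - real (card A)\<bar> \<le> 2" using a(3) A(2) cB by linarith
      ultimately have D: "\<bar>?D\<bar> \<le> real l + 2" by linarith
      have "\<bar>fact (Suc q) * kraw (Suc q) ?D ?N\<bar> \<le> E * ?N ^ q + (real l + 2) ^ Suc q"
      proof -
        have "\<bar>?D ^ Suc q\<bar> \<le> (real l + 2) ^ Suc q"
          unfolding power_abs using D by (intro power_mono) auto
        moreover have "\<bar>?D\<bar> \<le> ?N" using D N(2) by (rule order_trans)
        ultimately show ?thesis using E(2)[OF N(1), of ?D] by linarith
      qed
      also have "\<dots> \<le> E * ?N ^ q + (real l + 2) ^ Suc q * ?N ^ q"
        using mult_left_mono[of 1 "?N ^ q" "(real l + 2) ^ Suc q"] one_le_power[OF N(1)]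
        by (simp del: power_Suc of_nat_diff)
      also have "\<dots> \<le> E' * ?N ^ q" unfolding E'_def distrib_right by simp
      finally have "\<bar>fact (Suc q) * kraw (Suc q) ?D ?N\<bar> \<le> E' * ?N ^ q" .
      moreover have "\<bar>kraw (Suc q) ?D ?N\<bar> \<le> \<bar>fact (Suc q) * kraw (Suc q) ?D ?N\<bar>"
        using mult_right_mono[of 1 "fact (Suc q)" "\<bar>kraw (Suc q) ?D ?N\<bar>"]
        by (simp add: abs_mult del: fact_Suc kraw.simps)
      ultimately have kr: "\<bar>kraw (k - l) ?D ?N\<bar> \<le> E' * ?N ^ q" unfolding q by linarith
      have "2 * real (deg (parity_graph k 0 A B) S) =
        real ((?n - l) choose (k - l)) + (- 1) ^ (0 + ?s) * kraw (k - l) ?D ?N"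
        using deg_parity_graph[OF V(1) AB, of 0 l k S] S l by simp
      moreover have "\<bar>(- 1) ^ (0 + ?s) * kraw (k - l) ?D ?N\<bar> = \<bar>kraw (k - l) ?D ?N\<bar>"
        by (simp add: abs_mult)
      ultimately show ?thesis using kr by linarith
    qed
    then have "real ((card V - l) choose (k - l)) - E' * ?N ^ q \<le> 2 * real (min_deg V l (parity_graph k 0 A B))"
    proof -
      assume *: "\<And>S. S \<in> nsets V l \<Longrightarrow> real ((card V - l) choose (k - l)) - E' * ?N ^ q \<le>
        2 * real (deg (parity_graph k 0 A B) S)"
      let ?x = "(real ((card V - l) choose (k - l)) - E' * ?N ^ q) / 2"
      have "nat \<lceil>?x\<rceil> \<le> min_deg V l (parity_graph k 0 A B)"
      proof (rule min_deg_ge[OF V(1)])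
        fix S assume S: "S \<in> nsets V l"
        have "?x \<le> real (deg (parity_graph k 0 A B) S)" using *[OF S] by simp
        then show "nat \<lceil>?x\<rceil> \<le> deg (parity_graph k 0 A B) S" by (simp only: nat_le_iff ceiling_le_iff of_int_of_nat_eq)
      qed (use V in simp)
      then have "?x \<le> real (min_deg V l (parity_graph k 0 A B))" by linarith
      then show ?thesis by simp
    qed
    moreover have "min_deg V l (parity_graph k 0 A B) \<le> delta_ext V k l"
      using AB a(1) A(2) by (intro min_deg_le_delta_ext[OF V(1)]) (simp add: ext_triple_def)
    ultimately show "real ((card V - l) choose (k - l)) \<le> 2 * real (delta_ext V k l) + E' * ?N ^ (k - l - 1)"
      unfolding q_def[symmetric] by linarith
  qed
qed

lemma delta_ext_linear:
  assumes l: "l < k"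
  obtains c n0 where "0 < c" "\<And>V :: 'a set. finite V \<Longrightarrow> n0 \<le> card V \<Longrightarrow>
    c * real (card V) ^ (k - l) \<le> real (delta_ext V k l)"
proof -
  define q where "q = k - l - 1"
  have q: "k - l = Suc q" using l by (simp add: q_def)
  obtain E where E: "0 \<le> E" "\<And>V :: 'a set. finite V \<Longrightarrow> 2 * l + 3 \<le> card V \<Longrightarrow>
    real ((card V - l) choose (k - l)) \<le> 2 * real (delta_ext V k l) + E * real (card V - l) ^ (k - l - 1)"
    using delta_ext_lower[OF l] by blast
  define R where "R = real (Suc q) ^ Suc q"
  have R: "0 < R" by (simp add: R_def)
  \<comment> \<open>The binomial coefficient is at least N^(q + 1) / R with N = n - l. Half of this
    absorbs the error, another factor 2 is the one in front of \<open>delta_ext\<close>, and 2^(q +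
    1) comes from n \<le> 2 N.\<close>
  define c where "c = 1 / (4 * R * 2 ^ Suc q)"
  define n0 where "n0 = max (2 * l + 3 + Suc q) (l + nat \<lceil>2 * E * R\<rceil>)"
  show ?thesis
  proof (rule that[of c n0])
    show "0 < c" using R by (simp add: c_def)
    fix V :: "'a set" assume V: "finite V" "n0 \<le> card V"
    let ?N = "real (card V - l)"
    have n: "2 * l + 3 \<le> card V" "Suc q \<le> card V - l" and N: "2 * E * R \<le> ?N"
      using V(2) unfolding n0_def by linarith+
    have Npos: "0 < ?N" using n by simp
    have "?N ^ Suc q / R \<le> real ((card V - l) choose Suc q)"
      using binomial_ge_n_over_k_pow_k[OF n(2), where 'a = real] by (simp only: R_def power_divide)
    moreover have "E * ?N ^ q \<le> ?N ^ Suc q / (2 * R)"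
    proof -
      have "(2 * E * R) * ?N ^ q \<le> ?N * ?N ^ q" using N by (intro mult_right_mono) auto
      then show ?thesis using R by (simp add: field_simps)
    qed
    moreover have "real ((card V - l) choose Suc q) \<le> 2 * real (delta_ext V k l) + E * ?N ^ q"
      using E(2)[OF V(1) n(1)] by (simp add: q)
    ultimately have "?N ^ Suc q / R - ?N ^ Suc q / (2 * R) \<le> 2 * real (delta_ext V k l)" by linarith
    moreover have "?N ^ Suc q / R - ?N ^ Suc q / (2 * R) = ?N ^ Suc q / (2 * R)"
      using R by (simp add: field_simps)
    ultimately have 1: "?N ^ Suc q / (4 * R) \<le> real (delta_ext V k l)" by simp
    have "real (card V) \<le> 2 * ?N" using n by simp
    then have "real (card V) ^ Suc q \<le> (2 * ?N) ^ Suc q" by (intro power_mono) auto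
    then have "c * real (card V) ^ Suc q \<le> c * (2 * ?N) ^ Suc q" using R by (intro mult_left_mono) (auto simp: c_def)
    also have "\<dots> = ?N ^ Suc q / (4 * R)" by (simp add: c_def power_mult_distrib)
    finally show "c * real (card V) ^ (k - l) \<le> real (delta_ext V k l)" using 1 unfolding q by linarith
  qed
qed

section \<open>Parity graphs outside \<open>ext\<close> and the availability of a correcting
  edge\<close>

lemma obtain_nset_meeting:
  assumes "finite A" "finite B" "A \<inter> B = {}" "s \<le> l" "s \<le> card A" "l - s \<le> card B"
  obtains S where "S \<in> nsets (A \<union> B) l" "card (S \<inter> A) = s"
proof -
  obtain S1 where S1: "S1 \<subseteq> A" "card S1 = s" using obtain_subset_with_card_n[OF assms(5)] by blast
  obtain S2 where S2: "S2 \<subseteq> B" "card S2 = l - s" using obtain_subset_with_card_n[OF assms(6)] by blast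
  have fin: "finite S1" "finite S2"
    using finite_subset[OF S1(1) assms(1)] finite_subset[OF S2(1) assms(2)] by auto
  have "(S1 \<union> S2) \<inter> A = S1" using S1 S2 assms(3) by blast
  moreover have "card (S1 \<union> S2) = l"
    using S1 S2 fin assms(3,4) by (subst card_Un_disjoint) auto
  ultimately show ?thesis
    using that[of "S1 \<union> S2"] S1 S2 fin by (auto simp: nsets_def)
qed

text \<open>Moving v from A to B replaces D by D + 2 in the degree formula. Hence an l-set with s
  vertices in the new A has for parity \<sigma> the degree that an l-set with s + 1 vertices in the
  old A has for parity 1 - \<sigma>. Only s = l has no old counterpart, and there the sign is made
  favourable by the choice of \<sigma>. Both choices lie in \<open>ext\<close>, since card A - 1 is
  odd and n / k is even.\<close>

lemma min_parity_le_delta_ext: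
  assumes V: "finite V" "A \<union> B = V" "A \<inter> B = {}" and A: "A \<noteq> {}" and l: "l < k" "l \<le> card V"
    and ev: "even (card A)" "even (card V div k)"
  shows "\<exists>i<2. min_deg V l (parity_graph k i A B) \<le> delta_ext V k l"
proof (rule ccontr)
  let ?\<delta> = "delta_ext V k l"
  assume "\<not> ?thesis"
  then have big: "?\<delta> < min_deg V l (parity_graph k i A B)" if "i < 2" for i using that by force
  obtain v where v: "v \<in> A" using A by blast
  define A' B' where "A' = A - {v}" and "B' = insert v B"
  have AB': "A' \<union> B' = V" "A' \<inter> B' = {}" using V v by (auto simp: A'_def B'_def)
  have fin: "finite A" "finite B" "finite A'" "finite B'" using V by (auto simp: A'_def B'_def)
  have cA: "card A = Suc (card A')" using card.remove[OF fin(1) v] by (simp add: A'_def)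
  have cB: "card B' = Suc (card B)" using subsetD[OF equalityD1[OF V(3)], of v] v fin(2) by (auto simp: B'_def card_insert_if)
  let ?C = "real ((card V - l) choose (k - l))" and ?N = "real (card V - l)"
  define K where "K s = kraw (k - l) (real (card B) - real (card A) - real l + 2 * real s) ?N" for s
  have d: "2 * real (deg (parity_graph k i A B) S) = ?C + (- 1) ^ (i + card (S \<inter> A)) * K (card (S \<inter> A))"
    if "S \<in> nsets V l" "i < 2" for S i
    using deg_parity_graph[OF V that(2) less_imp_le[OF l(1)] that(1)] by (simp add: K_def)
  have d': "2 * real (deg (parity_graph k i A' B') S) = ?C + (- 1) ^ (i + card (S \<inter> A')) * K (Suc (card (S \<inter> A')))"
    if "S \<in> nsets V l" "i < 2" for S i
  proof -
    have eq: "real (card B') - real (card A') - real l + 2 * real (card (S \<inter> A')) =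
      real (card B) - real (card A) - real l + 2 * real (Suc (card (S \<inter> A')))"
      using cA cB by simp
    show ?thesis
      using deg_parity_graph[OF V(1) AB' that(2) less_imp_le[OF l(1)] that(1)] unfolding K_def eq by simp
  qed
  have low: "real ?\<delta> + 1 \<le> real (deg (parity_graph k i A B) S)" if "S \<in> nsets V l" "i < 2" for S i
    using big[OF that(2)] min_deg_le[OF V(1) that(1), of "parity_graph k i A B"] by linarith
  \<comment> \<open>The two parity graphs are complementary, so the two degrees of any l-set add up
    to the binomial coefficient.\<close>
  have C: "2 * (real ?\<delta> + 1) \<le> ?C"
  proof -
    obtain S where S: "S \<in> nsets V l" using nsets_eq_empty_iff[of V l] l(2) by fastforce
    show ?thesis using low[OF S, of 0] low[OF S, of 1] d[OF S, of 0] d[OF S, of 1] by simp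
  qed
  \<comment> \<open>No l-set realises the value at l + 1 in the old partition; \<sigma> makes its
    contribution nonnegative, so that the degree is at least half the binomial coefficient.\<close>
  obtain \<sigma> :: nat where \<sigma>: "\<sigma> < 2" "0 \<le> (- 1) ^ (\<sigma> + l) * K (Suc l)"
  proof (cases "0 \<le> (- 1) ^ l * K (Suc l)")
    case True
    then show ?thesis using that[of 0] by simp
  next
    case False
    then show ?thesis using that[of 1] by simp
  qed
  have "?\<delta> + 1 \<le> min_deg V l (parity_graph k \<sigma> A' B')"
  proof (rule min_deg_ge[OF V(1) l(2)])
    fix S assume S: "S \<in> nsets V l"
    then have S': "S \<subseteq> V" "finite S" "card S = l" by (auto simp: nsets_def)
    let ?s = "card (S \<inter> A')"
    have s: "?s + card (S \<inter> B') = l"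
    proof -
      have "?s + card (S \<inter> B') = card ((S \<inter> A') \<union> (S \<inter> B'))"
        using S' AB' by (intro card_Un_disjoint[symmetric]) auto
      also have "(S \<inter> A') \<union> (S \<inter> B') = S" using S' AB' by blast
      finally show ?thesis using S' by simp
    qed
    have "2 * (real ?\<delta> + 1) \<le> 2 * real (deg (parity_graph k \<sigma> A' B') S)"
    proof (cases "?s = l")
      case True
      then show ?thesis using d'[OF S \<sigma>(1)] \<sigma>(2) C by simp
    next
      case False
      then have sl: "Suc ?s \<le> l" using s by linarith
      have sA: "Suc ?s \<le> card A" using cA fin card_mono[OF fin(3), of "S \<inter> A'"] by simp
      have sB: "l - Suc ?s \<le> card B" using s cB card_mono[OF fin(4), of "S \<inter> B'"] by simp
      obtain R where R: "R \<in> nsets (A \<union> B) l" "card (R \<inter> A) = Suc ?s"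
        using obtain_nset_meeting[OF fin(1,2) V(3) sl sA sB] by blast
      have RV: "R \<in> nsets V l" using R(1) V(2) by simp
      have "(- 1 :: real) ^ (\<sigma> + ?s) = (- 1) ^ ((1 - \<sigma>) + Suc ?s)"
        using \<sigma>(1) by (auto simp: less_2_cases_iff)
      then have "2 * real (deg (parity_graph k \<sigma> A' B') S) = 2 * real (deg (parity_graph k (1 - \<sigma>) A B) R)"
        using d'[OF S \<sigma>(1)] d[OF RV, of "1 - \<sigma>"] R(2) by simp
      moreover have "1 - \<sigma> < 2" using \<sigma>(1) by linarith
      then have "real ?\<delta> + 1 \<le> real (deg (parity_graph k (1 - \<sigma>) A B) R)" by (rule low[OF RV])
      ultimately show ?thesis by simp
    qed
    then have "real (?\<delta> + 1) \<le> real (deg (parity_graph k \<sigma> A' B') S)" by simp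
    then show "?\<delta> + 1 \<le> deg (parity_graph k \<sigma> A' B') S" by (simp only: of_nat_le_iff)
  qed
  moreover have "ext_triple V k \<sigma> A' B'"
    using \<sigma>(1) AB' cA ev by (auto simp: ext_triple_def)
  ultimately show False using min_deg_le_delta_ext[OF V(1), of k \<sigma> A' B' l] by simp
qed

text \<open>A graph with l-degree above \<open>delta_ext\<close> is contained in no parity graph
  with l-degree at most \<open>delta_ext\<close>, whether or not that one is in \<open>ext\<close>.
  The condition that card A + i m be even is exactly the failure of \<open>ext_triple\<close> for
  parity i.\<close>

lemma avoids_parity_if_min_deg:
  assumes V: "finite V" "card V = k * m" and l: "l < k" "l \<le> card V" and i: "i < 2"
    and H: "\<And>j. j \<in> {1..m} \<Longrightarrow> H j \<subseteq> nsets V k"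
      "\<And>j. j \<in> {1..m} \<Longrightarrow> delta_ext V k l < min_deg V l (H j)"
  shows "avoids_parity m k i V H"
  unfolding avoids_parity_def
proof (intro allI impI)
  fix A B assume AB: "A \<union> B = V" "A \<inter> B = {}" "A \<noteq> {}"
  have m: "card V div k = m" using V l by simp
  have esc: "\<forall>j\<in>{1..m}. \<exists>E\<in>H j. E \<notin> parity_graph k i' A B"
    if "min_deg V l (parity_graph k i' A B) \<le> delta_ext V k l" for i'
  proof (intro ballI, rule ccontr)
    fix j assume j: "j \<in> {1..m}" "\<not> (\<exists>E\<in>H j. E \<notin> parity_graph k i' A B)"
    then have "H j \<subseteq> parity_graph k i' A B" by blast
    then have "min_deg V l (H j) \<le> min_deg V l (parity_graph k i' A B)"
      using V l parity_graph_subset[OF AB(1)] by (intro min_deg_mono) auto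
    then show False using that H(2)[OF j(1)] by linarith
  qed
  have other: "\<forall>j\<in>{1..m}. \<exists>E\<in>H j. E \<in> parity_graph k i A B"
    if flip: "min_deg V l (parity_graph k (1 - i) A B) \<le> delta_ext V k l"
  proof
    fix j assume j: "j \<in> {1..m}"
    then obtain E where E: "E \<in> H j" "E \<notin> parity_graph k (1 - i) A B" using esc[OF flip] by blast
    then have "E \<in> nsets V k" using H(1)[OF j] by blast
    then have "E \<in> parity_graph k i A B"
      using E(2) AB(1) i by (auto simp: parity_graph_def less_2_cases_iff)
    then show "\<exists>E\<in>H j. E \<in> parity_graph k i A B" using E(1) by blast
  qed
  show "(\<forall>j\<in>{1..m}. \<exists>E\<in>H j. E \<notin> parity_graph k i A B) \<or>
      even (card A + i * m) \<and> (\<forall>j\<in>{1..m}. \<exists>E\<in>H j. E \<in> parity_graph k i A B)"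
  proof (cases "ext_triple V k i A B")
    case True
    then show ?thesis using esc[of i] min_deg_le_delta_ext[OF V(1)] by blast
  next
    case False
    then have ev: "even (card A + i * m)" using AB i m by (auto simp: ext_triple_def less_2_cases_iff)
    show ?thesis
    proof (cases "ext_triple V k (1 - i) A B")
      case True
      then show ?thesis using other min_deg_le_delta_ext[OF V(1) True] ev by blast
    next
      case notext: False
      have "even (card A)" "even m"
        using False notext AB i m by (auto simp: ext_triple_def less_2_cases_iff)
      then obtain i' where i': "i' < 2" "min_deg V l (parity_graph k i' A B) \<le> delta_ext V k l"
        using min_parity_le_delta_ext[OF V(1) AB l] m by auto
      have "i' = i \<or> i' = 1 - i" using i i'(1) by auto
      then show ?thesis using esc[of i] other i'(2) ev by blast
    qed
  qed
qed

section \<open>Near-balance of the maximisers\<close>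

text \<open>If |D| > Y + 2, then D and D + 2 have the same sign and both exceed Y in absolute value.
  Their r-th powers then have a common sign and exceed X in absolute value, so one of the two lower
  bounds fails.\<close>

lemma opposite_signs_bound:
  fixes \<epsilon> D Y X :: real
  assumes \<epsilon>: "\<epsilon> = 1 \<or> \<epsilon> = - 1" and Y: "0 \<le> Y" "X < Y ^ r"
    and D: "- X \<le> \<epsilon> * D ^ r" "- X \<le> - \<epsilon> * (D + 2) ^ r"
  shows "\<bar>D\<bar> \<le> Y + 2"
proof (rule ccontr)
  assume *: "\<not> \<bar>D\<bar> \<le> Y + 2"
  have big: "X < u ^ r" if "Y \<le> u" for u
    using Y(2) power_mono[OF that Y(1), of r] by linarith
  show False
  proof (cases "0 \<le> D")
    case True
    then have "X < D ^ r" "X < (D + 2) ^ r" using * by (intro big; simp)+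
    then show False using \<epsilon> D by auto
  next
    case False
    then have u: "X < (- D) ^ r" "X < (- (D + 2)) ^ r" using * by (intro big; simp)+
    have "(- D) ^ r = (- 1) ^ r * D ^ r" "(- (D + 2)) ^ r = (- 1) ^ r * (D + 2) ^ r"
      by (simp_all only: power_minus[of D] power_minus[of "D + 2"])
    moreover have "(- 1 :: real) ^ r = 1 \<or> (- 1 :: real) ^ r = - 1" by (simp add: minus_one_power_iff)
    ultimately show False using \<epsilon> D u by auto
  qed
qed

text \<open>The quantity on the left is the difference of the sizes of B - S and A - S; the bound
  makes \<open>kraw_small_power\<close> applicable to it.\<close>

lemma discrepancy_le:
  assumes V: "finite V" "A \<union> B = V" "A \<inter> B = {}" and S: "S \<in> nsets V l"
  shows "\<bar>real (card B) - real (card A) - real l + 2 * real (card (S \<inter> A))\<bar> \<le> real (card V - l)"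
proof -
  have fin: "finite A" "finite B" using V by auto
  have S': "S \<subseteq> V" "finite S" "card S = l" using S by (auto simp: nsets_def)
  have "card (S \<inter> A) + card (S \<inter> B) = card ((S \<inter> A) \<union> (S \<inter> B))"
    using S' V by (intro card_Un_disjoint[symmetric]) auto
  also have "(S \<inter> A) \<union> (S \<inter> B) = S" using S' V by blast
  finally have "card (S \<inter> A) + card (S \<inter> B) = l" using S' by simp
  moreover have "card (S \<inter> A) \<le> card A" "card (S \<inter> B) \<le> card B" using fin by (auto intro: card_mono)
  moreover have "card A + card B = card V" using card_Un_disjoint[OF fin V(3)] V(2) by simp
  moreover have "l \<le> card V" using card_mono[OF V(1) S'(1)] S'(3) by simp
  ultimately show ?thesis by linarith
qed

lemma min_deg_empty:
  assumes "finite V" "l < k" "l \<le> card V"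
  shows "min_deg V l ({} :: 'a set set) = 0"
proof -
  obtain S where "S \<in> nsets V l" using nsets_eq_empty_iff[of V l] assms(1,3) by fastforce
  then have "min_deg V l ({} :: 'a set set) \<le> deg {} S" by (rule min_deg_le[OF assms(1)])
  then show ?thesis by (simp add: deg_def)
qed

text \<open>All k-sets meet A in the same number of vertices, so either all or none have parity i.
  If all had, a partition of V into n / k of them would give card A the parity of i n / k, which
  \<open>ext_triple\<close> excludes.\<close>

lemma parity_graph_degenerate:
  assumes V: "finite V" "k dvd card V" "0 < k" and ext: "ext_triple V k i A B" and e: "A = {} \<or> B = {}"
  shows "parity_graph k i A B = {}"
proof -
  obtain m where m: "card V = k * m" using V(2) by blast
  have AB: "A \<union> B = V" "A \<inter> B = {}" and i: "i = 0 \<or> i = 1" and ev: "even (i * m) \<longleftrightarrow> odd (card A)"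
    using ext m V(3) by (auto simp: ext_triple_def)
  show ?thesis
  proof (cases "A = {}")
    case True
    then have "i = 1" using i ev by auto
    then show ?thesis using True by (auto simp: parity_graph_def)
  next
    case False
    then have AV: "A = V" "B = {}" using e AB by auto
    have "k mod 2 \<noteq> i" using i ev m AV by (auto simp: mod2_eq_if)
    moreover have "E \<inter> V = E" if "E \<in> nsets V k" for E using that by (auto simp: nsets_def)
    ultimately show ?thesis using AV by (auto simp: parity_graph_def nsets_def)
  qed
qed

text \<open>Exchanging w \<in> B for v \<in> A in an l-set raises its number of vertices in A from s
  to s + 1; the signed sums enter the two degrees with opposite signs and arguments D and D + 2.
  Both degrees are at least \<open>delta_ext\<close>, hence at least half the binomial coefficient
  up to lower order. So D^(k - l) and - (D + 2)^(k - l), up to a common sign, are bounded below by a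
  lower-order term, which forces |D| to be small.\<close>

lemma attains_balanced:
  fixes \<gamma> :: real
  assumes l: "1 \<le> l" "l < k" and \<gamma>: "0 < \<gamma>"
  obtains n0 where "\<And>(V :: 'a set) i A B. finite V \<Longrightarrow> n0 \<le> card V \<Longrightarrow> k dvd card V \<Longrightarrow>
    attains V k l i A B \<Longrightarrow> \<bar>real (card A) - real (card B)\<bar> \<le> \<gamma> * real (card V)"
proof -
  define q where "q = k - l - 1"
  have q: "k - l = Suc q" using l by (simp add: q_def)
  obtain E1 where E1: "0 \<le> E1" "\<And>V :: 'a set. finite V \<Longrightarrow> 2 * l + 3 \<le> card V \<Longrightarrow>
    real ((card V - l) choose (k - l)) \<le> 2 * real (delta_ext V k l) + E1 * real (card V - l) ^ q"
    using delta_ext_lower[OF l(2)] unfolding q_def by blast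
  obtain E2 where E2: "0 \<le> E2" "\<And>D N. 1 \<le> N \<Longrightarrow> \<bar>D\<bar> \<le> N \<Longrightarrow>
    \<bar>fact (Suc q) * kraw (Suc q) D N - D ^ Suc q\<bar> \<le> E2 * N ^ q"
    using kraw_small_power by blast
  obtain c n1 where c: "0 < c" "\<And>V :: 'a set. finite V \<Longrightarrow> n1 \<le> card V \<Longrightarrow>
    c * real (card V) ^ (k - l) \<le> real (delta_ext V k l)"
    using delta_ext_linear[OF l(2)] by blast
  define F :: real where "F = fact (Suc q)"
  have F: "0 < F" by (simp add: F_def del: fact_Suc)
  define g where "g = (\<gamma> / 2) ^ Suc q"
  have g: "0 < g" using \<gamma> by (simp add: g_def)
  \<comment> \<open>Inside the inner \<open>max\<close>, the first bound makes the error (F E1 + E2)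
    N^q smaller than (\<gamma> N / 2)^(q + 1), and the second absorbs the additive 2 + l into
    \<gamma> N / 2.\<close>
  define n0 where "n0 = max (max (2 * l + 3) n1) (l + nat \<lceil>max ((F * E1 + E2) / g + 1) (2 * (2 + real l) / \<gamma>)\<rceil>)"
  show ?thesis
  proof (rule that[of n0])
    fix V :: "'a set" and i A B
    assume V: "finite V" "n0 \<le> card V" "k dvd card V" and att: "attains V k l i A B"
    let ?N = "real (card V - l)" and ?\<delta> = "delta_ext V k l"
    have n: "2 * l + 3 \<le> card V" "n1 \<le> card V" and "(F * E1 + E2) / g + 1 \<le> ?N" "2 * (2 + real l) / \<gamma> \<le> ?N"
      using V(2) unfolding n0_def by linarith+
    then have N1: "F * E1 + E2 < ?N * g" and N2: "2 + real l \<le> \<gamma> / 2 * ?N" and N3: "1 \<le> ?N"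
      using g \<gamma> by (auto simp: field_simps)
    have ext: "ext_triple V k i A B" and md: "min_deg V l (parity_graph k i A B) = ?\<delta>"
      using att by (auto simp: attains_def)
    have AB: "A \<union> B = V" "A \<inter> B = {}" and i: "i < 2" using ext by (auto simp: ext_triple_def)
    have fin: "finite A" "finite B" using AB V(1) by auto
    \<comment> \<open>A maximiser has edges, so neither side of its partition is empty and there are
      vertices to exchange.\<close>
    have "0 < c * real (card V) ^ (k - l)" using c(1) n by simp
    then have "0 < ?\<delta>" using c(2)[OF V(1) n(2)] by simp
    then have "parity_graph k i A B \<noteq> {}" using md min_deg_empty[OF V(1) l(2)] n by auto
    then have "A \<noteq> {}" "B \<noteq> {}" using parity_graph_degenerate[OF V(1,3) _ ext] l by auto
    then obtain v w where vw: "v \<in> A" "w \<in> B" by blast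
    have le: "l - 1 \<le> card (V - {v, w})"
    proof -
      have "card V - card {v, w} \<le> card (V - {v, w})" by (rule diff_card_le_card_Diff) simp
      moreover have "card {v, w} \<le> 2" by (simp add: card_insert_if)
      ultimately show ?thesis using n by linarith
    qed
    obtain R where R: "R \<subseteq> V - {v, w}" "card R = l - 1" using obtain_subset_with_card_n[OF le] by blast
    have finR: "finite R" using finite_subset[OF R(1)] V(1) by simp
    have S: "insert v R \<in> nsets V l" "insert w R \<in> nsets V l"
      using R finR vw AB l(1) by (auto simp: nsets_def card_insert_if)
    let ?s = "card (insert w R \<inter> A)"
    have s: "card (insert v R \<inter> A) = Suc ?s"
    proof -
      have "insert w R \<inter> A = R \<inter> A" "insert v R \<inter> A = insert v (R \<inter> A)" "v \<notin> R \<inter> A"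
        using vw AB(2) R(1) by blast+
      then show ?thesis using finR by simp
    qed
    define D where "D = real (card B) - real (card A) - real l + 2 * real ?s"
    have D2: "real (card B) - real (card A) - real l + 2 * real (Suc ?s) = D + 2" by (simp add: D_def)
    define \<epsilon> :: real where "\<epsilon> = (- 1) ^ (i + ?s)"
    have \<epsilon>: "\<epsilon> = 1 \<or> \<epsilon> = - 1" by (simp add: \<epsilon>_def minus_one_power_iff)
    have deg_ge: "real ((card V - l) choose (k - l)) \<le> 2 * real (deg (parity_graph k i A B) S) + E1 * ?N ^ q"
      if "S \<in> nsets V l" for S
      using min_deg_le[OF V(1) that, of "parity_graph k i A B"] E1(2)[OF V(1) n(1)] unfolding md by linarith
    have "2 * real (deg (parity_graph k i A B) (insert w R)) =
        real ((card V - l) choose (k - l)) + \<epsilon> * kraw (Suc q) D ?N"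
      using deg_parity_graph[OF V(1) AB i less_imp_le[OF l(2)] S(2)]
      unfolding D_def[symmetric] \<epsilon>_def[symmetric] q by simp
    then have k1: "- (E1 * ?N ^ q) \<le> \<epsilon> * kraw (Suc q) D ?N" using deg_ge[OF S(2)] by linarith
    have "(- 1) ^ (i + Suc ?s) = - \<epsilon>" by (simp add: \<epsilon>_def)
    then have "2 * real (deg (parity_graph k i A B) (insert v R)) =
        real ((card V - l) choose (k - l)) + - \<epsilon> * kraw (Suc q) (D + 2) ?N"
      using deg_parity_graph[OF V(1) AB i less_imp_le[OF l(2)] S(1)] unfolding s D2 q by simp
    then have k2: "- (E1 * ?N ^ q) \<le> - \<epsilon> * kraw (Suc q) (D + 2) ?N" using deg_ge[OF S(1)] by linarith
    have d1: "\<bar>D\<bar> \<le> ?N" and d2: "\<bar>D + 2\<bar> \<le> ?N"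
      using discrepancy_le[OF V(1) AB S(2)] discrepancy_le[OF V(1) AB S(1)] unfolding s D2 D_def by simp_all
    define X where "X = (F * E1 + E2) * ?N ^ q"
    have lift: "- X \<le> \<sigma> * x ^ Suc q"
      if "- (E1 * ?N ^ q) \<le> \<sigma> * kraw (Suc q) x ?N" "\<bar>x\<bar> \<le> ?N" "\<sigma> = 1 \<or> \<sigma> = - 1" for \<sigma> x
    proof -
      have "F * (- (E1 * ?N ^ q)) \<le> F * (\<sigma> * kraw (Suc q) x ?N)" using that(1) F by (intro mult_left_mono) auto
      then have "- (F * E1 * ?N ^ q) \<le> \<sigma> * (F * kraw (Suc q) x ?N)" by (simp add: mult_ac del: kraw.simps)
      moreover have "\<bar>F * kraw (Suc q) x ?N - x ^ Suc q\<bar> \<le> E2 * ?N ^ q"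
        unfolding F_def using N3 that(2) by (rule E2(2))
      ultimately have "- (F * E1 * ?N ^ q) - E2 * ?N ^ q \<le> \<sigma> * x ^ Suc q" using that(3) by auto
      then show ?thesis by (simp add: X_def algebra_simps)
    qed
    have "\<bar>D\<bar> \<le> \<gamma> / 2 * ?N + 2"
    proof (rule opposite_signs_bound[OF \<epsilon> _ _ lift[OF k1 d1 \<epsilon>] lift[OF k2 d2]])
      show "0 \<le> \<gamma> / 2 * ?N" using \<gamma> by simp
      have "X < (?N * g) * ?N ^ q" unfolding X_def using N1 N3 by (intro mult_strict_right_mono) auto
      also have "\<dots> = g * ?N ^ Suc q" by simp
      also have "\<dots> = (\<gamma> / 2 * ?N) ^ Suc q" unfolding g_def by (rule power_mult_distrib[symmetric])
      finally show "X < (\<gamma> / 2 * ?N) ^ Suc q" .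
      show "- \<epsilon> = 1 \<or> - \<epsilon> = - 1" using \<epsilon> by auto
    qed
    moreover have "?s \<le> l" using S(2) card_mono[of "insert w R" "insert w R \<inter> A"] by (auto simp: nsets_def)
    moreover have "\<gamma> * ?N \<le> \<gamma> * real (card V)" using \<gamma> by (intro mult_left_mono) auto
    ultimately show "\<bar>real (card A) - real (card B)\<bar> \<le> \<gamma> * real (card V)"
      using N2 unfolding D_def by (simp only: times_divide_eq_left)
  qed
qed

section \<open>Vertex degrees\<close>

text \<open>Pairs (S, T) with U \<subseteq> S and S \<union> T \<in> H are determined by the edge S
  \<union> T and its subset S, of which there are at most 2^k. Admitting an empty U treats the
  number of edges and the vertex degrees together.\<close>

lemma superset_degree_lower:
  assumes V: "finite V" and H: "H \<subseteq> nsets V k" and U: "U \<subseteq> V" "card U \<le> l" and x: "x \<le> min_deg V l H"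
  shows "((card V - card U) choose (l - card U)) * x \<le> 2 ^ k * card {E \<in> H. U \<subseteq> E}"
proof -
  have finU: "finite U" using U V finite_subset by blast
  have finH: "finite H" using H finite_imp_finite_nsets[OF V] finite_subset by blast
  let ?S = "(\<lambda>R. R \<union> U) ` nsets (V - U) (l - card U)"
  have finS: "finite ?S" using V by (intro finite_imageI finite_imp_finite_nsets) simp
  have cS: "card ?S = (card V - card U) choose (l - card U)"
  proof -
    have "inj_on (\<lambda>R. R \<union> U) (nsets (V - U) (l - card U))"
      by (rule inj_onI) (auto simp: nsets_def)
    then show ?thesis using U finU by (simp add: card_image card_Diff_subset)
  qed
  have SV: "S \<in> nsets V l" "U \<subseteq> S" if S: "S \<in> ?S" for S
  proof -
    obtain R where R: "S = R \<union> U" "R \<subseteq> V - U" "finite R" "card R = l - card U"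
      using S by (auto simp: nsets_def)
    have "card S = card R + card U" unfolding R(1) using R finU by (intro card_Un_disjoint) auto
    then show "S \<in> nsets V l" "U \<subseteq> S" using R U finU by (auto simp: nsets_def)
  qed
  define TT where "TT S = {T. S \<inter> T = {} \<and> S \<union> T \<in> H}" for S
  have finT: "finite (TT S)" for S
    by (rule finite_subset[of _ "Pow V"]) (use H V in \<open>auto simp: TT_def nsets_def\<close>)
  have "card ?S * x = (\<Sum>S\<in>?S. x)" by simp
  also have "\<dots> \<le> (\<Sum>S\<in>?S. card (TT S))"
  proof (rule sum_mono)
    fix S assume "S \<in> ?S"
    then have "min_deg V l H \<le> deg H S" by (intro min_deg_le[OF V] SV)
    then show "x \<le> card (TT S)" using x by (simp add: deg_def TT_def)
  qed
  also have "\<dots> = card (Sigma ?S TT)" using finS finT by simp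
  also have "\<dots> \<le> card (Sigma {E \<in> H. U \<subseteq> E} Pow)"
  proof (rule card_inj_on_le[where f = "\<lambda>(S, T). (S \<union> T, S)"])
    show "inj_on (\<lambda>(S, T). (S \<union> T, S)) (Sigma ?S TT)"
    proof (rule inj_onI)
      fix p p' assume p: "p \<in> Sigma ?S TT" "p' \<in> Sigma ?S TT"
        "(case p of (S, T) \<Rightarrow> (S \<union> T, S)) = (case p' of (S, T) \<Rightarrow> (S \<union> T, S))"
      obtain S T S' T' where [simp]: "p = (S, T)" "p' = (S', T')" by (cases p; cases p')
      have "S = S'" "S \<union> T = S' \<union> T'" "S \<inter> T = {}" "S' \<inter> T' = {}"
        using p by (auto simp: TT_def)
      then have "T = T'" by blast
      then show "p = p'" using \<open>S = S'\<close> by simp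
    qed
    show "(\<lambda>(S, T). (S \<union> T, S)) ` Sigma ?S TT \<subseteq> Sigma {E \<in> H. U \<subseteq> E} Pow"
      using SV(2) by (auto simp: TT_def)
    show "finite (Sigma {E \<in> H. U \<subseteq> E} Pow)"
      using finH H by (intro finite_SigmaI) (auto simp: nsets_def)
  qed
  also have "\<dots> = (\<Sum>E\<in>{E \<in> H. U \<subseteq> E}. card (Pow E))"
    using finH H by (intro card_SigmaI) (auto simp: nsets_def)
  also have "\<dots> = (\<Sum>E\<in>{E \<in> H. U \<subseteq> E}. 2 ^ k)"
    using H by (intro sum.cong) (auto simp: nsets_def card_Pow)
  also have "\<dots> = 2 ^ k * card {E \<in> H. U \<subseteq> E}" by simp
  finally show ?thesis unfolding cS .
qed

lemma power_le_binomial: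
  assumes "2 * (u + r) \<le> n"
  shows "real n ^ r \<le> (2 * real r) ^ r * real ((n - u) choose r)"
proof (cases "r = 0")
  case False
  have "real n \<le> 2 * real (n - u)" using assms by simp
  then have "real n ^ r \<le> (2 * real (n - u)) ^ r" by (intro power_mono) auto
  also have "\<dots> = (2 * real r) ^ r * (real (n - u) / real r) ^ r"
    using False unfolding power_mult_distrib[symmetric] by simp
  also have "\<dots> \<le> (2 * real r) ^ r * real ((n - u) choose r)"
    using assms by (intro mult_left_mono binomial_ge_n_over_k_pow_k) auto
  finally show ?thesis .
qed simp

lemma vertex_degree_linear:
  assumes l: "1 \<le> l" "l < k"
  obtains c n0 where "0 < c" "\<And>(V :: 'a set) H U. finite V \<Longrightarrow> n0 \<le> card V \<Longrightarrow> H \<subseteq> nsets V k \<Longrightarrow>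
    delta_ext V k l < min_deg V l H \<Longrightarrow> U \<subseteq> V \<Longrightarrow> card U \<le> 1 \<Longrightarrow>
    c * real (card V) ^ (k - card U) \<le> real (card {E \<in> H. U \<subseteq> E})"
proof -
  obtain c n1 where c: "0 < c" "\<And>V :: 'a set. finite V \<Longrightarrow> n1 \<le> card V \<Longrightarrow>
    c * real (card V) ^ (k - l) \<le> real (delta_ext V k l)"
    using delta_ext_linear[OF l(2)] by blast
  define L where "L = (2 * real l) ^ l * 2 ^ k"
  have L: "0 < L" using l by (simp add: L_def)
  show ?thesis
  proof (rule that[of "c / L" "max n1 (2 * (l + 1))"])
    show "0 < c / L" using c L by simp
    fix V :: "'a set" and H U
    assume V: "finite V" "max n1 (2 * (l + 1)) \<le> card V" and H: "H \<subseteq> nsets V k"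
      and d: "delta_ext V k l < min_deg V l H" and U: "U \<subseteq> V" "card U \<le> 1"
    let ?n = "real (card V)" and ?r = "l - card U" and ?C = "real ((card V - card U) choose (l - card U))"
    have "?n ^ ?r \<le> (2 * real ?r) ^ ?r * ?C" using V U l by (intro power_le_binomial) auto
    also have "\<dots> \<le> (2 * real l) ^ l * ?C"
    proof (rule mult_right_mono)
      have "(2 * real ?r) ^ ?r \<le> (2 * real l) ^ ?r" by (intro power_mono) auto
      also have "\<dots> \<le> (2 * real l) ^ l" using l by (intro power_increasing) auto
      finally show "(2 * real ?r) ^ ?r \<le> (2 * real l) ^ l" .
    qed simp
    finally have 1: "?n ^ ?r \<le> (2 * real l) ^ l * ?C" .
    have "(c * ?n ^ (k - l)) * ?n ^ ?r \<le> real (min_deg V l H) * ((2 * real l) ^ l * ?C)"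
      using c(1) c(2)[OF V(1)] V(2) d 1 by (intro mult_mono) auto
    also have "\<dots> = (2 * real l) ^ l * real (((card V - card U) choose ?r) * min_deg V l H)" by simp
    also have "\<dots> \<le> (2 * real l) ^ l * real (2 ^ k * card {E \<in> H. U \<subseteq> E})"
      using superset_degree_lower[OF V(1) H U(1) _ order_refl, of l] U l
      by (intro mult_left_mono) (simp_all only: of_nat_le_iff, auto)
    also have "\<dots> = L * real (card {E \<in> H. U \<subseteq> E})" by (simp add: L_def)
    also have "(c * ?n ^ (k - l)) * ?n ^ ?r = c * ?n ^ (k - card U)"
    proof -
      have "k - card U = (k - l) + ?r" using l U by simp
      then show ?thesis by (simp add: power_add)
    qed
    finally show "c / L * ?n ^ (k - card U) \<le> real (card {E \<in> H. U \<subseteq> E})"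
      using L by (simp add: field_simps)
  qed
qed

lemma vertex_insert_inject:
  "insert (Inl j) (Inr ` E) = insert (Inl j') (Inr ` E') \<longleftrightarrow> j = j' \<and> E = E'"
proof
  assume eq: "insert (Inl j) (Inr ` E) = insert (Inl j') (Inr ` E')"
  have "Inl j \<in> insert (Inl j') (Inr ` E')" unfolding eq[symmetric] by simp
  then have "j = j'" by auto
  moreover have "Inr -` (insert (Inl j) (Inr ` E)) = Inr -` (insert (Inl j') (Inr ` E'))"
    using eq by simp
  then have "E = E'" by auto
  ultimately show "j = j' \<and> E = E'" ..
qed simp

text \<open>The empty U gives the degree of a colour, which is the number of edges of one graph; a
  singleton U gives the degree of a vertex, to which each of the m colours contributes at least c
  m^(k - 1).\<close>

lemma T_graph_degree_lower:
  fixes V :: "'a set"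
  assumes V: "finite V" "card V = k * m" and k: "1 \<le> k" and H: "\<And>j. j \<in> {1..m} \<Longrightarrow> H j \<subseteq> nsets V k"
    and c: "0 \<le> c" and deg: "\<And>j U. j \<in> {1..m} \<Longrightarrow> U \<subseteq> V \<Longrightarrow> card U \<le> 1 \<Longrightarrow>
      c * real (card V) ^ (k - card U) \<le> real (card {E \<in> H j. U \<subseteq> E})"
    and w: "w \<in> T_verts m V"
  shows "c * real m ^ k \<le> real (card {E \<in> T_graph m H. w \<in> E})"
proof -
  have "1 * m \<le> k * m" using k by (rule mult_le_mono1)
  then have "m \<le> card V" using V(2) by simp
  then have mV: "real m \<le> real (card V)" by (simp only: of_nat_le_iff)
  have finH: "finite (H j)" if "j \<in> {1..m}" for j
    using H[OF that] finite_imp_finite_nsets[OF V(1)] finite_subset by blast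
  have finT: "finite (T_graph m H)"
    unfolding T_graph_def using finH by (intro finite_UN_I) auto
  have mem: "insert (Inl j) (Inr ` E) \<in> T_graph m H" if "j \<in> {1..m}" "E \<in> H j" for j E
    unfolding T_graph_def by (intro UN_I[OF that(1)] CollectI exI[of _ E]) (simp add: that)
  consider j where "j \<in> {1..m}" "w = Inl j" | v where "v \<in> V" "w = Inr v"
    using w by (auto simp: T_verts_def)
  then show ?thesis
  proof cases
    case 1
    have "c * real m ^ k \<le> c * real (card V) ^ (k - card ({} :: 'a set))"
      using mult_left_mono[OF power_mono[OF mV, of k] c] by simp
    also have "\<dots> \<le> real (card {E \<in> H j. {} \<subseteq> E})" by (rule deg[OF 1(1)]) auto
    also have "\<dots> \<le> real (card {E \<in> T_graph m H. w \<in> E})"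
      unfolding of_nat_le_iff
    proof (rule card_inj_on_le[where f = "\<lambda>E. insert (Inl j) (Inr ` E)"])
      show "inj_on (\<lambda>E. insert (Inl j) (Inr ` E)) {E \<in> H j. {} \<subseteq> E}"
        by (intro inj_onI) (simp only: vertex_insert_inject)
    qed (use finT mem 1 in auto)
    finally show ?thesis .
  next
    case 2
    have "c * real m ^ k = real m * (c * real m ^ (k - 1))"
      using k by (cases k) auto
    also have "\<dots> \<le> real m * (c * real (card V) ^ (k - 1))"
      using mult_left_mono[OF mult_left_mono[OF power_mono[OF mV, of "k - 1"] c], of "real m"] by simp
    also have "\<dots> = (\<Sum>j\<in>{1..m}. c * real (card V) ^ (k - card {v}))" by simp
    also have "\<dots> \<le> (\<Sum>j\<in>{1..m}. real (card {E \<in> H j. {v} \<subseteq> E}))"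
      using 2 by (intro sum_mono deg) auto
    also have "\<dots> = real (card (Sigma {1..m} (\<lambda>j. {E \<in> H j. {v} \<subseteq> E})))"
      using finH by (simp add: card_SigmaI)
    also have "\<dots> \<le> real (card {E \<in> T_graph m H. w \<in> E})"
      unfolding of_nat_le_iff
    proof (rule card_inj_on_le[where f = "\<lambda>(j, E). insert (Inl j) (Inr ` E)"])
      show "inj_on (\<lambda>(j, E). insert (Inl j) (Inr ` E)) (Sigma {1..m} (\<lambda>j. {E \<in> H j. {v} \<subseteq> E}))"
      proof (rule inj_onI)
        fix p p' :: "nat \<times> 'a set" assume p: "(case p of (j, E) \<Rightarrow> insert (Inl j) (Inr ` E)) =
          (case p' of (j, E) \<Rightarrow> insert (Inl j) (Inr ` E :: (nat + 'a) set))"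
        obtain j E j' E' where [simp]: "p = (j, E)" "p' = (j', E')" by (cases p; cases p')
        show "p = p'" using p by (simp add: vertex_insert_inject)
      qed
      show "(\<lambda>(j, E). insert (Inl j) (Inr ` E)) ` Sigma {1..m} (\<lambda>j. {E \<in> H j. {v} \<subseteq> E}) \<subseteq>
          {E \<in> T_graph m H. w \<in> E}"
        using mem 2 by auto
    qed (use finT in auto)
    finally show ?thesis .
  qed
qed

lemma card_meeting_le:
  assumes "finite W" "finite Z"
  shows "card {E \<in> nsets W (q + 1). E \<inter> Z \<noteq> {}} \<le> card Z * card W ^ q"
proof -
  have "{E \<in> nsets W (q + 1). E \<inter> Z \<noteq> {}} = (\<Union>z\<in>Z. {E \<in> nsets W (q + 1). {z} \<subseteq> E})" by auto
  then have "card {E \<in> nsets W (q + 1). E \<inter> Z \<noteq> {}} \<le> (\<Sum>z\<in>Z. card {E \<in> nsets W (q + 1). {z} \<subseteq> E})"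
    by (simp only: card_UN_le[OF assms(2)])
  also have "\<dots> \<le> (\<Sum>z\<in>Z. card W ^ q)"
  proof (rule sum_mono)
    fix z :: 'a
    show "card {E \<in> nsets W (q + 1). {z} \<subseteq> E} \<le> card W ^ q"
      using card_nsets_superset_le[OF assms(1), of "{z}" q] by (simp add: add.commute)
  qed
  finally show ?thesis by simp
qed

text \<open>For i = 0 the k-subsets of B already suffice; for i = 1 the sets made of one vertex of A
  and k - 1 vertices of B do.\<close>

lemma card_parity_graph_ge:
  assumes fin: "finite A" "finite B" and AB: "A \<inter> B = {}" and i: "i < 2" and k: "2 \<le> k"
    and b: "k \<le> b" "b \<le> card A" "b \<le> card B"
  shows "(real b / real k) ^ k \<le> real (card (parity_graph k i A B))"
proof -
  have finP: "finite (parity_graph k i A B)"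
    using fin by (simp add: parity_graph_def finite_imp_finite_nsets)
  show ?thesis
  proof (cases "i = 0")
    case True
    have "(real b / real k) ^ k \<le> (real (card B) / real k) ^ k"
      using b by (intro power_mono divide_right_mono) auto
    also have "\<dots> \<le> real (card B choose k)" using b by (intro binomial_ge_n_over_k_pow_k) auto
    also have "\<dots> = real (card (nsets B k))" by simp
    also have "\<dots> \<le> real (card (parity_graph k i A B))"
      unfolding of_nat_le_iff
    proof (rule card_mono[OF finP])
      have "E \<inter> A = {}" if "E \<subseteq> B" for E using that AB by blast
      then show "nsets B k \<subseteq> parity_graph k i A B" using True by (auto simp: parity_graph_def nsets_def)
    qed
    finally show ?thesis .
  next
    case False
    then have i1: "i = 1" using i by simp
    have "(real b / real k) ^ k = (real b / real k) * (real b / real k) ^ (k - 1)"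
      using k by (cases k) auto
    also have "\<dots> \<le> real (card A) * (real (card B) / real (k - 1)) ^ (k - 1)"
    proof (rule mult_mono)
      have "real b / real k \<le> real b / 1" using k by (intro divide_left_mono) auto
      then show "real b / real k \<le> real (card A)" using b by simp
      show "(real b / real k) ^ (k - 1) \<le> (real (card B) / real (k - 1)) ^ (k - 1)"
        using b k by (intro power_mono frac_le) auto
    qed auto
    also have "\<dots> \<le> real (card A) * real (card B choose (k - 1))"
      using b by (intro mult_left_mono binomial_ge_n_over_k_pow_k) auto
    also have "\<dots> = real (card (A \<times> nsets B (k - 1)))" by (simp add: card_cartesian_product)
    also have "\<dots> \<le> real (card (parity_graph k i A B))"
      unfolding of_nat_le_iff
    proof (rule card_inj_on_le[OF _ _ finP, where f = "\<lambda>(v, E). insert v E"])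
      have sub: "v \<notin> E" "insert v E \<inter> A = {v}" if "v \<in> A" "E \<subseteq> B" for v E using that AB by auto
      show "inj_on (\<lambda>(v, E). insert v E) (A \<times> nsets B (k - 1))"
      proof (rule inj_onI)
        fix p p' assume p: "p \<in> A \<times> nsets B (k - 1)" "p' \<in> A \<times> nsets B (k - 1)"
          "(case p of (v, E) \<Rightarrow> insert v E) = (case p' of (v, E) \<Rightarrow> insert v E)"
        obtain v E v' E' where [simp]: "p = (v, E)" "p' = (v', E')" by (cases p; cases p')
        have m: "v \<in> A" "E \<subseteq> B" "v' \<in> A" "E' \<subseteq> B" using p by (auto simp: nsets_def)
        have eq: "insert v E = insert v' E'" using p(3) by simp
        have "{v} = {v'}" using sub(2)[OF m(1,2)] sub(2)[OF m(3,4)] eq by simp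
        then have "v = v'" by simp
        moreover have "E = E'" using eq sub(1)[OF m(1,2)] sub(1)[OF m(3,4)] \<open>v = v'\<close> by (simp add: insert_ident)
        ultimately show "p = p'" by simp
      qed
      show "(\<lambda>(v, E). insert v E) ` (A \<times> nsets B (k - 1)) \<subseteq> parity_graph k i A B"
      proof clarify
        fix v E assume vE: "v \<in> A" "E \<in> nsets B (k - 1)"
        then have E: "E \<subseteq> B" "finite E" "card E = k - 1" by (auto simp: nsets_def)
        have "card (insert v E) = k" using sub(1)[OF vE(1) E(1)] E k by simp
        moreover have "card (insert v E \<inter> A) mod 2 = 1" unfolding sub(2)[OF vE(1) E(1)] by simp
        ultimately show "insert v E \<in> parity_graph k i A B"
          using E vE(1) i1 unfolding parity_graph_def nsets_def by blast
      qed
    qed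
    finally show ?thesis .
  qed
qed

section \<open>Closeness up to a permutation of the vertices\<close>

text \<open>The permutation may interchange colours and vertices. If it sends a colour to a vertex,
  the model edges at this colour whose vertices stay vertices have images without a colour, hence
  outside T; this bounds the number N of such colours. Up to these, the permutation relabels colours
  and vertices separately, and A can be taken as the image of A0.\<close>

lemma copy_reduction:
  fixes V A0 B0 :: "'a set" and f :: "nat + 'a \<Rightarrow> nat + 'a" and m k i :: nat
  defines "C \<equiv> (\<lambda>E. f ` E) ` tedges {1..m} (parity_graph k i A0 B0)"
  assumes V: "finite V" and k: "2 \<le> k" and i: "i < 2"
    and AB0: "A0 \<union> B0 = V" "A0 \<inter> B0 = {}" and T: "T \<subseteq> tedges {1..m} (nsets V k)"
    and f: "bij_betw f (T_verts m V) (T_verts m V)"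
    and b: "k \<le> b" "b + m \<le> card A0" "b + m \<le> card B0"
  obtains A B N where "A \<union> B = V" "A \<inter> B = {}"
    "\<bar>real (card A) - real (card B)\<bar> \<le> \<bar>real (card A0) - real (card B0)\<bar> + 2 * real N"
    "real N * (real b / real k) ^ k \<le> real (card (sym_diff T C))"
    "card (tedges {1..m} (parity_graph k i A B) - T) \<le>
      card (sym_diff T C) + 2 * N * card (T_verts m V) ^ k"
proof -
  let ?W = "T_verts m V" and ?P0 = "parity_graph k i A0 B0"
  define X :: "(nat + 'a) set" where "X = Inl ` {1..m}"
  define Y :: "(nat + 'a) set" where "Y = Inr ` V"
  have W: "?W = X \<union> Y" "X \<inter> Y = {}" "finite ?W" "finite X" "finite Y" "card X = m"
    using V by (auto simp: T_verts_def X_def Y_def Plus_def card_image)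
  have inj: "inj_on f ?W" and img: "f ` ?W = ?W" using f by (auto simp: bij_betw_def)
  have fin0: "finite A0" "finite B0" using V AB0 by auto
  have InrW: "Inr v \<in> ?W" if "v \<in> V" for v using that by (auto simp: T_verts_def)
  have Inr_inj: "u = v" if "u \<in> V" "v \<in> V" "f (Inr u) = f (Inr v)" for u v
    using inj_onD[OF inj that(3)] InrW that by simp
  have finT: "finite T"
    using T finite_tedges[of "{1..m}" "nsets V k"] finite_imp_finite_nsets[OF V] finite_subset by blast
  have P0: "?P0 \<subseteq> nsets V k" using AB0 by (auto simp: parity_graph_def)
  have finC: "finite C"
    unfolding C_def using finite_subset[OF P0 finite_imp_finite_nsets[OF V]]
    by (intro finite_imageI finite_tedges) auto
  define J where "J = {j \<in> {1..m}. f (Inl j) \<in> Y}"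
  \<comment> \<open>There are only m colours, so at most m vertices can be sent to colours.\<close>
  have keep: "b \<le> card {a \<in> D. f (Inr a) \<in> Y}" if D: "D \<subseteq> V" "b + m \<le> card D" for D
  proof -
    have fD: "finite D" using D(1) V finite_subset by blast
    have "(f \<circ> Inr) ` {a \<in> D. f (Inr a) \<in> X} \<subseteq> X" by auto
    moreover have "inj_on (f \<circ> Inr) {a \<in> D. f (Inr a) \<in> X}"
      using D(1) by (intro inj_onI Inr_inj) auto
    ultimately have "card {a \<in> D. f (Inr a) \<in> X} \<le> m"
      using card_inj_on_le[OF _ _ W(4)] W(6) by metis
    moreover have "card D \<le> card {a \<in> D. f (Inr a) \<in> Y} + card {a \<in> D. f (Inr a) \<in> X}"
    proof -
      have "f (Inr a) \<in> X \<union> Y" if "a \<in> D" for a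
        using that D(1) InrW img W(1) by (metis imageI subsetD)
      then have "D \<subseteq> {a \<in> D. f (Inr a) \<in> Y} \<union> {a \<in> D. f (Inr a) \<in> X}" by auto
      then have "card D \<le> card ({a \<in> D. f (Inr a) \<in> Y} \<union> {a \<in> D. f (Inr a) \<in> X})"
        using fD by (intro card_mono) auto
      then show ?thesis using card_Un_le order_trans by blast
    qed
    ultimately show ?thesis using D(2) by linarith
  qed
  define A1 where "A1 = {a \<in> A0. f (Inr a) \<in> Y}"
  define B1 where "B1 = {a \<in> B0. f (Inr a) \<in> Y}"
  let ?Q = "parity_graph k i A1 B1"
  have Q: "E \<in> ?P0" "E \<subseteq> V" "f ` Inr ` E \<subseteq> Y" if "E \<in> ?Q" for E
  proof -
    have E: "E \<subseteq> A1 \<union> B1" using that by (auto simp: parity_graph_def nsets_def)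
    then have "E \<inter> A0 = E \<inter> A1" using AB0(2) by (auto simp: A1_def B1_def)
    then show "E \<in> ?P0" using that by (auto simp: parity_graph_def nsets_def A1_def B1_def)
    show "E \<subseteq> V" "f ` Inr ` E \<subseteq> Y" using E AB0 by (auto simp: A1_def B1_def)
  qed
  have cQ: "(real b / real k) ^ k \<le> real (card ?Q)"
    using fin0 AB0 b keep[of A0] keep[of B0] k i
    by (intro card_parity_graph_ge) (auto simp: A1_def B1_def)
  have CT: "card (C - T) \<le> card (sym_diff T C)"
    using finC finT by (intro card_mono) auto
  \<comment> \<open>The image of an edge with colour in \<open>J\<close> and body in
    \<open>?Q\<close> lies in V, while every edge of T contains a colour.\<close>
  have "card (J \<times> ?Q) \<le> card (C - T)"
  proof (rule card_inj_on_le[where f = "\<lambda>(j, E). f ` insert (Inl j) (Inr ` E)"])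
    show "finite (C - T)" using finC by simp
    have subW: "insert (Inl j) (Inr ` E) \<subseteq> ?W" if "j \<in> J" "E \<in> ?Q" for j E
      using that Q(2)[OF that(2)] by (auto simp: J_def T_verts_def)
    show "inj_on (\<lambda>(j, E). f ` insert (Inl j) (Inr ` E)) (J \<times> ?Q)"
    proof (rule inj_onI)
      fix p p' assume p: "p \<in> J \<times> ?Q" "p' \<in> J \<times> ?Q"
        "(case p of (j, E) \<Rightarrow> f ` insert (Inl j) (Inr ` E)) = (case p' of (j, E) \<Rightarrow> f ` insert (Inl j) (Inr ` E))"
      obtain j E j' E' where [simp]: "p = (j, E)" "p' = (j', E')" by (cases p; cases p')
      have "f ` insert (Inl j) (Inr ` E) = f ` insert (Inl j') (Inr ` E')" using p(3) by simp
      moreover have pj: "j \<in> J" "E \<in> ?Q" "j' \<in> J" "E' \<in> ?Q" using p(1,2) by auto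
      ultimately have "insert (Inl j) (Inr ` E) = insert (Inl j') (Inr ` E')"
        using inj_on_image_eq_iff[OF inj subW[OF pj(1,2)] subW[OF pj(3,4)]] by blast
      then show "p = p'" by (simp add: vertex_insert_inject)
    qed
    show "(\<lambda>(j, E). f ` insert (Inl j) (Inr ` E)) ` (J \<times> ?Q) \<subseteq> C - T"
    proof clarify
      fix j E assume j: "j \<in> J" and E: "E \<in> ?Q"
      have "f ` insert (Inl j) (Inr ` E) \<in> C"
        unfolding C_def tedges_def using j Q(1)[OF E] by (intro imageI) (auto simp: J_def)
      moreover have "f ` insert (Inl j) (Inr ` E) \<notin> T"
      proof
        assume "f ` insert (Inl j) (Inr ` E) \<in> T"
        then have "f ` insert (Inl j) (Inr ` E) \<in> tedges {1..m} (nsets V k)" using T by blast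
        then obtain j' e where "f ` insert (Inl j) (Inr ` E) = insert (Inl j') (Inr ` e)"
          by (rule tedge_cases)
        moreover have "f ` insert (Inl j) (Inr ` E) \<subseteq> Y" using j Q(3)[OF E] by (auto simp: J_def)
        ultimately have "Inl j' \<in> Y" by blast
        then show False by (auto simp: Y_def)
      qed
      ultimately show "f ` insert (Inl j) (Inr ` E) \<in> C - T" by blast
    qed
  qed
  then have JQ: "card J * card ?Q \<le> card (sym_diff T C)"
    using CT by (simp add: card_cartesian_product)
  \<comment> \<open>Vertices that are images of colours fall into \<open>B\<close>, whence the term
    card J in the bound for card B.\<close>
  define A where "A = {v \<in> V. \<exists>a\<in>A0. f (Inr a) = Inr v}"
  define B where "B = V - A"
  have AB: "A \<union> B = V" "A \<inter> B = {}" by (auto simp: A_def B_def)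
  have fin: "finite A" "finite B" using AB V by auto
  have "card A \<le> card A0"
  proof -
    have "Inr ` A \<subseteq> (f \<circ> Inr) ` A0" by (force simp: A_def)
    then have "card (Inr ` A :: (nat + 'a) set) \<le> card ((f \<circ> Inr) ` A0)"
      using fin0 by (intro card_mono) auto
    also have "\<dots> \<le> card A0" using fin0(1) by (rule card_image_le)
    finally show ?thesis by (simp add: card_image)
  qed
  moreover have "card B \<le> card B0 + card J"
  proof -
    have "Inr v \<in> (f \<circ> Inr) ` B0 \<union> (f \<circ> Inl) ` J" if v: "v \<in> B" for v
    proof -
      have vV: "v \<in> V" using v by (simp add: B_def)
      then obtain x where x: "x \<in> ?W" "f x = Inr v" using InrW img by (metis imageE)
      show ?thesis
      proof (cases x)
        case (Inl j)
        then have "j \<in> J" using x vV by (auto simp: J_def T_verts_def Y_def)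
        then show ?thesis using x Inl by force
      next
        case (Inr u)
        then have "u \<in> V" using x by (auto simp: T_verts_def)
        moreover have "u \<notin> A0" using x Inr v by (auto simp: A_def B_def)
        ultimately have "u \<in> B0" using AB0 by blast
        then show ?thesis using x Inr by force
      qed
    qed
    then have "card (Inr ` B :: (nat + 'a) set) \<le> card ((f \<circ> Inr) ` B0 \<union> (f \<circ> Inl) ` J)"
      using fin0 by (intro card_mono) (auto simp: J_def)
    also have "\<dots> \<le> card ((f \<circ> Inr) ` B0) + card ((f \<circ> Inl) ` J)" by (rule card_Un_le)
    also have "\<dots> \<le> card B0 + card J"
      using fin0 by (intro add_mono card_image_le) (auto simp: J_def)
    finally show ?thesis by (simp add: card_image)
  qed
  moreover have "card A + card B = card A0 + card B0"
    using card_Un_disjoint[OF fin AB(2)] card_Un_disjoint[OF fin0 AB0(2)] AB AB0 by simp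
  ultimately have bal: "\<bar>real (card A) - real (card B)\<bar> \<le> \<bar>real (card A0) - real (card B0)\<bar> + 2 * real (card J)"
    by linarith
  \<comment> \<open>The colours that are not images of colours and the vertices that are, at most
    card J of each kind. An edge avoiding \<open>Z\<close> is the image of one colour and k
    vertices, with the same parity, so it lies in \<open>C\<close>.\<close>
  define Z where "Z = (X - f ` X) \<union> (Y \<inter> f ` X)"
  have finZ: "finite Z" using W by (auto simp: Z_def)
  have cZ: "card Z \<le> 2 * card J"
  proof -
    have XW: "X \<subseteq> ?W" using W by simp
    have "Y \<inter> f ` X \<subseteq> (f \<circ> Inl) ` J" by (auto simp: X_def J_def)
    then have "card (Y \<inter> f ` X) \<le> card ((f \<circ> Inl) ` J)" by (intro card_mono) (auto simp: J_def)
    also have "\<dots> \<le> card J" by (intro card_image_le) (simp add: J_def)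
    finally have 1: "card (Y \<inter> f ` X) \<le> card J" .
    have "f ` X \<subseteq> X \<union> Y" using XW img W(1) by blast
    then have fX: "f ` X = (X \<inter> f ` X) \<union> (Y \<inter> f ` X)" by blast
    have "card (f ` X) = m" using card_image[OF inj_on_subset[OF inj XW]] W by simp
    moreover have "card ((X \<inter> f ` X) \<union> (Y \<inter> f ` X)) = card (X \<inter> f ` X) + card (Y \<inter> f ` X)"
      using W by (intro card_Un_disjoint) auto
    ultimately have "card (X \<inter> f ` X) + card (Y \<inter> f ` X) = m" using fX by simp
    moreover have "card X = card (X \<inter> f ` X) + card (X - f ` X)"
      using W(4) by (rule card_Int_Diff)
    ultimately have "card (X - f ` X) \<le> card J" using 1 W(6) by linarith
    then show ?thesis unfolding Z_def using 1 card_Un_le[of "X - f ` X" "Y \<inter> f ` X"] by linarith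
  qed
  have "tedges {1..m} (parity_graph k i A B) - T \<subseteq> (C - T) \<union> {E \<in> nsets ?W (k + 1). E \<inter> Z \<noteq> {}}"
  proof
    fix E assume E: "E \<in> tedges {1..m} (parity_graph k i A B) - T"
    then obtain j e where je: "E = insert (Inl j) (Inr ` e)" "j \<in> {1..m}" "e \<in> parity_graph k i A B"
      by (blast elim: tedge_cases)
    have e: "e \<subseteq> V" "finite e" "card e = k" "card (e \<inter> A) mod 2 = i"
      using je(3) AB by (auto simp: parity_graph_def nsets_def)
    have "E \<in> tedges {1..m} (nsets V k)" using je e by (auto simp: tedges_def nsets_def)
    then have EW: "E \<in> nsets ?W (k + 1)" using tedges_subset_nsets by blast
    show "E \<in> (C - T) \<union> {E \<in> nsets ?W (k + 1). E \<inter> Z \<noteq> {}}"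
    proof (cases "E \<inter> Z = {}")
      case False
      then show ?thesis using EW by blast
    next
      case True
      have "Inl j \<in> X" using je by (auto simp: X_def)
      then have "Inl j \<in> f ` X" using True je(1) by (auto simp: Z_def)
      then obtain j' where j': "j' \<in> {1..m}" "f (Inl j') = Inl j" by (auto simp: X_def)
      define e' where "e' = {v \<in> V. f (Inr v) \<in> Inr ` e}"
      have lift: "\<exists>v'\<in>V. f (Inr v') = Inr v" if v: "v \<in> e" for v
      proof -
        have "Inr v \<notin> f ` X"
        proof
          assume "Inr v \<in> f ` X"
          then have "Inr v \<in> Z" using v e(1) by (auto simp: Z_def Y_def)
          then show False using True je(1) v by auto
        qed
        moreover have "Inr v \<in> f ` ?W" using InrW v e(1) img by blast
        ultimately have "Inr v \<in> f ` Y" unfolding W(1) by blast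
        then show ?thesis by (auto simp: Y_def)
      qed
      have bij: "card {v \<in> V. f (Inr v) \<in> Inr ` d} = card d" if d: "d \<subseteq> e" for d
      proof -
        have "(f \<circ> Inr) ` {v \<in> V. f (Inr v) \<in> Inr ` d} = Inr ` d"
        proof (intro equalityI subsetI)
          fix x :: "nat + 'a" assume "x \<in> Inr ` d"
          then obtain v where v: "v \<in> d" "x = Inr v" by blast
          then obtain v' where "v' \<in> V" "f (Inr v') = Inr v" using lift d by blast
          then show "x \<in> (f \<circ> Inr) ` {v \<in> V. f (Inr v) \<in> Inr ` d}" using v by force
        qed auto
        moreover have "inj_on (f \<circ> Inr) {v \<in> V. f (Inr v) \<in> Inr ` d}"
          by (intro inj_onI Inr_inj) auto
        ultimately have "card {v \<in> V. f (Inr v) \<in> Inr ` d} = card (Inr ` d :: (nat + 'a) set)"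
          using card_image by metis
        then show ?thesis by (simp add: card_image)
      qed
      have "e' \<inter> A0 = {v \<in> V. f (Inr v) \<in> Inr ` (e \<inter> A)}"
      proof (intro equalityI subsetI)
        fix u assume "u \<in> e' \<inter> A0"
        then obtain v where "u \<in> V" "v \<in> e" "f (Inr u) = Inr v" "u \<in> A0" by (auto simp: e'_def)
        then show "u \<in> {v \<in> V. f (Inr v) \<in> Inr ` (e \<inter> A)}" using e(1) by (auto simp: A_def)
      next
        fix u assume "u \<in> {v \<in> V. f (Inr v) \<in> Inr ` (e \<inter> A)}"
        then obtain v where v: "u \<in> V" "v \<in> e" "v \<in> A" "f (Inr u) = Inr v" by auto
        then obtain a where a: "a \<in> A0" "f (Inr a) = Inr v" by (auto simp: A_def)
        then have "Inr a = (Inr u :: nat + 'a)"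
          using inj_onD[OF inj] v InrW AB0(1) by (metis UnI1)
        then show "u \<in> e' \<inter> A0" using a v by (auto simp: e'_def)
      qed
      then have "card (e' \<inter> A0) = card (e \<inter> A)" using bij[of "e \<inter> A"] by simp
      moreover have "card e' = k" using bij[of e] e unfolding e'_def by simp
      moreover have "e' \<subseteq> V" "finite e'" using V by (auto simp: e'_def)
      ultimately have "e' \<in> ?P0" using e AB0 by (simp add: parity_graph_def nsets_def)
      moreover have "f ` insert (Inl j') (Inr ` e') = E"
      proof -
        have "f ` Inr ` e' = Inr ` e"
        proof (intro equalityI subsetI)
          fix x :: "nat + 'a" assume "x \<in> Inr ` e"
          then obtain v where v: "v \<in> e" "x = Inr v" by blast
          then obtain v' where "v' \<in> V" "f (Inr v') = Inr v" using lift by blast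
          then show "x \<in> f ` Inr ` e'" using v by (force simp: e'_def)
        qed (auto simp: e'_def)
        then show ?thesis using j' je(1) by simp
      qed
      ultimately have "E \<in> C" unfolding C_def tedges_def using j'(1) by blast
      then show ?thesis using E by blast
    qed
  qed
  moreover have "finite {E \<in> nsets ?W (k + 1). E \<inter> Z \<noteq> {}}"
    using finite_imp_finite_nsets[OF W(3)] by simp
  ultimately have "card (tedges {1..m} (parity_graph k i A B) - T) \<le>
      card ((C - T) \<union> {E \<in> nsets ?W (k + 1). E \<inter> Z \<noteq> {}})"
    using finC by (intro card_mono) auto
  also have "\<dots> \<le> card (C - T) + card {E \<in> nsets ?W (k + 1). E \<inter> Z \<noteq> {}}" by (rule card_Un_le)
  also have "\<dots> \<le> card (sym_diff T C) + card Z * card ?W ^ k"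
    using CT card_meeting_le[OF W(3) finZ, of k] by (rule add_mono)
  also have "\<dots> \<le> card (sym_diff T C) + 2 * card J * card ?W ^ k"
    using cZ by (intro add_left_mono mult_right_mono) auto
  finally have close: "card (tedges {1..m} (parity_graph k i A B) - T) \<le>
      card (sym_diff T C) + 2 * card J * card ?W ^ k" .
  have "real (card J) * (real b / real k) ^ k \<le> real (card J) * real (card ?Q)"
    using cQ by (intro mult_left_mono) auto
  also have "\<dots> = real (card J * card ?Q)" by simp
  also have "\<dots> \<le> real (card (sym_diff T C))" using JQ by (simp only: of_nat_le_iff)
  finally show ?thesis using that[OF AB bal _ close] by blast
qed

text \<open>Each side has at least 5 k m / 12, hence at least 5 m / 4 vertices. Of these m may be
  lost to colours under the permutation, and the rest is the number \<open>b\<close> in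
  \<open>copy_reduction\<close>.\<close>

lemma balanced_partition_part_ge:
  fixes a b k m :: nat
  assumes k: "3 \<le> k" and ab: "a + b = k * m" and bal: "\<bar>real a - real b\<bar> \<le> real (k * m) / 6"
  shows "m div 4 + m \<le> a"
proof -
  have "real a + real b = real (k * m)" using ab by (metis of_nat_add)
  then have "5 / 12 * real (k * m) \<le> real a" using bal by linarith
  moreover have "3 * m \<le> k * m" using k by (rule mult_le_mono1)
  then have "3 * real m \<le> real (k * m)" by (metis of_nat_le_iff of_nat_mult of_nat_numeral)
  ultimately have "5 / 4 * real m \<le> real a" by linarith
  then have "5 * m \<le> 4 * a" by linarith
  then show ?thesis by linarith
qed

section \<open>Choice of \<epsilon> and combination of the estimates\<close>

theorem mainTheorem3:
  fixes k l :: nat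
  assumes "k \<ge> 3" and "real k / 2 \<le> real l" and "l \<le> k - 1"
  shows "\<exists>\<epsilon>>0. \<exists>n\<^sub>0::nat. \<forall>(V::'a set) n (H::nat \<Rightarrow> 'a set set) H_ext.
      finite V \<and> card V = n \<and> n \<ge> n\<^sub>0 \<and> k dvd n \<and>
      (\<forall>i\<in>{1..n div k}. H i \<subseteq> nsets V k) \<and>
      is_H_ext V k l H_ext \<and>
      close_to \<epsilon> (k + 1) (T_verts (n div k) V)
        (T_graph (n div k) H) (T_graph (n div k) (\<lambda>_. H_ext)) \<and>
      (\<forall>i\<in>{1..n div k}. min_deg V l (H i) > delta_ext V k l)
      \<longrightarrow> (\<exists>M. perfect_matching (T_verts (n div k) V) (T_graph (n div k) H) M)"
proof -
  have k: "3 \<le> k" and l: "1 \<le> l" "l < k" using assms by linarith+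
  obtain c n1 where c: "0 < c" and deg: "\<And>(V :: 'a set) H U. finite V \<Longrightarrow> n1 \<le> card V \<Longrightarrow>
    H \<subseteq> nsets V k \<Longrightarrow> delta_ext V k l < min_deg V l H \<Longrightarrow> U \<subseteq> V \<Longrightarrow> card U \<le> 1 \<Longrightarrow>
    c * real (card V) ^ (k - card U) \<le> real (card {E \<in> H. U \<subseteq> E})"
    using vertex_degree_linear[OF l] by blast
  show ?thesis
  proof (rule perfect_matching_if_near_parity_graph[OF k c])
    fix \<gamma> m0 assume \<gamma>: "0 < \<gamma>" and core: "\<And>m (V :: 'a set) A B i H. m0 \<le> m \<Longrightarrow> finite V \<Longrightarrow>
      card V = k * m \<Longrightarrow> A \<union> B = V \<Longrightarrow> A \<inter> B = {} \<Longrightarrow> i < 2 \<Longrightarrow> (\<And>j. j \<in> {1..m} \<Longrightarrow> H j \<subseteq> nsets V k) \<Longrightarrow>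
      \<bar>real (card A) - real (card B)\<bar> \<le> \<gamma> * real m \<Longrightarrow>
      real (card (tedges {1..m} (parity_graph k i A B) - T_graph m H)) \<le> \<gamma> * real m ^ (k + 1) \<Longrightarrow>
      (\<And>w. w \<in> T_verts m V \<Longrightarrow> c * real m ^ k \<le> real (card {E \<in> T_graph m H. w \<in> E})) \<Longrightarrow>
      avoids_parity m k i V H \<Longrightarrow> \<exists>M. perfect_matching (T_verts m V) (T_graph m H) M"
    \<comment> \<open>1 / 6 is the imbalance allowed by \<open>balanced_partition_part_ge\<close>;
      \<gamma> / (2 k) turns a bound in terms of n = k m into \<gamma> m / 2.\<close>
    define \<beta> where "\<beta> = min (1 / 6) (\<gamma> / (2 * real k))"
    have \<beta>: "0 < \<beta>" "\<beta> \<le> 1 / 6" "\<beta> \<le> \<gamma> / (2 * real k)" using \<gamma> k by (auto simp: \<beta>_def)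
    obtain n2 where bal: "\<And>(V :: 'a set) i A B. finite V \<Longrightarrow> n2 \<le> card V \<Longrightarrow> k dvd card V \<Longrightarrow>
      attains V k l i A B \<Longrightarrow> \<bar>real (card A) - real (card B)\<bar> \<le> \<beta> * real (card V)"
      using attains_balanced[OF l \<beta>(1)] by blast
    \<comment> \<open>\<open>P\<close> converts card W ^ (k + 1) into P m^(k + 1); \<open>Q\<close>
      comes from m div 4 \<ge> m / 8, by which (m div 4 / k)^k is at least m^k / Q.\<close>
    define P where "P = real (k + 1) ^ (k + 1)"
    define Q where "Q = (8 * real k) ^ k"
    have P1: "1 \<le> P" and Q1: "1 \<le> Q" unfolding P_def Q_def using k by (intro one_le_power; simp)+
    \<comment> \<open>Closeness bounds the number N of displaced colours by \<epsilon> P Q m. It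
      costs 2 N in the balance and at most 2 N P m^k missing edges; this \<epsilon> keeps the cost
      in balance at most \<gamma> m / 2 and all missing edges together at most \<gamma> m^(k + 1) /
      2.\<close>
    define \<epsilon> where "\<epsilon> = \<gamma> / (4 * P * Q * (P + 1))"
    have \<epsilon>: "0 < \<epsilon>" using \<gamma> P1 Q1 by (simp add: \<epsilon>_def)
    have eps: "\<epsilon> * P * Q * (P + 1) = \<gamma> / 4"
    proof -
      have "P \<noteq> 0" "Q \<noteq> 0" "P + 1 \<noteq> 0" using P1 Q1 by linarith+
      moreover have "\<gamma> / (4 * P * Q * R) * P * Q * R = \<gamma> / 4" if "P \<noteq> 0" "Q \<noteq> 0" "R \<noteq> 0" for R
        using that by simp
      ultimately show ?thesis unfolding \<epsilon>_def by blast
    qed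
    \<comment> \<open>4 k \<le> m gives k \<le> m div 4, and 8 \<le> m gives m / 8 \<le> m div
      4.\<close>
    define n0 where "n0 = max (max n1 n2) (k * max (max m0 (4 * k)) 8)"
    show ?thesis
    proof (intro exI[of _ \<epsilon>] conjI \<epsilon> exI[of _ n0] allI impI)
      fix V :: "'a set" and n and H :: "nat \<Rightarrow> 'a set set" and H_ext
      assume hyp: "finite V \<and> card V = n \<and> n \<ge> n0 \<and> k dvd n \<and>
        (\<forall>i\<in>{1..n div k}. H i \<subseteq> nsets V k) \<and>
        is_H_ext V k l H_ext \<and>
        close_to \<epsilon> (k + 1) (T_verts (n div k) V)
          (T_graph (n div k) H) (T_graph (n div k) (\<lambda>_. H_ext)) \<and>
        (\<forall>i\<in>{1..n div k}. min_deg V l (H i) > delta_ext V k l)"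
      define m where "m = n div k"
      have V: "finite V" and n: "card V = n" "n0 \<le> n" "k dvd n" using hyp by auto
      have nkm: "n = k * m" using n(3) by (simp add: m_def)
      have cV: "card V = k * m" using n nkm by simp
      have H: "H j \<subseteq> nsets V k" and Hdeg: "delta_ext V k l < min_deg V l (H j)" if "j \<in> {1..m}" for j
        using hyp that by (auto simp: m_def)
      have "k * max (max m0 (4 * k)) 8 \<le> k * m" using n(2) nkm by (simp add: n0_def)
      then have "max (max m0 (4 * k)) 8 \<le> m" using k by simp
      then have m: "m0 \<le> m" "4 * k \<le> m" "8 \<le> m" by simp_all
      have n12: "n1 \<le> card V" "n2 \<le> card V" using n by (simp_all add: n0_def)
      obtain i A0 B0 where att: "attains V k l i A0 B0" and Hext: "H_ext = parity_graph k i A0 B0"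
        using hyp by (auto simp: is_H_ext_def)
      have AB0: "A0 \<union> B0 = V" "A0 \<inter> B0 = {}" and i: "i < 2"
        using att by (auto simp: attains_def ext_triple_def)
      have "finite A0" "finite B0" using AB0 V by auto
      then have c0: "card A0 + card B0 = k * m" using card_Un_disjoint[OF _ _ AB0(2)] AB0(1) cV by simp
      have bal0: "\<bar>real (card A0) - real (card B0)\<bar> \<le> \<beta> * real (k * m)"
        using bal[OF V n12(2) _ att] n(3) cV n(1) by simp
      also have "\<dots> \<le> 1 / 6 * real (k * m)" using \<beta>(2) by (intro mult_right_mono) auto
      finally have bal6: "\<bar>real (card A0) - real (card B0)\<bar> \<le> real (k * m) / 6" by simp
      have part: "m div 4 + m \<le> card A0" "m div 4 + m \<le> card B0"
        using balanced_partition_part_ge[OF k, of "card A0" "card B0" m]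
          balanced_partition_part_ge[OF k, of "card B0" "card A0" m] c0 bal6
        by (simp_all add: abs_minus_commute add.commute)
      let ?W = "T_verts m V" and ?T = "T_graph m H"
      have cW: "real (card ?W) = real (k + 1) * real m"
        using V cV by (simp add: T_verts_def card_Plus algebra_simps)
      have TC: "T_graph m (\<lambda>_. H_ext) = tedges {1..m} (parity_graph k i A0 B0)"
        unfolding Hext T_graph_def tedges_def by (auto simp: vertex_insert_inject)
      obtain f where f: "bij_betw f ?W ?W"
        and sd: "real (card (sym_diff ?T ((\<lambda>E. f ` E) ` tedges {1..m} (parity_graph k i A0 B0)))) \<le>
          \<epsilon> * real (card ?W) ^ (k + 1)"
        using hyp unfolding close_to_def is_copy_def m_def[symmetric] TC by blast
      obtain A B N where AB: "A \<union> B = V" "A \<inter> B = {}"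
        and balAB: "\<bar>real (card A) - real (card B)\<bar> \<le> \<bar>real (card A0) - real (card B0)\<bar> + 2 * real N"
        and N: "real N * (real (m div 4) / real k) ^ k \<le>
          real (card (sym_diff ?T ((\<lambda>E. f ` E) ` tedges {1..m} (parity_graph k i A0 B0))))"
        and close: "card (tedges {1..m} (parity_graph k i A B) - ?T) \<le>
          card (sym_diff ?T ((\<lambda>E. f ` E) ` tedges {1..m} (parity_graph k i A0 B0))) + 2 * N * card ?W ^ k"
      proof (rule copy_reduction[OF V _ i AB0 T_graph_subset_tedges[OF H] f _ part])
        show "2 \<le> k" "k \<le> m div 4" using k m by auto
      qed
      have mpos: "0 < real m" using m by simp
      have sd': "real (card (sym_diff ?T ((\<lambda>E. f ` E) ` tedges {1..m} (parity_graph k i A0 B0)))) \<le>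
          \<epsilon> * P * real m ^ (k + 1)"
        using sd unfolding cW P_def power_mult_distrib by (simp only: mult.assoc)
      have "real m / 8 \<le> real (m div 4)" using m by linarith
      then have "(real m / 8 / real k) ^ k \<le> (real (m div 4) / real k) ^ k"
        using k by (intro power_mono divide_right_mono) auto
      then have "real N * (real m / 8 / real k) ^ k \<le> real N * (real (m div 4) / real k) ^ k"
        by (intro mult_left_mono) auto
      also have "\<dots> \<le> \<epsilon> * P * real m ^ (k + 1)" using N sd' by linarith
      finally have "real N * (real m / 8 / real k) ^ k \<le> \<epsilon> * P * real m ^ (k + 1)" .
      moreover have "(real m / 8 / real k) ^ k = real m ^ k / Q"
        by (simp add: Q_def power_divide divide_divide_eq_left)
      ultimately have "real N * (real m ^ k / Q) * Q \<le> \<epsilon> * P * real m ^ (k + 1) * Q"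
        using Q1 by (intro mult_right_mono) auto
      moreover have "real N * (real m ^ k / Q) * Q = real N * real m ^ k" using Q1 by simp
      ultimately have "real N * real m ^ k \<le> (\<epsilon> * P * Q * real m) * real m ^ k"
        by (simp add: mult_ac)
      then have N': "real N \<le> \<epsilon> * P * Q * real m" using mpos by (simp add: mult_le_cancel_right)
      have small: "\<epsilon> * P * Q + \<epsilon> * P * Q * P = \<gamma> / 4" using eps by (simp add: algebra_simps)
      have pos: "0 \<le> \<epsilon> * P * Q" "0 \<le> \<epsilon> * P" using \<epsilon> P1 Q1 by auto
      have "\<exists>M. perfect_matching ?W ?T M"
      proof (rule core[OF m(1) V cV AB i H])
        show "\<bar>real (card A) - real (card B)\<bar> \<le> \<gamma> * real m"
        proof -
          have "\<beta> * real (k * m) \<le> \<gamma> / (2 * real k) * real (k * m)"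
            using \<beta>(3) by (intro mult_right_mono) auto
          also have "\<dots> = \<gamma> / 2 * real m" using k by simp
          finally have 1: "\<beta> * real (k * m) \<le> \<gamma> / 2 * real m" .
          have "\<epsilon> * P * Q \<le> \<gamma> / 4" using small pos P1 by (smt (verit) mult_nonneg_nonneg)
          then have "\<epsilon> * P * Q * real m \<le> \<gamma> / 4 * real m" by (intro mult_right_mono) auto
          then have "2 * real N \<le> \<gamma> / 2 * real m" using N' by (simp add: field_simps)
          then have "\<bar>real (card A) - real (card B)\<bar> \<le> \<gamma> / 2 * real m + \<gamma> / 2 * real m"
            using balAB bal0 1 by linarith
          then show ?thesis by simp
        qed
        show "real (card (tedges {1..m} (parity_graph k i A B) - ?T)) \<le> \<gamma> * real m ^ (k + 1)"
        proof -
          have "real (card ?W) ^ k \<le> P * real m ^ k"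
            unfolding cW P_def power_mult_distrib by (intro mult_right_mono power_increasing) auto
          then have "real N * real (card ?W) ^ k \<le> (\<epsilon> * P * Q * real m) * (P * real m ^ k)"
            using N' pos by (intro mult_mono) auto
          also have "\<dots> = (\<epsilon> * P * Q * P) * real m ^ (k + 1)" by simp
          finally have 1: "real N * real (card ?W) ^ k \<le> (\<epsilon> * P * Q * P) * real m ^ (k + 1)" .
          have "\<epsilon> * P * 1 \<le> \<epsilon> * P * Q" using pos Q1 by (intro mult_left_mono) auto
          then have "\<epsilon> * P * real m ^ (k + 1) \<le> (\<epsilon> * P * Q) * real m ^ (k + 1)"
            by (intro mult_right_mono) auto
          moreover have "real (card (tedges {1..m} (parity_graph k i A B) - ?T)) \<le>
            real (card (sym_diff ?T ((\<lambda>E. f ` E) ` tedges {1..m} (parity_graph k i A0 B0)))) +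
            2 * (real N * real (card ?W) ^ k)"
          proof -
            have "real (card (tedges {1..m} (parity_graph k i A B) - ?T)) \<le>
              real (card (sym_diff ?T ((\<lambda>E. f ` E) ` tedges {1..m} (parity_graph k i A0 B0))) +
                2 * N * card ?W ^ k)" using close by (simp only: of_nat_le_iff)
            then show ?thesis by simp
          qed
          ultimately have "real (card (tedges {1..m} (parity_graph k i A B) - ?T)) \<le>
            (\<epsilon> * P * Q) * real m ^ (k + 1) + 2 * ((\<epsilon> * P * Q * P) * real m ^ (k + 1))"
            using sd' 1 by linarith
          also have "\<dots> \<le> 2 * ((\<epsilon> * P * Q) * real m ^ (k + 1)) + 2 * ((\<epsilon> * P * Q * P) * real m ^ (k + 1))"
            using mult_nonneg_nonneg[OF pos(1) zero_le_power[OF of_nat_0_le_iff], of m "k + 1"] by linarith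
          also have "\<dots> = 2 * ((\<epsilon> * P * Q + \<epsilon> * P * Q * P) * real m ^ (k + 1))"
            by (simp only: distrib_left distrib_right)
          also have "\<dots> = \<gamma> / 2 * real m ^ (k + 1)" unfolding small by simp
          also have "\<dots> \<le> \<gamma> * real m ^ (k + 1)" using \<gamma> by (intro mult_right_mono) auto
          finally show ?thesis .
        qed
        show "c * real m ^ k \<le> real (card {E \<in> ?T. w \<in> E})" if "w \<in> ?W" for w
          using k c deg[OF V n12(1) H Hdeg] that by (intro T_graph_degree_lower[OF V cV _ H]) auto
        show "avoids_parity m k i V H"
        proof (rule avoids_parity_if_min_deg[OF V cV l(2) _ i H Hdeg])
          have "k * 1 \<le> k * m" using m by (intro mult_left_mono) auto
          then show "l \<le> card V" using l cV by linarith
        qed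
      qed
      then show "\<exists>M. perfect_matching (T_verts (n div k) V) (T_graph (n div k) H) M"
        unfolding m_def .
    qed
  qed
qed

end
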